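(* The monodromy of Klassen's open book for $P^2\times S^1$, whose page is a Klein bottle with one hole $K$, is given by the $Y$-homeomorphism $y\in Map(K)$ of Lickorish. That is, under a suitable identification of the page with $K$, the monodromy, as an element of $Map(K)$, is the class of a $Y$-homeomorphism.
   Context: $P^2$ is the real projective plane, viewed as the closed unit disk $D^2\subset\mathbb{C}$ with antipodal points of $\partial D^2$ identified. The map $z\mapsto -z$ of $D^2$ descends to a homeomorphism $\varphi:P^2\to P^2$, which is isotopic to the identity, so $P^2\times[0,1]/\big((x,1)\sim(\varphi(x),0)\big)$ is homeomorphic to $P^2\times S^1$. Klassen's open book: the map $p:\big(D^2-\{-\tfrac12,\tfrac12\}\big)\times[0,1]\to S^1$, $p(z,t)=\dfrac{z^2-\frac14}{|z^2-\frac14|}e^{2\pi i t}$, induces a fibration over the unit circle $S^1\subset \mathbb{C}$ of the complement in $P^2\times S^1$ of the knot $B=\big(\{-\tfrac12,\tfrac12\}\times[0,1]\big)/\sim$. Klassen's open book is the resulting open book with binding $B$ and pages $B\cup p^{-1}(e^{2\pi i s})$ (more precisely, the images in the quotient). $K$ is the Klein bottle with one hole, i.e. the compact nonorientable surface of genus two with one boundary component. $Map(K)$ is its mapping class group: homeomorphisms fixing $\partial K$ pointwise, up to isotopy fixing $\partial K$ pointwise. The monodromy of an open book is the class in the mapping class group of the page of the return map of a flow transverse to the interiors of the pages and meridional near the binding (so that it fixes the boundary of the page pointwise). $Y$-homeomorphism (crosscap slide): model $K$ as an octagon, namely the square $[-1,1]^2$ with its four corners cut off, with its left and right edges identified by $(-1,s)\sim(1,s)$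 and its top and bottom edges identified by $(s,1)\sim(-s,-1)$; the four corner arcs form $\partial K$. Let $\alpha$ be the two-sided circle given by the horizontal midline and $\beta$ the one-sided circle given by the vertical midline. The reflection of the octagon through $\alpha$, $(x_1,x_2)\mapsto(x_1,-x_2)$, induces a homeomorphism $r:K\to K$ which rotates $\partial K$ by a half turn. Post-composing $r$ with a half twist in a collar of $\partial K$ gives a homeomorphism $y$ fixing $\partial K$ pointwise. The two possible half twists give two maps, inverse to each other in $Map(K)$; each is called a $Y$-homeomorphism of Lickorish. *)

theory Defs
  imports "HOL-Analysis.Analysis"
begin

section \<open>Gluing\<close>

text \<open>The points of a glued space are the classes of the equivalence relation generated by
  \<open>R\<close>; the topology is the quotient topology.\<close>

definition glue_rel :: "'a topology \<Rightarrow> ('a \<times> 'a) set \<Rightarrow> ('a \<times> 'a) set" where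
  "glue_rel X R = Restr ((R \<union> R\<inverse>)\<^sup>*) (topspace X)"

definition glue_proj :: "'a topology \<Rightarrow> ('a \<times> 'a) set \<Rightarrow> 'a \<Rightarrow> 'a set" where
  "glue_proj X R x = glue_rel X R `` {x}"

definition glue :: "'a topology \<Rightarrow> ('a \<times> 'a) set \<Rightarrow> 'a set topology" where
  "glue X R = topology (\<lambda>U. U \<subseteq> topspace X // glue_rel X R \<and>
                             openin X {x \<in> topspace X. glue_proj X R x \<in> U})"

lemma openin_glue:
  "openin (glue X R) U \<longleftrightarrow>
     U \<subseteq> topspace X // glue_rel X R \<and> openin X {x \<in> topspace X. glue_proj X R x \<in> U}"
proof -
  have *: "{x \<in> topspace X. glue_proj X R x \<in> S \<inter> T} =
      {x \<in> topspace X. glue_proj X R x \<in> S} \<inter> {x \<in> topspace X. glue_proj X R x \<in> T}" for S T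
    by auto
  have **: "{x \<in> topspace X. glue_proj X R x \<in> \<Union>\<K>} =
      (\<Union>S\<in>\<K>. {x \<in> topspace X. glue_proj X R x \<in> S})" for \<K>
    by auto
  have "istopology (\<lambda>U. U \<subseteq> topspace X // glue_rel X R \<and>
                          openin X {x \<in> topspace X. glue_proj X R x \<in> U})"
    unfolding istopology_def * ** by (auto intro!: openin_Union simp: Sup_le_iff)
  then show ?thesis
    unfolding glue_def by simp
qed

lemma quotient_map_glue: "quotient_map X (glue X R) (glue_proj X R)"
proof -
  have sub: "glue_proj X R ` topspace X = topspace X // glue_rel X R"
    by (auto simp: quotient_def glue_proj_def)
  have "{x \<in> topspace X. glue_proj X R x \<in> topspace X // glue_rel X R} = topspace X"
    using sub by auto
  then have "openin (glue X R) (topspace X // glue_rel X R)"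
    by (simp add: openin_glue)
  then have "topspace (glue X R) = topspace X // glue_rel X R"
    by (metis openin_glue openin_subset openin_topspace subset_antisym)
  with sub show ?thesis
    unfolding quotient_map_def openin_glue by auto
qed

lemma glue_proj_eq_iff:
  assumes "x \<in> topspace X" "y \<in> topspace X"
  shows "glue_proj X R x = glue_proj X R y \<longleftrightarrow> (x, y) \<in> (R \<union> R\<inverse>)\<^sup>*"
proof -
  have "sym ((R \<union> R\<inverse>)\<^sup>*)"
    by (intro sym_rtrancl sym_Un_converse)
  then have "equiv (topspace X) (glue_rel X R)"
    by (auto simp: glue_rel_def equiv_def refl_on_def sym_def trans_def intro: rtrancl_trans)
  then show ?thesis
    using assms eq_equiv_class_iff [of "topspace X" "glue_rel X R" x y]
    by (simp add: glue_proj_def) (simp add: glue_rel_def)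
qed

lemma glue_proj_eqI:
  assumes "(x, y) \<in> R" "x \<in> topspace X" "y \<in> topspace X"
  shows "glue_proj X R x = glue_proj X R y"
  using assms by (simp add: glue_proj_eq_iff r_into_rtrancl)


section \<open>Mapping class groups\<close>

text \<open>Homeomorphisms of \<open>X\<close> fixing \<open>D\<close> pointwise, modulo isotopy through such homeomorphisms.
  Maps are \<^const>\<open>undefined\<close> off \<open>topspace X\<close>, so that equality of functions is equality of
  self-maps of \<open>X\<close>.\<close>

definition homeos_fixing :: "'a topology \<Rightarrow> 'a set \<Rightarrow> ('a \<Rightarrow> 'a) set" where
  "homeos_fixing X D =
     {f \<in> extensional (topspace X). homeomorphic_map X X f \<and> (\<forall>x\<in>D. f x = x)}"

definition isotopy_rel :: "'a topology \<Rightarrow> 'a set \<Rightarrow> (('a \<Rightarrow> 'a) \<times> ('a \<Rightarrow> 'a)) set" where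
  "isotopy_rel X D =
     {(f, h). f \<in> homeos_fixing X D \<and> h \<in> homeos_fixing X D \<and>
       homotopic_with (\<lambda>k. homeomorphic_map X X k \<and> (\<forall>x\<in>D. k x = x)) X X f h}"

definition mapping_class_group :: "'a topology \<Rightarrow> 'a set \<Rightarrow> ('a \<Rightarrow> 'a) set set" where
  "mapping_class_group X D = homeos_fixing X D // isotopy_rel X D"

definition mapping_class :: "'a topology \<Rightarrow> 'a set \<Rightarrow> ('a \<Rightarrow> 'a) \<Rightarrow> ('a \<Rightarrow> 'a) set" where
  "mapping_class X D f = isotopy_rel X D `` {restrict f (topspace X)}"

definition transport_class ::
  "'b topology \<Rightarrow> ('a \<Rightarrow> 'b) \<Rightarrow> ('b \<Rightarrow> 'a) \<Rightarrow> ('a \<Rightarrow> 'a) set \<Rightarrow> ('b \<Rightarrow> 'b) set" where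
  "transport_class Y g g' \<mu> = (\<lambda>f. restrict (g \<circ> f \<circ> g') (topspace Y)) ` \<mu>"


section \<open>Monodromy of an open book\<close>

text \<open>An open book in \<open>X\<close> is given by its binding \<open>B\<close> and its fibration
  \<open>p\<close> of \<open>topspace X - B\<close> over the unit circle.\<close>

definition page :: "'a topology \<Rightarrow> 'a set \<Rightarrow> ('a \<Rightarrow> complex) \<Rightarrow> complex \<Rightarrow> 'a set" where
  "page X B p \<zeta> = B \<union> {x \<in> topspace X - B. p x = \<zeta>}"

definition flow_on :: "'a topology \<Rightarrow> (real \<Rightarrow> 'a \<Rightarrow> 'a) \<Rightarrow> bool" where
  "flow_on X \<Phi> \<longleftrightarrow>
     continuous_map (prod_topology euclideanreal X) X (\<lambda>(t, x). \<Phi> t x) \<and>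
     (\<forall>x\<in>topspace X. \<Phi> 0 x = x \<and> (\<forall>s t. \<Phi> (s + t) x = \<Phi> s (\<Phi> t x)))"

text \<open>Topological (positive) transversality: along every orbit off the binding, the argument of
  \<open>p\<close> is strictly increasing.\<close>

definition transverse_to_pages ::
  "'a topology \<Rightarrow> 'a set \<Rightarrow> ('a \<Rightarrow> complex) \<Rightarrow> (real \<Rightarrow> 'a \<Rightarrow> 'a) \<Rightarrow> bool" where
  "transverse_to_pages X B p \<Phi> \<longleftrightarrow>
     (\<forall>x \<in> topspace X - B. \<exists>a. continuous_on UNIV a \<and> strict_mono a \<and>
        (\<forall>t. \<Phi> t x \<notin> B \<and> p (\<Phi> t x) = cis (a t)))"

text \<open>Some tubular neighbourhood \<open>B \<times> D\<^sup>2\<close> of the binding, in which the pages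
  are the half-planes \<open>arg z = const\<close>, is such that the orbits in it are the meridians
  \<open>{b} \<times> {z. norm z = r}\<close>; in particular (\<open>r = 0\<close>) the binding is stationary.\<close>

definition meridional_near_binding ::
  "'a topology \<Rightarrow> 'a set \<Rightarrow> ('a \<Rightarrow> complex) \<Rightarrow> (real \<Rightarrow> 'a \<Rightarrow> 'a) \<Rightarrow> bool" where
  "meridional_near_binding X B p \<Phi> \<longleftrightarrow>
     (\<exists>\<nu>. embedding_map (prod_topology (subtopology X B) (top_of_set (cball 0 1))) X \<nu> \<and>
          (\<exists>U. openin X U \<and> B \<subseteq> U \<and> U \<subseteq> \<nu> ` (B \<times> cball 0 1)) \<and>
          (\<forall>b\<in>B. \<nu> (b, 0) = b) \<and>
          (\<forall>b\<in>B. \<forall>z\<in>cball 0 1 - {0}. p (\<nu> (b, z)) = z / complex_of_real (cmod z)) \<and>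
          (\<forall>b\<in>B. \<forall>z\<in>cball 0 1. \<forall>t. \<exists>w. cmod w = cmod z \<and> \<Phi> t (\<nu> (b, z)) = \<nu> (b, w)))"

definition open_book_flow ::
  "'a topology \<Rightarrow> 'a set \<Rightarrow> ('a \<Rightarrow> complex) \<Rightarrow> (real \<Rightarrow> 'a \<Rightarrow> 'a) \<Rightarrow> bool" where
  "open_book_flow X B p \<Phi> \<longleftrightarrow>
     flow_on X \<Phi> \<and> transverse_to_pages X B p \<Phi> \<and> meridional_near_binding X B p \<Phi>"

text \<open>The first return map to the page \<open>P\<close>; the binding consists of fixed points of the flow.\<close>

definition return_map :: "'a set \<Rightarrow> 'a set \<Rightarrow> (real \<Rightarrow> 'a \<Rightarrow> 'a) \<Rightarrow> 'a \<Rightarrow> 'a" where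
  "return_map P B \<Phi> x = (if x \<in> B then x else \<Phi> (LEAST t. 0 < t \<and> \<Phi> t x \<in> P) x)"

text \<open>\<open>\<mu>\<close> is the mapping class of the return map of one, equivalently of every, flow as above.
  Both existence of a flow and independence of its choice are asserted.\<close>

definition is_monodromy ::
  "'a topology \<Rightarrow> 'a set \<Rightarrow> ('a \<Rightarrow> complex) \<Rightarrow> complex \<Rightarrow> ('a \<Rightarrow> 'a) set \<Rightarrow> bool" where
  "is_monodromy X B p \<zeta> \<mu> \<longleftrightarrow>
     \<mu> \<in> mapping_class_group (subtopology X (page X B p \<zeta>)) B \<and>
     (\<exists>\<Phi>. open_book_flow X B p \<Phi>) \<and>
     (\<forall>\<Phi>. open_book_flow X B p \<Phi> \<longrightarrow>
        mapping_class (subtopology X (page X B p \<zeta>)) B (return_map (page X B p \<zeta>) B \<Phi>) = \<mu>)"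


section \<open>Klassen's open book\<close>

definition projective_plane :: "complex set topology" where
  "projective_plane = glue (top_of_set (cball 0 1)) {(z, - z) |z. cmod z = 1}"

abbreviation solid_cylinder :: "(complex \<times> real) topology" where
  "solid_cylinder \<equiv> top_of_set (cball 0 1 \<times> {0..1})"

text \<open>The first part of the relation makes each slice a projective plane, the second one glues
  the ends by the homeomorphism induced by \<open>z \<mapsto> - z\<close>.\<close>

definition klassen_rel :: "((complex \<times> real) \<times> (complex \<times> real)) set" where
  "klassen_rel = {((z, t), (- z, t)) |z t. cmod z = 1 \<and> t \<in> {0..1}} \<union>
                 {((z, 1), (- z, 0)) |z. cmod z \<le> 1}"

definition klassen_space :: "(complex \<times> real) set topology" where
  "klassen_space = glue solid_cylinder klassen_rel"

definition klassen_binding :: "(complex \<times> real) set set" where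
  "klassen_binding = glue_proj solid_cylinder klassen_rel ` ({- 1/2, 1/2} \<times> {0..1})"

definition klassen_formula :: "complex \<times> real \<Rightarrow> complex" where
  "klassen_formula = (\<lambda>(z, t).
     (z\<^sup>2 - 1/4) / complex_of_real (cmod (z\<^sup>2 - 1/4)) * exp (2 * pi * \<i> * t))"

definition klassen_fibration :: "(complex \<times> real) set \<Rightarrow> complex" where
  "klassen_fibration c = the_elem (klassen_formula ` c)"

definition klassen_page :: "real \<Rightarrow> (complex \<times> real) set topology" where
  "klassen_page s = subtopology klassen_space
     (page klassen_space klassen_binding klassen_fibration (exp (2 * pi * \<i> * s)))"

text \<open>The two invariants \<open>(1 - |z|) z\<close> and \<open>z\<^sup>2\<close> separate the points of the
  projective plane.\<close>

lemma Hausdorff_projective_plane: "Hausdorff_space projective_plane"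
proof -
  define D where "D = top_of_set (cball (0::complex) 1)"
  define R where "R = {(z, - z) |z::complex. cmod z = 1}"
  define G where "G = (\<lambda>z::complex. (complex_of_real (1 - cmod z) * z, z\<^sup>2))"
  have top: "topspace D = cball 0 1" by (simp add: D_def)
  have cont: "continuous_map D euclidean G"
    unfolding D_def G_def by (simp, intro continuous_intros)
  have resp: "G x = G y" if "(x, y) \<in> (R \<union> R\<inverse>)\<^sup>*" for x y
    using that by (induction rule: rtrancl_induct) (auto simp: R_def G_def)
  obtain g where g: "continuous_map (glue D R) euclidean g"
      "\<And>x. x \<in> topspace D \<Longrightarrow> g (glue_proj D R x) = G x"
    using quotient_map_lift_exists [OF quotient_map_glue cont, of R] resp glue_proj_eq_iff
    by metis
  have inj: "glue_proj D R x = glue_proj D R y"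
    if "x \<in> topspace D" "y \<in> topspace D" "G x = G y" for x y
  proof -
    from that(3) have "y = x \<or> y = - x"
      and *: "complex_of_real (1 - cmod x) * x = complex_of_real (1 - cmod y) * y"
      by (auto simp: G_def power2_eq_iff)
    moreover have "y = x \<or> cmod x = 1" if "y = - x"
    proof -
      define c where "c = complex_of_real (1 - cmod x) * x"
      have "c = - c"
        using * unfolding that c_def by (simp only: norm_minus_cancel mult_minus_right)
      then have "c + c = 0"
        using eq_neg_iff_add_eq_0 by blast
      then have "complex_of_real (1 - cmod x) * x = 0"
        unfolding c_def [symmetric] by (simp flip: mult_2)
      then have "complex_of_real (1 - cmod x) = 0 \<or> x = 0"
        by (simp only: mult_eq_0_iff)
      then have "1 - cmod x = 0 \<or> x = 0"
        by (simp only: of_real_eq_0_iff)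
      with that show ?thesis by fastforce
    qed
    ultimately consider "y = x" | "y = - x" "cmod x = 1"
      by blast
    then show ?thesis
    proof cases
      case 2
      then show ?thesis using that by (intro glue_proj_eqI) (auto simp: R_def)
    qed simp
  qed
  have "inj_on g (topspace (glue D R))"
    using g(2) inj quotient_imp_surjective_map [OF quotient_map_glue, of D R]
    by (smt (verit, best) imageE inj_onI)
  then have "Hausdorff_space (glue D R)"
    using Hausdorff_space_injective_preimage [of euclidean "glue D R" g] g(1) by auto
  then show ?thesis
    by (simp add: projective_plane_def D_def R_def)
qed

lemma klassen_space_homeomorphic:
  "klassen_space homeomorphic_space prod_topology projective_plane (top_of_set (sphere (0::complex) 1))"
proof -
  define D where "D = top_of_set (cball (0::complex) 1)"
  define R where "R = {(z, - z) |z::complex. cmod z = 1}"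
  define S where "S = top_of_set (sphere (0::complex) 1)"
  define q where "q = glue_proj D R"
  define Q where "Q = glue_proj solid_cylinder klassen_rel"
  define F where "F = (\<lambda>(z, t). (q (cis (pi * t) * z), cis (2 * pi * t)))"
  have P: "projective_plane = glue D R"
    by (simp add: projective_plane_def D_def R_def)
  have qq: "quotient_map D (glue D R) q"
    unfolding q_def by (rule quotient_map_glue)
  have q_neg: "q (- z) = q z" if "cmod z = 1" for z
    unfolding q_def using that by (intro glue_proj_eqI [symmetric]) (auto simp: R_def D_def)
  have q_eqD: "w = z \<or> w = - z \<and> cmod z = 1"
    if "q z = q w" "cmod z \<le> 1" "cmod w \<le> 1" for z w
  proof -
    have "(z, w) \<in> (R \<union> R\<inverse>)\<^sup>*"
      using that glue_proj_eq_iff [of z D w R] by (simp add: q_def D_def)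
    then show ?thesis
      by (induction rule: rtrancl_induct) (auto simp: R_def)
  qed
  have cont: "continuous_map solid_cylinder (prod_topology (glue D R) S) F"
  proof -
    have "continuous_map solid_cylinder D (\<lambda>x. cis (pi * snd x) * fst x)"
      unfolding D_def cis_conv_exp
      by (auto intro!: continuous_intros simp: norm_mult image_subset_iff)
    then have "continuous_map solid_cylinder (glue D R) (q \<circ> (\<lambda>x. cis (pi * snd x) * fst x))"
      using quotient_imp_continuous_map [OF qq] continuous_map_compose by blast
    moreover have "continuous_map solid_cylinder S (\<lambda>x. cis (2 * pi * snd x))"
      unfolding S_def cis_conv_exp
      by (auto intro!: continuous_intros simp: image_subset_iff)
    ultimately show ?thesis
      unfolding F_def case_prod_unfold by (auto simp: continuous_map_paired o_def)
  qed
  have resp1: "F a = F b" if "(a, b) \<in> klassen_rel" for a b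
    using that q_neg unfolding klassen_rel_def F_def by (auto simp: norm_mult)
  have resp: "F a = F b" if "(a, b) \<in> (klassen_rel \<union> klassen_rel\<inverse>)\<^sup>*" for a b
    using that by (induction rule: rtrancl_induct) (auto dest: resp1)
  obtain h where h: "continuous_map klassen_space (prod_topology (glue D R) S) h"
      "h ` topspace klassen_space = F ` topspace solid_cylinder"
      "\<And>x. x \<in> topspace solid_cylinder \<Longrightarrow> h (Q x) = F x"
    unfolding klassen_space_def Q_def
  proof (rule quotient_map_lift_exists [OF quotient_map_glue cont, of klassen_rel])
    fix x y
    assume "x \<in> topspace solid_cylinder" "y \<in> topspace solid_cylinder"
      "glue_proj solid_cylinder klassen_rel x = glue_proj solid_cylinder klassen_rel y"
    then show "F x = F y"
      using resp glue_proj_eq_iff [of x solid_cylinder y klassen_rel] by blast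
  qed (rule that [unfolded klassen_space_def Q_def])
  have surj: "F ` topspace solid_cylinder = topspace (prod_topology (glue D R) S)"
  proof
    show "F ` topspace solid_cylinder \<subseteq> topspace (prod_topology (glue D R) S)"
      using cont continuous_map_image_subset_topspace by blast
    show "topspace (prod_topology (glue D R) S) \<subseteq> F ` topspace solid_cylinder"
    proof clarify
      fix a b assume "(a, b) \<in> topspace (prod_topology (glue D R) S)"
      then have "a \<in> q ` topspace D" and b: "cmod b = 1"
        using quotient_imp_surjective_map [OF qq] by (auto simp: S_def)
      then obtain z where z: "cmod z \<le> 1" "a = q z" by (auto simp: D_def)
      define t where "t = Arg2pi b / (2 * pi)"
      have "t \<in> {0..1}" "cis (2 * pi * t) = b"
        using Arg2pi_ge_0 [of b] Arg2pi_lt_2pi [of b] b Arg2pi_eq [of b]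
        by (auto simp: t_def cis_conv_exp divide_simps)
      moreover have "cis (pi * t) * (cis (- pi * t) * z) = z"
        by (simp only: cis_mult flip: mult.assoc) simp
      ultimately have "(a, b) = F (cis (- pi * t) * z, t)"
        using z by (simp only: F_def split)
      with \<open>t \<in> {0..1}\<close> z show "(a, b) \<in> F ` topspace solid_cylinder"
        by (intro image_eqI) (auto simp: norm_mult)
    qed
  qed
  have neg: "Q (- z, t) = Q (z, t)" if "cmod z = 1" "t \<in> {0..1}" for z t
    unfolding Q_def using that
    by (intro glue_proj_eqI [symmetric]) (auto simp: klassen_rel_def)
  have wrap: "Q (- z, 0) = Q (z, 1)" if "cmod z \<le> 1" for z
    unfolding Q_def using that
    by (intro glue_proj_eqI [symmetric]) (auto simp: klassen_rel_def)
  have inj: "Q x = Q y"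
    if "x \<in> topspace solid_cylinder" "y \<in> topspace solid_cylinder" "F x = F y" for x y
  proof -
    have one: "Q (z, t) = Q (w, s)"
      if "cmod z \<le> 1" "cmod w \<le> 1" "t \<in> {0..1}" "s \<in> {0..1}" "t \<le> s"
        "F (z, t) = F (w, s)" for z w t s
    proof -
      have "cis (2 * pi * t) = cis (2 * pi * s)"
        using that by (simp add: F_def)
      then have "sin (2 * pi * s) = sin (2 * pi * t) \<and> cos (2 * pi * s) = cos (2 * pi * t)"
        by (simp add: complex_eq_iff)
      then obtain n::int where "2 * pi * s = 2 * pi * t + 2 * pi * n"
        unfolding sin_cos_eq_iff by blast
      then have "2 * pi * s = 2 * pi * (t + n)"
        by (simp only: distrib_left)
      then have n: "s = t + n"
        by simp
      with that have "-1 < real_of_int n" "real_of_int n < 2"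
        by auto
      then have "n = 0 \<or> n = 1"
        by linarith
      with n that consider "s = t" | "t = 0" "s = 1"
        by fastforce
      then show ?thesis
      proof cases
        case 1
        have "cis (pi * t) * w = cis (pi * t) * z \<or>
            cis (pi * t) * w = cis (pi * t) * (- z) \<and> cmod z = 1"
          using q_eqD [of "cis (pi * t) * z" "cis (pi * s) * w"] that 1
          by (auto simp: F_def norm_mult)
        then have "w = z \<or> w = - z \<and> cmod z = 1"
          by (simp only: mult_cancel_left) simp
        with 1 that show ?thesis
          using neg [of z t] by auto
      next
        case 2
        then have "w = - z \<or> w = z \<and> cmod z = 1"
          using q_eqD [of z "- w"] that by (auto simp: F_def)
        moreover have "Q (- w, 0) = Q (w, 1)"
          using wrap that by blast
        moreover have "Q (- w, 0) = Q (w, 0)" if "cmod w = 1"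
          using neg [of w 0] that by simp
        ultimately show ?thesis
          using 2 by (metis minus_minus)
      qed
    qed
    obtain z t w s where xy: "x = (z, t)" "y = (w, s)"
      by (metis surj_pair)
    with that have *: "cmod z \<le> 1" "cmod w \<le> 1" "t \<in> {0..1}" "s \<in> {0..1}"
      by auto
    show ?thesis
    proof (cases "t \<le> s")
      case True
      then show ?thesis
        using one [OF *] that(3) xy by metis
    next
      case False
      then show ?thesis
        using one [OF *(2,1,4,3)] that(3) xy by (metis linear)
    qed
  qed
  have "inj_on h (topspace klassen_space)"
  proof (rule inj_onI)
    fix a b
    assume ab: "a \<in> topspace klassen_space" "b \<in> topspace klassen_space" "h a = h b"
    have "topspace klassen_space = Q ` topspace solid_cylinder"
      unfolding klassen_space_def Q_def
      by (rule quotient_imp_surjective_map [OF quotient_map_glue, symmetric])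
    with ab obtain x y where xy: "x \<in> topspace solid_cylinder" "a = Q x"
        "y \<in> topspace solid_cylinder" "b = Q y"
      by (auto simp del: topspace_euclidean_subtopology)
    with ab(3) have "F x = F y"
      by (simp only: h(3))
    with inj xy show "a = b"
      by metis
  qed
  moreover have "compact_space klassen_space"
  proof -
    have "compactin solid_cylinder (cball 0 1 \<times> {0..1})"
      by (simp add: compactin_subtopology compact_Times)
    then have "compactin klassen_space (Q ` (cball 0 1 \<times> {0..1}))"
      unfolding klassen_space_def Q_def
      by (rule image_compactin [OF _ quotient_imp_continuous_map [OF quotient_map_glue]])
    then show ?thesis
      using quotient_imp_surjective_map [OF quotient_map_glue, of solid_cylinder klassen_rel]
      by (simp add: compact_space_def klassen_space_def Q_def)
  qed
  moreover have "Hausdorff_space (prod_topology (glue D R) S)"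
    unfolding Hausdorff_space_prod_topology S_def
    using Hausdorff_projective_plane P by (simp add: Hausdorff_space_subtopology)
  ultimately have "homeomorphic_map klassen_space (prod_topology (glue D R) S) h"
    using h(1,2) surj by (intro continuous_imp_homeomorphic_map) simp_all
  then show ?thesis
    unfolding P S_def by (rule homeomorphic_map_imp_homeomorphic_space)
qed

lemma klassen_rel_formula:
  assumes "(a, b) \<in> (klassen_rel \<union> klassen_rel\<inverse>)\<^sup>*"
  shows "klassen_formula a = klassen_formula b"
  using assms
proof (induction rule: rtrancl_induct)
  case (step b c)
  have "exp (2 * complex_of_real pi * \<i>) = 1"
    by (simp add: exp_eq_polar)
  with step.hyps(2) have "klassen_formula b = klassen_formula c"
    unfolding klassen_rel_def by (auto simp: klassen_formula_def)
  with step.IH show ?case by simp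
qed simp

lemma klassen_fibration_proj:
  assumes "x \<in> topspace solid_cylinder"
  shows "klassen_fibration (glue_proj solid_cylinder klassen_rel x) = klassen_formula x"
proof -
  have "klassen_formula ` glue_proj solid_cylinder klassen_rel x = {klassen_formula x}"
    using assms klassen_rel_formula [of x]
    by (auto simp: glue_proj_def glue_rel_def intro!: image_eqI [where x = x])
  then show ?thesis
    by (simp add: klassen_fibration_def)
qed


section \<open>The Klein bottle with one hole and the Y-homeomorphisms\<close>

definition octagon :: "(real \<times> real) set" where
  "octagon = {(x\<^sub>1, x\<^sub>2). \<bar>x\<^sub>1\<bar> \<le> 1 \<and> \<bar>x\<^sub>2\<bar> \<le> 1 \<and> \<bar>x\<^sub>1\<bar> + \<bar>x\<^sub>2\<bar> \<le> 3/2}"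

definition octagon_rel :: "((real \<times> real) \<times> (real \<times> real)) set" where
  "octagon_rel = {((-1, s), (1, s)) |s. (1, s) \<in> octagon} \<union>
                 {((s, 1), (- s, -1)) |s. (s, 1) \<in> octagon}"

definition klein_hole :: "(real \<times> real) set topology" where
  "klein_hole = glue (top_of_set octagon) octagon_rel"

definition klein_hole_boundary :: "(real \<times> real) set set" where
  "klein_hole_boundary = glue_proj (top_of_set octagon) octagon_rel `
     {(x\<^sub>1, x\<^sub>2) \<in> octagon. \<bar>x\<^sub>1\<bar> + \<bar>x\<^sub>2\<bar> = 3/2}"

text \<open>A point of \<^const>\<open>klein_hole\<close> is a set of points of the octagon, and the induced map
  takes it to its image.\<close>

definition klein_reflection :: "(real \<times> real) set \<Rightarrow> (real \<times> real) set" where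
  "klein_reflection c = (\<lambda>(x\<^sub>1, x\<^sub>2). (x\<^sub>1, - x\<^sub>2)) ` c"

definition collar :: "'a topology \<Rightarrow> 'a set \<Rightarrow> (complex \<times> real \<Rightarrow> 'a) \<Rightarrow> bool" where
  "collar X D c \<longleftrightarrow>
     embedding_map (top_of_set (sphere 0 1 \<times> {0..1})) X c \<and>
     c ` (sphere 0 1 \<times> {0}) = D \<and>
     openin X (c ` (sphere 0 1 \<times> {0..<1}))"

text \<open>The half twist along a collar rotates its boundary circle by \<open>\<epsilon> * pi\<close> and
  is the identity on the inner circle of the collar; \<open>\<epsilon> = \<plusminus>1\<close> is its direction.\<close>

definition half_twist :: "(complex \<times> real \<Rightarrow> 'a) \<Rightarrow> real \<Rightarrow> 'a \<Rightarrow> 'a" where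
  "half_twist c \<epsilon> x =
     (if x \<in> c ` (sphere 0 1 \<times> {0..1})
      then (let (w, u) = inv_into (sphere 0 1 \<times> {0..1}) c x
            in c (w * cis (\<epsilon> * pi * (1 - u)), u))
      else x)"

text \<open>The collar is parametrised so that the half turn of the boundary induced by the reflection
  is \<open>w \<mapsto> - w\<close>; thus its composition with a half twist fixes the boundary.\<close>

definition Y_homeomorphism :: "((real \<times> real) set \<Rightarrow> (real \<times> real) set) \<Rightarrow> bool" where
  "Y_homeomorphism y \<longleftrightarrow>
     (\<exists>c \<epsilon>. collar klein_hole klein_hole_boundary c \<and>
        (\<forall>w\<in>sphere 0 1. klein_reflection (c (w, 0)) = c (- w, 0)) \<and>
        \<epsilon> \<in> {1, -1} \<and>
        y = restrict (half_twist c \<epsilon> \<circ> klein_reflection) (topspace klein_hole))"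

end

theory Submission
  imports Defs
begin

text \<open>
  Put \<open>v = z * cis (pi * t)\<close> and \<open>w = cis (2 * pi * t)\<close>. In these coordinates the space is the
  quotient of the pairs with \<open>cmod v \<le> 1\<close>, \<open>cmod w = 1\<close> by \<open>(v, w) \<sim> (- v, w)\<close> for \<open>cmod v = 1\<close>, and
  Klassen's fibration is the sign of \<open>C = v\<^sup>2 - w / 4\<close>, so that the pages are the preimages of rays.

  Every open book flow can be reparametrised so that the argument of the fibration grows at unit
  speed; this extends over the binding by the identity. For two such flows \<open>\<Psi>\<close> and \<open>\<Psi>'\<close>, the maps
  \<open>\<Psi>' (2 * pi * (1 - \<tau>)) \<circ> \<Psi> (2 * pi * \<tau>)\<close> preserve each page and join the two return maps. Hence any
  unit speed flow computes the monodromy, even one that is meridional only on the binding itself.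
  Choose one that is \<open>(v, w) \<mapsto> (cis (\<theta> / 2) * v, cis \<theta> * w)\<close> away from the binding: its return map is
  \<open>(v, w) \<mapsto> (- v, w)\<close> there, and it interpolates linearly to the identity across a collar of the binding.

  On the page \<open>C \<ge> 0\<close> the involution \<open>v \<mapsto> - v\<close> has quotient
  \<open>{(w, R). R \<ge> 0 \<and> cmod (R + w / 4) \<le> 1}\<close>, which complex conjugation cuts into two copies of a quarter of
  the octagon. Matching the quarters identifies the page with the one-holed Klein bottle and the
  involution with the reflection, and the interpolation across the collar becomes the half twist.
\<close>

section \<open>Flows of unit angular speed\<close>

text \<open>The flows are merely continuous and their speed is uncontrolled, so unit speed has to be
  earned: the angle swept along an orbit must be shown continuous in the starting point and
  unbounded in both time directions. The first spreads along the time axis by connectedness; the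
  second comes from a compact invariant set that contains the orbit and misses the binding.

  The identification with \<open>K\<close> is found from fixed points. On a page
  \<open>v \<mapsto> - v\<close> fixes the circle \<open>cmod v = 1\<close>, where \<open>v\<close>
  and \<open>- v\<close> are one point, and the isolated point \<open>v = 0\<close>. In
  \<open>K\<close> the reflection fixes the midline \<open>x\<^sub>2 = 0\<close> and the single
  point represented by \<open>(0, 1)\<close> and \<open>(0, -1)\<close>. The map from the octagon is
  built so that these sets correspond.

  Two explicit flows are used. \<open>flat_profile\<close> has true meridians near the binding and
  shows that an open book flow exists. \<open>linear_profile\<close> has a return map that equals
  the reflection followed by a half twist exactly, so no isotopy has to be built in
  \<open>K\<close>.\<close>

lemma real_lift_unique:
  fixes d :: "real \<Rightarrow> real"
  assumes "connected S" "continuous_on S d" "\<And>t. t \<in> S \<Longrightarrow> cis (d t) = 1"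
    and "a \<in> S" "d a = 0" "t \<in> S"
  shows "d t = 0"
proof -
  have range: "\<exists>n::int. d t = of_int n * (2 * pi)" if "t \<in> S" for t
  proof -
    have "cos (d t) = 1"
      using assms(3)[OF that] by (simp add: complex_eq_iff)
    then show ?thesis
      by (auto simp: cos_one_2pi_int mult.assoc)
  qed
  \<comment> \<open>The values of \<open>d\<close> are multiples of \<open>2 * pi\<close>, so
    distinct values are at least \<open>2 * pi\<close> apart.\<close>
  have "d constant_on S"
  proof (rule continuous_discrete_range_constant [OF assms(1,2)])
    fix x assume "x \<in> S"
    show "\<exists>e>0. \<forall>y. y \<in> S \<and> d y \<noteq> d x \<longrightarrow> e \<le> norm (d y - d x)"
    proof (intro exI[of _ "2*pi"] conjI allI impI)
      fix y assume y: "y \<in> S \<and> d y \<noteq> d x"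
      obtain m n :: int where mn: "d x = of_int m * (2 * pi)" "d y = of_int n * (2 * pi)"
        using range y \<open>x \<in> S\<close> by metis
      then have "m \<noteq> n" using y by auto
      then have "1 \<le> \<bar>n - m\<bar>" by linarith
      then have "1 \<le> \<bar>real_of_int (n - m)\<bar>" by linarith
      then have "2*pi \<le> \<bar>real_of_int (n - m)\<bar> * (2*pi)"
        by simp
      also have "\<dots> = norm (d y - d x)"
        by (simp add: mn abs_mult flip: left_diff_distrib)
      finally show "2*pi \<le> norm (d y - d x)" .
    qed simp
  qed
  then show ?thesis
    using assms(4-6) unfolding constant_on_def by metis
qed

lemma continuous_map_euclidean_compose:
  assumes "continuous_map Z euclidean f" "continuous_on UNIV g"
  shows "continuous_map Z euclidean (\<lambda>x. g (f x))"
  using continuous_map_compose[of Z euclidean f euclidean g] assms by (simp add: o_def)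

text \<open>The common class in which reparametrised open book flows and the explicit
  \<open>klassen_flow\<close> are compared. The map at time \<open>2 * pi\<close> sends every page
  to itself.\<close>

definition normalized_flow ::
  "'a topology \<Rightarrow> 'a set \<Rightarrow> ('a \<Rightarrow> complex) \<Rightarrow> (real \<Rightarrow> 'a \<Rightarrow> 'a) \<Rightarrow> bool" where
  "normalized_flow X B p \<Psi> \<longleftrightarrow>
     flow_on X \<Psi> \<and> (\<forall>x\<in>B. \<forall>\<theta>. \<Psi> \<theta> x = x) \<and>
     (\<forall>x\<in>topspace X - B. \<forall>\<theta>. \<Psi> \<theta> x \<notin> B \<and> p (\<Psi> \<theta> x) = cis \<theta> * p x)"

lemma flow_on_in_topspace:
  assumes "flow_on X \<Phi>" "x \<in> topspace X"
  shows "\<Phi> t x \<in> topspace X"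
proof -
  have "(\<lambda>(t, x). \<Phi> t x) ` topspace (prod_topology euclideanreal X) \<subseteq> topspace X"
    using assms(1) continuous_map_image_subset_topspace by (fastforce simp: flow_on_def)
  with assms(2) show ?thesis by auto
qed

lemma continuous_map_flow_on:
  assumes "flow_on X \<Phi>" "continuous_map Z euclideanreal f" "continuous_map Z X g"
  shows "continuous_map Z X (\<lambda>z. \<Phi> (f z) (g z))"
proof -
  have "continuous_map Z X ((\<lambda>(t, x). \<Phi> t x) \<circ> (\<lambda>z. (f z, g z)))"
    using assms unfolding flow_on_def
    by (intro continuous_map_compose [of _ "prod_topology euclideanreal X"])
       (auto simp: continuous_map_pairedI)
  then show ?thesis by (simp add: o_def)
qed

locale open_book =
  fixes X :: "'a topology" and B :: "'a set" and p :: "'a \<Rightarrow> complex"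
  assumes compact: "compact_space X" and Hausdorff: "Hausdorff_space X"
    and closed: "closedin X B"
    and cont: "continuous_map (subtopology X (topspace X - B)) euclidean p"
begin

abbreviation complement :: "'a topology" where
  "complement \<equiv> subtopology X (topspace X - B)"

end

section \<open>The angle swept along an orbit\<close>

locale open_book_with_flow = open_book +
  fixes \<Phi> :: "real \<Rightarrow> 'a \<Rightarrow> 'a"
  assumes obf: "open_book_flow X B p \<Phi>"
begin

lemma flow: "flow_on X \<Phi>"
  using obf by (simp add: open_book_flow_def)

lemma flow_0 [simp]: "x \<in> topspace X \<Longrightarrow> \<Phi> 0 x = x"
  and flow_add: "x \<in> topspace X \<Longrightarrow> \<Phi> (s + t) x = \<Phi> s (\<Phi> t x)"
  using flow by (auto simp: flow_on_def)

text \<open>Transversality supplies a lift \<open>a\<close> for each orbit separately. Two lifts of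
  one orbit differ by a constant, which \<open>a t - a 0\<close> cancels, so the value does not
  depend on the choice.\<close>

definition angle :: "real \<Rightarrow> 'a \<Rightarrow> real" where
  "angle t x = (let a = (SOME a. continuous_on UNIV a \<and> strict_mono a \<and>
       (\<forall>t. \<Phi> t x \<notin> B \<and> p (\<Phi> t x) = cis (a t))) in a t - a 0)"

context
  fixes x assumes x: "x \<in> topspace X - B"
begin

lemma angle_ex:
  obtains a where "\<And>t. angle t x = a t - a 0" "continuous_on UNIV a" "strict_mono a"
    "\<And>t. \<Phi> t x \<notin> B" "\<And>t. p (\<Phi> t x) = cis (a t)"
proof -
  define a where "a = (SOME a. continuous_on UNIV a \<and> strict_mono a \<and>
       (\<forall>t. \<Phi> t x \<notin> B \<and> p (\<Phi> t x) = cis (a t)))"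
  have "\<exists>a. continuous_on UNIV a \<and> strict_mono a \<and> (\<forall>t. \<Phi> t x \<notin> B \<and> p (\<Phi> t x) = cis (a t))"
    using obf x unfolding open_book_flow_def transverse_to_pages_def by blast
  then have "continuous_on UNIV a \<and> strict_mono a \<and> (\<forall>t. \<Phi> t x \<notin> B \<and> p (\<Phi> t x) = cis (a t))"
    unfolding a_def by (rule someI_ex)
  moreover have "angle t x = a t - a 0" for t
    unfolding angle_def a_def [symmetric] Let_def ..
  ultimately show ?thesis
    using that by blast
qed

lemma angle_0 [simp]: "angle 0 x = 0"
  by (metis angle_ex diff_self)

lemma continuous_on_angle: "continuous_on S (\<lambda>t. angle t x)"
proof -
  obtain a where *: "\<And>t. angle t x = a t - a 0" "continuous_on UNIV a"
    using angle_ex by metis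
  show ?thesis unfolding *(1)
    by (intro continuous_intros continuous_on_subset[OF *(2)]) auto
qed

lemma strict_mono_angle: "strict_mono (\<lambda>t. angle t x)"
proof -
  obtain a where *: "\<And>t. angle t x = a t - a 0" "strict_mono a"
    using angle_ex by metis
  then show ?thesis
    by (simp add: strict_mono_def)
qed

lemma angle_less_iff [simp]: "angle s x < angle t x \<longleftrightarrow> s < t"
  using strict_mono_less[OF strict_mono_angle] by blast

lemma angle_eq_iff [simp]: "angle s x = angle t x \<longleftrightarrow> s = t"
  using strict_mono_eq[OF strict_mono_angle] by blast

lemma flow_complement: "\<Phi> t x \<in> topspace X - B"
  using flow_on_in_topspace[OF flow] x by (metis Diff_iff angle_ex)

lemma norm_fibration: "cmod (p x) = 1"
proof -
  obtain a where "\<And>t. p (\<Phi> t x) = cis (a t)"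
    using angle_ex by metis
  from this[of 0] show ?thesis using x by simp
qed

lemma fibration_flow: "p (\<Phi> t x) = cis (angle t x) * p x"
proof -
  obtain a where *: "\<And>t. angle t x = a t - a 0" "\<And>t. p (\<Phi> t x) = cis (a t)"
    using angle_ex by metis
  have "p x = cis (a 0)" using *(2)[of 0] x by simp
  then show ?thesis by (simp add: * cis_mult)
qed

end

text \<open>As functions of \<open>s\<close>, both sides lift the same path in the circle, and they
  agree at \<open>s = 0\<close>.\<close>

lemma angle_add:
  assumes x: "x \<in> topspace X - B"
  shows "angle (s + t) x = angle s (\<Phi> t x) + angle t x"
proof -
  let ?d = "\<lambda>s. angle (s + t) x - angle s (\<Phi> t x) - angle t x"
  note y = flow_complement[OF x, of t]
  have "?d s = 0"
  proof (rule real_lift_unique[of UNIV ?d 0])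
    show "continuous_on UNIV ?d"
      by (intro continuous_intros continuous_on_angle[OF y]
          continuous_on_compose2[OF continuous_on_angle[OF x, of UNIV]]) auto
    show "cis (?d s) = 1" for s
    proof -
      have "p (\<Phi> (s + t) x) = p (\<Phi> s (\<Phi> t x))"
        using x by (simp add: flow_add)
      then have "cis (angle (s + t) x) * p x = cis (angle s (\<Phi> t x) + angle t x) * p x"
        by (simp only: fibration_flow[OF x] fibration_flow[OF y] flip: cis_mult mult.assoc)
      moreover have "p x \<noteq> 0" using norm_fibration[OF x] by auto
      ultimately have "cis (angle (s + t) x) = cis (angle s (\<Phi> t x) + angle t x)"
        by simp
      then have "cis (angle (s + t) x - (angle s (\<Phi> t x) + angle t x)) = 1"
        by (simp flip: cis_divide)
      then show ?thesis
        by (simp add: algebra_simps)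
    qed
  qed (use x y in auto)
  then show ?thesis by simp
qed

lemma continuous_map_fibration_flow:
  assumes "continuous_map Z euclideanreal f" "continuous_map Z complement g"
  shows "continuous_map Z complement (\<lambda>z. \<Phi> (f z) (g z))"
proof -
  have "g z \<in> topspace X - B" if "z \<in> topspace Z" for z
    using assms(2) that continuous_map_image_subset_topspace by fastforce
  moreover have "continuous_map Z X (\<lambda>z. \<Phi> (f z) (g z))"
    using assms by (intro continuous_map_flow_on[OF flow]) (auto simp: continuous_map_in_subtopology)
  ultimately show ?thesis
    using flow_complement by (auto simp: continuous_map_in_subtopology)
qed

text \<open>On a box around \<open>(0, y)\<close> the quotient
  \<open>p (\<Phi> s x) * cnj (p x) = cis (angle s x)\<close> has positive real part. Angles that
  start at \<open>0\<close> therefore stay where \<open>arcsin\<close> inverts \<open>sin\<close>,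
  and the arcsine of the imaginary part is continuous in \<open>x\<close>. One \<open>e\<close>
  serves all points of \<open>W\<close>.\<close>

lemma angle_locally_continuous:
  assumes y: "y \<in> topspace X - B"
  shows "\<exists>e>0. \<exists>W. openin complement W \<and> y \<in> W \<and>
    (\<forall>s. \<bar>s\<bar> < e \<longrightarrow> continuous_map (subtopology complement W) euclideanreal (angle s))"
proof -
  let ?q = "\<lambda>s x. p (\<Phi> s x) * cnj (p x)"
  let ?Z = "prod_topology euclideanreal complement"
  have fst: "continuous_map ?Z euclideanreal fst" and snd: "continuous_map ?Z complement snd"
    by (simp_all add: continuous_map_fst continuous_map_snd)
  have "continuous_map ?Z euclidean (\<lambda>z. p (\<Phi> (fst z) (snd z)))"
    "continuous_map ?Z euclidean (\<lambda>z. p (snd z))"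
    using continuous_map_compose[OF continuous_map_fibration_flow[OF fst snd] cont]
      continuous_map_compose[OF snd cont] by (simp_all add: o_def)
  then have q: "continuous_map ?Z euclidean (\<lambda>z. ?q (fst z) (snd z))"
    by (auto simp: continuous_map_atin intro!: tendsto_intros)
  have q_cis: "?q s x = cis (angle s x)" if "x \<in> topspace X - B" for s x
  proof -
    have "p x * cnj (p x) = 1"
      using norm_fibration[OF that] by (simp flip: complex_norm_square)
    then show ?thesis
      using fibration_flow[OF that, of s] by (simp only: mult.assoc mult_1_right)
  qed
  let ?O = "{z \<in> topspace ?Z. ?q (fst z) (snd z) \<in> {w. Re w > 0}}"
  have op: "openin ?Z ?O"
    by (intro openin_continuous_map_preimage[OF q]) (simp add: open_halfspace_Re_gt flip: open_openin)
  have mem: "(0, y) \<in> ?O"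
  proof -
    have "Re (?q 0 y) > 0"
      by (simp only: q_cis[OF y] angle_0[OF y] cis.sel) simp
    then show ?thesis
      using y by (simp del: times_complex.sel flow_0)
  qed
  obtain U W where UW: "openin euclideanreal U" "openin complement W" "0 \<in> U" "y \<in> W" "U \<times> W \<subseteq> ?O"
    using openin_prod_topology_alt [THEN iffD1, OF op, rule_format, OF mem] by blast
  then obtain e where e: "e > 0" "ball 0 e \<subseteq> U"
    by (metis open_contains_ball open_openin)
  have W: "x \<in> topspace X - B" if "x \<in> W" for x
    using UW(2) that openin_subset by fastforce
  have eq: "angle s x = arcsin (Im (?q s x))" if s: "\<bar>s\<bar> < e" and "x \<in> W" for s x
  proof -
    note x = W[OF \<open>x \<in> W\<close>]
    have pos: "Re (?q s x) > 0" if "s \<in> {-e<..<e}" for s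
    proof -
      have "s \<in> U" using e that by (auto simp: subset_iff)
      then show ?thesis using UW(5) \<open>x \<in> W\<close> by force
    qed
    let ?d = "\<lambda>s. angle s x - arcsin (sin (angle s x))"
    have "?d s = 0"
    proof (rule real_lift_unique[of "{-e<..<e}" ?d 0])
      show "continuous_on {-e<..<e} ?d"
        by (intro continuous_intros continuous_on_angle[OF x]) auto
      show "cis (?d s) = 1" if "s \<in> {-e<..<e}" for s
      proof -
        have "cos (angle s x) > 0"
          using pos[OF that] by (simp only: q_cis[OF x] cis.sel)
        then have "cos (arcsin (sin (angle s x))) = cos (angle s x)"
          by (simp add: cos_arcsin sin_squared_eq)
        then have "cis (arcsin (sin (angle s x))) = cis (angle s x)"
          by (simp add: complex_eq_iff)
        then show ?thesis by (simp flip: cis_divide)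
      qed
    qed (use x s in \<open>auto simp: \<open>e > 0\<close>\<close>)
    then show ?thesis by (simp only: q_cis[OF x] cis.sel)
  qed
  have "continuous_map (subtopology complement W) euclideanreal (angle s)" if s: "\<bar>s\<bar> < e" for s
  proof -
    have q: "continuous_map complement euclidean (?q s)"
      using continuous_map_compose[OF _ q, of complement "\<lambda>x. (s, x)"]
      by (simp add: o_def continuous_map_pairedI)
    have Im: "continuous_map complement (top_of_set {-1..1}) (\<lambda>x. Im (?q s x))"
    proof -
      have "continuous_map complement euclidean (\<lambda>x. Im (?q s x))"
        by (rule continuous_map_euclidean_compose[OF q]) (intro continuous_intros)
      moreover have "Im (?q s x) \<in> {-1..1}" if "x \<in> topspace complement" for x
      proof -
        have "x \<in> topspace X - B" using that by auto
        from q_cis[OF this] show ?thesis by (simp only: cis.sel) simp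
      qed
      ultimately show ?thesis
        unfolding continuous_map_in_subtopology by blast
    qed
    have "continuous_map (top_of_set {-1..1}) euclideanreal arcsin"
      by (simp add: continuous_on_arcsin')
    from continuous_map_compose[OF Im this]
    have "continuous_map complement euclideanreal (\<lambda>x. arcsin (Im (?q s x)))"
      by (simp only: o_def)
    then have "continuous_map (subtopology complement W) euclideanreal (\<lambda>x. arcsin (Im (?q s x)))"
      by (rule continuous_map_from_subtopology)
    then show ?thesis
      by (rule continuous_map_eq) (simp only: eq[OF s] topspace_subtopology Int_iff)
  qed
  with e UW show ?thesis by blast
qed

text \<open>Continuity near \<open>x\<close> spreads over all times because the real line is
  connected. For \<open>u\<close> and \<open>v\<close> close to \<open>r\<close>,
  \<open>angle_add\<close> gives \<open>angle v x = angle u x - angle (u - r) (\<Phi> r x) + angle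
  (v - r) (\<Phi> r x)\<close>, and the last two terms are covered by the local lemma at
  \<open>\<Phi> r x\<close>.\<close>

lemma continuous_map_angle: "continuous_map complement euclideanreal (angle t)"
proof -
  define P where "P = (\<lambda>x t. \<exists>V. openin complement V \<and> x \<in> V \<and>
     continuous_map (subtopology complement V) euclideanreal (angle t))"
  have P: "P x t" if x: "x \<in> topspace X - B" for x
  proof (rule connected_induction_simple[where S = UNIV and P = "P x" and a = 0 and b = t])
    show "P x 0"
      unfolding P_def
    proof (intro exI conjI)
      show "openin complement (topspace X - B)"
        using openin_topspace[of complement] by (simp add: Int_absorb1)
      show "continuous_map (subtopology complement (topspace X - B)) euclideanreal (angle 0)"
        by (rule continuous_map_eq[where f = "\<lambda>x. 0"]) auto
    qed (use x in auto)
  next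
    fix r :: real
    note y = flow_complement[OF x, of r]
    obtain e W where eW: "e > 0" "openin complement W" "\<Phi> r x \<in> W"
      "\<And>s. \<bar>s\<bar> < e \<Longrightarrow> continuous_map (subtopology complement W) euclideanreal (angle s)"
      using angle_locally_continuous[OF y] by blast
    have transfer: "P x v" if Pu: "P x u" and u: "\<bar>u - r\<bar> < e/2" and v: "\<bar>v - r\<bar> < e/2" for u v
    proof -
      obtain V where V: "openin complement V" "x \<in> V"
        "continuous_map (subtopology complement V) euclideanreal (angle u)"
        using Pu unfolding P_def by blast
      have Psi: "continuous_map complement complement (\<Phi> r)"
        using continuous_map_fibration_flow[of complement "\<lambda>_. r" "\<lambda>x. x"] by simp
      define V' where "V' = V \<inter> {x \<in> topspace complement. \<Phi> r x \<in> W}"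
      have op: "openin complement V'"
        unfolding V'_def using V eW Psi
        by (intro openin_Int openin_continuous_map_preimage[OF Psi]) auto
      have shift: "continuous_map (subtopology complement V') euclideanreal (\<lambda>x. angle s (\<Phi> r x))"
        if "\<bar>s\<bar> < e" for s
      proof -
        have "continuous_map (subtopology complement V') (subtopology complement W) (\<Phi> r)"
          using continuous_map_from_subtopology[OF Psi]
          by (auto simp: V'_def continuous_map_in_subtopology)
        from continuous_map_compose[OF this eW(4)[OF that]] show ?thesis
          by (simp add: o_def)
      qed
      have "continuous_map (subtopology complement V') euclideanreal
          (\<lambda>x. angle u x - angle (u - r) (\<Phi> r x) + angle (v - r) (\<Phi> r x))"
        using u v continuous_map_from_subtopology_mono[OF V(3), of V'] eW(1)
        by (intro continuous_intros shift) (auto simp: V'_def)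
      then have "continuous_map (subtopology complement V') euclideanreal (angle v)"
      proof (rule continuous_map_eq)
        fix z assume "z \<in> topspace (subtopology complement V')"
        then have z: "z \<in> topspace X - B" by auto
        show "angle u z - angle (u - r) (\<Phi> r z) + angle (v - r) (\<Phi> r z) = angle v z"
          using angle_add[OF z, of "u - r" r] angle_add[OF z, of "v - r" r] by simp
      qed
      then show ?thesis
        unfolding P_def using op V x eW(3) by (intro exI[of _ V']) (auto simp: V'_def)
    qed
    show "\<exists>T. openin (top_of_set UNIV) T \<and> r \<in> T \<and> (\<forall>x'\<in>T. \<forall>y\<in>T. P x x' \<longrightarrow> P x y)"
      using transfer \<open>e > 0\<close>
      by (intro exI[of _ "ball r (e/2)"]) (auto simp: dist_real_def abs_minus_commute)
  qed auto
  show ?thesis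
  proof (rule pasting_lemma[where T = "\<lambda>V. V" and f = "\<lambda>_. angle t"])
    show "\<exists>V. V \<in> {V. openin complement V \<and> continuous_map (subtopology complement V) euclideanreal (angle t)}
       \<and> x \<in> V \<and> angle t x = angle t x" if "x \<in> topspace complement" for x
      using P[of x] that unfolding P_def by auto
  qed auto
qed

section \<open>The tubular neighbourhood and the unboundedness of the angle\<close>

abbreviation tube_top :: "('a \<times> complex) topology" where
  "tube_top \<equiv> prod_topology (subtopology X B) (top_of_set (cball 0 1))"

lemma topspace_Int_binding [simp]: "topspace X \<inter> B = B"
  using closedin_subset[OF closed] by auto

text \<open>Meridionality only provides some open \<open>U\<close> between the binding and the image
  of \<open>\<nu>\<close>. As the binding is compact, the Wallace theorem finds a radius whose whole
  tube lies over \<open>U\<close>; there, openness in the image of the embedding is openness in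
  \<open>X\<close>.\<close>

lemma tube_ex:
  "\<exists>\<nu>. embedding_map tube_top X \<nu> \<and>
    (\<forall>b\<in>B. \<nu> (b, 0) = b) \<and>
    (\<forall>b\<in>B. \<forall>z\<in>cball 0 1 - {0}. p (\<nu> (b, z)) = z / complex_of_real (cmod z)) \<and>
    (\<forall>b\<in>B. \<forall>z\<in>cball 0 1. \<forall>t. \<exists>w. cmod w = cmod z \<and> \<Phi> t (\<nu> (b, z)) = \<nu> (b, w)) \<and>
    (\<exists>r>0. r \<le> 1 \<and> (\<forall>s. 0 < s \<longrightarrow> s \<le> r \<longrightarrow> openin X (\<nu> ` (B \<times> ball 0 s))))"
proof -
  obtain \<nu> U where \<nu>: "embedding_map tube_top X \<nu>"
    "\<forall>b\<in>B. \<nu> (b, 0) = b"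
    "\<forall>b\<in>B. \<forall>z\<in>cball 0 1 - {0}. p (\<nu> (b, z)) = z / complex_of_real (cmod z)"
    "\<forall>b\<in>B. \<forall>z\<in>cball 0 1. \<forall>t. \<exists>w. cmod w = cmod z \<and> \<Phi> t (\<nu> (b, z)) = \<nu> (b, w)"
    and U: "openin X U" "B \<subseteq> U" "U \<subseteq> \<nu> ` (B \<times> cball 0 1)"
    using obf unfolding open_book_flow_def meridional_near_binding_def by (elim conjE exE) blast
  have hom: "homeomorphic_map tube_top (subtopology X (\<nu> ` (B \<times> cball 0 1))) \<nu>"
    using \<nu>(1) unfolding embedding_map_def by simp
  have cont: "continuous_map tube_top X \<nu>"
    using hom homeomorphic_imp_continuous_map continuous_map_into_fulltopology by blast
  have op: "openin tube_top {a \<in> topspace tube_top. \<nu> a \<in> U}"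
    by (rule openin_continuous_map_preimage[OF cont U(1)])
  have c1: "compactin (subtopology X B) B"
    using closedin_compact_space[OF compact closed] by (simp add: compactin_subtopology)
  have c2: "compactin (top_of_set (cball (0::complex) 1)) {0}"
    by (simp add: compactin_subtopology)
  have c3: "B \<times> {0} \<subseteq> {a \<in> topspace tube_top. \<nu> a \<in> U}"
    using \<nu>(2) U(2) by auto
  obtain V W where VW: "openin (subtopology X B) V" "openin (top_of_set (cball (0::complex) 1)) W"
    "B \<subseteq> V" "{0} \<subseteq> W" "V \<times> W \<subseteq> {a \<in> topspace tube_top. \<nu> a \<in> U}"
    by (rule Wallace_theorem_prod_topology[OF c1 c2 op c3])
  obtain e where e: "e > 0" "ball 0 e \<inter> cball 0 1 \<subseteq> W"
    using VW(2,4) openin_contains_ball[of "cball 0 1" W] by auto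
  define r where "r = min e 1"
  have "openin X (\<nu> ` (B \<times> ball 0 s))" if s: "0 < s" "s \<le> r" for s
  proof -
    have sub: "B \<times> ball 0 s \<subseteq> {a \<in> topspace tube_top. \<nu> a \<in> U}"
      using VW(3,5) e s by (force simp: r_def)
    have "openin (top_of_set (cball (0::complex) 1)) (ball 0 s)"
    proof -
      have "cball 0 1 \<inter> ball (0::complex) s = ball 0 s"
        using s by (auto simp: r_def)
      then show ?thesis
        using openin_open_Int[of "ball (0::complex) s" "cball 0 1"] by simp
    qed
    then have "openin tube_top (B \<times> ball 0 s)"
      using openin_topspace[of "subtopology X B"] closedin_subset[OF closed]
      by (simp add: openin_prod_Times_iff)
    then have "openin (subtopology X (\<nu> ` (B \<times> cball 0 1))) (\<nu> ` (B \<times> ball 0 s))"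
      using hom homeomorphic_map_openness_eq by blast
    then obtain O' where O': "openin X O'" "\<nu> ` (B \<times> ball 0 s) = O' \<inter> \<nu> ` (B \<times> cball 0 1)"
      by (auto simp: openin_subtopology)
    have "\<nu> ` (B \<times> ball 0 s) \<subseteq> U"
      using sub by blast
    moreover have "S = V \<inter> U" if "S = V \<inter> I" "U \<subseteq> I" "S \<subseteq> U" for S V I :: "'a set"
      using that by auto
    ultimately have "\<nu> ` (B \<times> ball 0 s) = O' \<inter> U"
      using O'(2) U(3) by metis
    then show ?thesis
      using O'(1) U(1) by (simp add: openin_Int)
  qed
  moreover have "r > 0" "r \<le> 1" using e by (auto simp: r_def)
  ultimately show ?thesis using \<nu> by blast
qed

definition tube :: "'a \<times> complex \<Rightarrow> 'a" where
  "tube = (SOME \<nu>. embedding_map tube_top X \<nu> \<and>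
    (\<forall>b\<in>B. \<nu> (b, 0) = b) \<and>
    (\<forall>b\<in>B. \<forall>z\<in>cball 0 1 - {0}. p (\<nu> (b, z)) = z / complex_of_real (cmod z)) \<and>
    (\<forall>b\<in>B. \<forall>z\<in>cball 0 1. \<forall>t. \<exists>w. cmod w = cmod z \<and> \<Phi> t (\<nu> (b, z)) = \<nu> (b, w)) \<and>
    (\<exists>r>0. r \<le> 1 \<and> (\<forall>s. 0 < s \<longrightarrow> s \<le> r \<longrightarrow> openin X (\<nu> ` (B \<times> ball 0 s)))))"

lemma embedding_tube: "embedding_map tube_top X tube"
  and tube_0: "b \<in> B \<Longrightarrow> tube (b, 0) = b"
  and fibration_tube: "b \<in> B \<Longrightarrow> cmod z \<le> 1 \<Longrightarrow> z \<noteq> 0 \<Longrightarrow> p (tube (b, z)) = z / complex_of_real (cmod z)"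
  and flow_tube: "b \<in> B \<Longrightarrow> cmod z \<le> 1 \<Longrightarrow> \<exists>w. cmod w = cmod z \<and> \<Phi> t (tube (b, z)) = tube (b, w)"
  and openin_tube: "\<exists>r>0. r \<le> 1 \<and> (\<forall>s. 0 < s \<longrightarrow> s \<le> r \<longrightarrow> openin X (tube ` (B \<times> ball 0 s)))"
  using someI_ex[OF tube_ex, folded tube_def] by simp_all

lemma continuous_map_tube: "continuous_map tube_top X tube"
  using embedding_tube embedding_map_imp_homeomorphic_space
  by (meson continuous_map_in_subtopology embedding_map_def homeomorphic_imp_continuous_map)

lemma inj_tube: "inj_on tube (B \<times> cball 0 1)"
  using embedding_tube homeomorphic_imp_injective_map[of tube_top _ tube]
  unfolding embedding_map_def by simp

lemma tube_eq_iff: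
  assumes "b \<in> B" "cmod z \<le> 1" "b' \<in> B" "cmod z' \<le> 1"
  shows "tube (b, z) = tube (b', z') \<longleftrightarrow> b = b' \<and> z = z'"
  using inj_on_eq_iff[OF inj_tube, of "(b, z)" "(b', z')"] assms by simp

lemma tube_in_topspace: "b \<in> B \<Longrightarrow> cmod z \<le> 1 \<Longrightarrow> tube (b, z) \<in> topspace X"
  using continuous_map_image_subset_topspace[OF continuous_map_tube] by auto

lemma tube_in_binding_iff:
  assumes "b \<in> B" "cmod z \<le> 1"
  shows "tube (b, z) \<in> B \<longleftrightarrow> z = 0"
proof
  assume "tube (b, z) \<in> B"
  then have "tube (b, z) = tube (tube (b, z), 0)"
    by (simp add: tube_0)
  then show "z = 0"
    using tube_eq_iff[of b z "tube (b, z)" 0] assms \<open>tube (b, z) \<in> B\<close> by simp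
qed (use assms in \<open>simp add: tube_0\<close>)

text \<open>Take the complement of a small open tube: it is compact because \<open>X\<close> is, and
  invariant because an orbit in the tube keeps its value of \<open>cmod z\<close>.\<close>

lemma compact_invariant_ex:
  assumes x: "x \<in> topspace X - B"
  shows "\<exists>K. compactin complement K \<and> x \<in> K \<and> (\<forall>y\<in>K. \<forall>t. \<Phi> t y \<in> K)"
proof -
  obtain r where r: "r > 0" "r \<le> 1"
    and op: "\<And>s. 0 < s \<Longrightarrow> s \<le> r \<Longrightarrow> openin X (tube ` (B \<times> ball 0 s))"
    using openin_tube by blast
  have "\<exists>s>0. s \<le> r \<and> x \<notin> tube ` (B \<times> ball 0 s)"
  proof (cases "x \<in> tube ` (B \<times> cball 0 1)")
    case True
    then obtain b z where bz: "b \<in> B" "cmod z \<le> 1" "x = tube (b, z)"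
      by auto
    then have "z \<noteq> 0" using x by (auto simp: tube_0)
    \<comment> \<open>The ball is open, so the radius \<open>cmod z\<close> itself already leaves
      \<open>x\<close> out.\<close>
    have "x \<notin> tube ` (B \<times> ball 0 (min r (cmod z)))"
      using bz r by (auto simp: tube_eq_iff)
    then show ?thesis
      using \<open>z \<noteq> 0\<close> r by (intro exI[of _ "min r (cmod z)"]) auto
  next
    case False
    then have "x \<notin> tube ` (B \<times> ball 0 r)" using r by force
    then show ?thesis using r by blast
  qed
  then obtain s where s: "s > 0" "s \<le> r" "x \<notin> tube ` (B \<times> ball 0 s)"
    by blast
  define K where "K = topspace X - tube ` (B \<times> ball 0 s)"
  have "b \<in> tube ` (B \<times> ball 0 s)" if "b \<in> B" for b
    using s that by (intro image_eqI[of _ _ "(b, 0)"]) (auto simp: tube_0)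
  then have KY: "K \<subseteq> topspace X - B"
    by (auto simp: K_def)
  moreover have "compactin X K"
    unfolding K_def using op[OF s(1,2)]
    by (intro closedin_compact_space[OF compact]) auto
  ultimately have "compactin complement K"
    by (simp add: compactin_subtopology)
  moreover have "\<Phi> t y \<in> K" if y: "y \<in> K" for t y
  proof (rule ccontr)
    assume "\<Phi> t y \<notin> K"
    moreover have yX: "y \<in> topspace X" using y by (simp add: K_def)
    ultimately obtain b z where bz: "b \<in> B" "cmod z < s" "\<Phi> t y = tube (b, z)"
      using flow_on_in_topspace[OF flow yX] by (auto simp: K_def)
    then obtain w where w: "cmod w = cmod z" "\<Phi> (-t) (tube (b, z)) = tube (b, w)"
      using flow_tube[of b z "-t"] s r by auto
    have "y = tube (b, w)"
      using flow_add[OF yX, of "-t" t] w bz yX by simp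
    then show False
      using y bz w by (auto simp: K_def)
  qed
  ultimately show ?thesis
    using x s by (intro exI[of _ K]) (auto simp: K_def)
qed

text \<open>On the compact invariant set the angle swept in unit time has a positive minimum
  \<open>d\<close>. Each further unit of time adds at least \<open>d\<close>, forwards and
  backwards, and the intermediate value theorem does the rest.\<close>

lemma angle_surj:
  assumes x: "x \<in> topspace X - B"
  shows "\<exists>t. angle t x = \<theta>"
proof -
  obtain K where K: "compactin complement K" "x \<in> K" "\<And>y t. y \<in> K \<Longrightarrow> \<Phi> t y \<in> K"
    using compact_invariant_ex[OF x] by blast
  have KY: "y \<in> topspace X - B" if "y \<in> K" for y
    using compactin_subset_topspace[OF K(1)] that by auto
  have "compact (angle 1 ` K)"
    using image_compactin[OF K(1) continuous_map_angle] by simp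
  then obtain d where d: "d \<in> angle 1 ` K" "\<And>y. y \<in> K \<Longrightarrow> d \<le> angle 1 y"
    using compact_attains_inf[of "angle 1 ` K"] K(2) by blast
  have "0 < d"
  proof -
    obtain y where y: "y \<in> K" "d = angle 1 y" using d(1) by blast
    show ?thesis using angle_less_iff[OF KY[OF y(1)], of 0 1] angle_0[OF KY[OF y(1)]] y(2) by simp
  qed
  have pos: "real n * d \<le> angle (real n) x" for n
  proof (induction n)
    case (Suc n)
    have "angle (1 + real n) x = angle 1 (\<Phi> (real n) x) + angle (real n) x"
      by (rule angle_add[OF x])
    with Suc d(2)[OF K(3)[OF K(2)], of "real n"] show ?case
      by (simp add: algebra_simps)
  qed (use angle_0[OF x] in simp)
  have neg: "angle (- real n) x \<le> - (real n * d)" for n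
  proof (induction n)
    case (Suc n)
    have "angle (1 + (- 1 - real n)) x = angle 1 (\<Phi> (- 1 - real n) x) + angle (- 1 - real n) x"
      by (rule angle_add[OF x])
    with Suc d(2)[OF K(3)[OF K(2)], of "- 1 - real n"] show ?case
      by (simp add: algebra_simps)
  qed (use angle_0[OF x] in simp)
  obtain n where n: "\<bar>\<theta>\<bar> < real n * d"
    using reals_Archimedean3[OF \<open>0 < d\<close>] by blast
  have "\<exists>t. - real n \<le> t \<and> t \<le> real n \<and> angle t x = \<theta>"
    using pos[of n] neg[of n] n
    by (intro IVT'[of "\<lambda>t. angle t x"] continuous_on_angle[OF x]) auto
  then show ?thesis by blast
qed

section \<open>Reparametrisation to unit angular speed\<close>

definition time :: "real \<Rightarrow> 'a \<Rightarrow> real" where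
  "time \<theta> x = (THE t. angle t x = \<theta>)"

lemma time_angle [simp]: "x \<in> topspace X - B \<Longrightarrow> time (angle t x) x = t"
  unfolding time_def by (rule the_equality) (auto dest: angle_eq_iff)

lemma angle_time [simp]: "x \<in> topspace X - B \<Longrightarrow> angle (time \<theta> x) x = \<theta>"
  using angle_surj[of x \<theta>] by auto

lemma time_less_iff: "x \<in> topspace X - B \<Longrightarrow> time \<theta> x < t \<longleftrightarrow> \<theta> < angle t x"
  and less_time_iff: "x \<in> topspace X - B \<Longrightarrow> t < time \<theta> x \<longleftrightarrow> angle t x < \<theta>"
  by (metis angle_less_iff angle_time)+

text \<open>Since \<open>time\<close> inverts an increasing function,
  \<open>t < time \<theta> x\<close> means \<open>angle t x < \<theta>\<close>, which is open in
  \<open>(\<theta>, x)\<close> for fixed \<open>t\<close>. Semicontinuity from both sides thus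
  yields joint continuity from the continuity of each single \<open>angle t\<close>.\<close>

lemma continuous_map_time:
  "continuous_map (prod_topology euclideanreal complement) euclideanreal (\<lambda>(\<theta>, x). time \<theta> x)"
proof -
  let ?Z = "prod_topology euclideanreal complement"
  have cont: "continuous_map ?Z euclideanreal (\<lambda>z. fst z - angle t (snd z))" for t
    using continuous_map_compose[OF continuous_map_snd continuous_map_angle, of euclideanreal t]
    by (intro continuous_intros) (simp_all add: continuous_map_fst o_def)
  have "openin ?Z {z \<in> topspace ?Z. case z of (\<theta>, x) \<Rightarrow> t < time \<theta> x}" for t
  proof -
    have "openin ?Z {z \<in> topspace ?Z. fst z - angle t (snd z) \<in> {0<..}}"
      by (rule openin_continuous_map_preimage[OF cont]) simp
    also have "{z \<in> topspace ?Z. fst z - angle t (snd z) \<in> {0<..}} =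
        {z \<in> topspace ?Z. case z of (\<theta>, x) \<Rightarrow> t < time \<theta> x}"
      by (auto simp: less_time_iff)
    finally show ?thesis .
  qed
  moreover have "openin ?Z {z \<in> topspace ?Z. (case z of (\<theta>, x) \<Rightarrow> time \<theta> x) < t}" for t
  proof -
    have "openin ?Z {z \<in> topspace ?Z. fst z - angle t (snd z) \<in> {..<0}}"
      by (rule openin_continuous_map_preimage[OF cont]) simp
    also have "{z \<in> topspace ?Z. fst z - angle t (snd z) \<in> {..<0}} =
        {z \<in> topspace ?Z. (case z of (\<theta>, x) \<Rightarrow> time \<theta> x) < t}"
      by (auto simp: time_less_iff)
    finally show ?thesis .
  qed
  ultimately show ?thesis
    unfolding continuous_map_upper_lower_semicontinuous_lt
    by (auto simp: case_prod_unfold)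
qed

definition unit_flow :: "real \<Rightarrow> 'a \<Rightarrow> 'a" where
  "unit_flow \<theta> x = (if x \<in> B then x else \<Phi> (time \<theta> x) x)"

lemma unit_flow_binding [simp]: "x \<in> B \<Longrightarrow> unit_flow \<theta> x = x"
  and unit_flow_complement: "x \<notin> B \<Longrightarrow> unit_flow \<theta> x = \<Phi> (time \<theta> x) x"
  by (simp_all add: unit_flow_def)

lemma unit_flow_in_complement:
  "x \<in> topspace X - B \<Longrightarrow> unit_flow \<theta> x \<in> topspace X - B"
  using flow_complement[of x "time \<theta> x"] by (simp add: unit_flow_def)

lemma fibration_unit_flow:
  "x \<in> topspace X - B \<Longrightarrow> p (unit_flow \<theta> x) = cis \<theta> * p x"
  using fibration_flow[of x "time \<theta> x"] by (simp add: unit_flow_def)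

text \<open>The flow keeps \<open>cmod z\<close> and \<open>p\<close> reads off the direction of
  \<open>z\<close>, so prescribing the angle leaves only the rotation. Near the binding this formula
  takes the place of \<open>time\<close>, which is meaningful only off it.\<close>

lemma unit_flow_tube:
  assumes b: "b \<in> B" and z: "cmod z \<le> 1"
  shows "unit_flow \<theta> (tube (b, z)) = tube (b, cis \<theta> * z)"
proof (cases "z = 0")
  case False
  define x where "x = tube (b, z)"
  have x: "x \<in> topspace X - B"
    unfolding x_def using tube_in_binding_iff[OF b z] tube_in_topspace[OF b z] False by simp
  obtain w where w: "cmod w = cmod z" "\<Phi> (time \<theta> x) x = tube (b, w)"
    using flow_tube[OF b z] unfolding x_def by blast
  have "w \<noteq> 0" using w(1) False by auto
  have "p (tube (b, w)) = cis \<theta> * p (tube (b, z))"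
    using fibration_flow[OF x, of "time \<theta> x"] x w(2) by (simp add: x_def)
  then have "w / cmod w = cis \<theta> * (z / cmod z)"
    using fibration_tube[OF b z False] fibration_tube[OF b _ \<open>w \<noteq> 0\<close>] w(1) z by simp
  then have "w = cis \<theta> * z"
    using w(1) False by (simp add: field_simps)
  then show ?thesis
    using w(2) x by (simp add: unit_flow_complement flip: x_def)
qed (use b in \<open>simp add: tube_0\<close>)

lemma unit_flow_0: "x \<in> topspace X \<Longrightarrow> unit_flow 0 x = x"
proof (cases "x \<in> B")
  case False
  assume x: "x \<in> topspace X"
  have "time 0 x = time (angle 0 x) x"
    using x False angle_0[of x] by simp
  also have "\<dots> = 0"
    using x False by (intro time_angle) auto
  finally show ?thesis
    using x False by (simp add: unit_flow_complement)
qed simp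

lemma unit_flow_add:
  assumes "x \<in> topspace X"
  shows "unit_flow (s + t) x = unit_flow s (unit_flow t x)"
proof (cases "x \<in> B")
  case False
  with assms have x: "x \<in> topspace X - B" by simp
  define y where "y = \<Phi> (time t x) x"
  have y: "y \<in> topspace X - B"
    unfolding y_def by (rule flow_complement[OF x])
  have "angle (time s y + time t x) x = s + t"
    using angle_add[OF x, of "time s y" "time t x"] x y by (simp flip: y_def)
  then have "time (s + t) x = time s y + time t x"
    using time_angle[OF x] by metis
  then show ?thesis
    using x y by (simp add: unit_flow_complement flow_add flip: y_def)
qed simp

text \<open>Two open pieces are pasted: off the binding continuity comes from \<open>time\<close>,
  and around it from the rotation formula, read through the inverse \<open>\<mu>\<close> of the
  embedded tube.\<close>

lemma continuous_map_unit_flow: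
  "continuous_map (prod_topology euclideanreal X) X (\<lambda>(\<theta>, x). unit_flow \<theta> x)"
proof -
  obtain r where r: "r > 0" "r \<le> 1" "openin X (tube ` (B \<times> ball 0 r))"
    using openin_tube by blast
  define N where "N = tube ` (B \<times> ball 0 r)"
  define T where "T = (\<lambda>i::bool. (UNIV :: real set) \<times> (if i then topspace X - B else N))"
  let ?R = "prod_topology euclideanreal X"
  show ?thesis
  proof (rule pasting_lemma[where I = UNIV and T = T and f = "\<lambda>_. \<lambda>(\<theta>, x). unit_flow \<theta> x"])
    fix i
    show "openin ?R (T i)"
      using closed r(3) by (auto simp: T_def N_def openin_prod_Times_iff closedin_def)
    show "continuous_map (subtopology ?R (T i)) X (\<lambda>(\<theta>, x). unit_flow \<theta> x)"
    proof (cases i)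
      case True
      let ?Z = "prod_topology euclideanreal complement"
      have Z: "subtopology ?R (T i) = ?Z"
        using True by (simp add: T_def subtopology_Times)
      have "continuous_map ?Z X (\<lambda>z. \<Phi> ((\<lambda>(\<theta>, x). time \<theta> x) z) (snd z))"
        using continuous_map_snd[of euclideanreal complement]
        by (intro continuous_map_flow_on[OF flow continuous_map_time])
          (auto simp: continuous_map_in_subtopology)
      then have "continuous_map ?Z X (\<lambda>(\<theta>, x). unit_flow \<theta> x)"
        by (rule continuous_map_eq) (auto simp: unit_flow_complement)
      then show ?thesis by (simp only: Z)
    next
      case False
      let ?Z = "subtopology ?R (T i)" and ?I = "subtopology X (tube ` (B \<times> cball 0 1))"
      have "homeomorphic_map tube_top ?I tube"
        using embedding_tube unfolding embedding_map_def by simp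
      then obtain \<mu> where \<mu>: "homeomorphic_maps tube_top ?I tube \<mu>"
        unfolding homeomorphic_map_maps by blast
      then have \<mu>_cont: "continuous_map ?I tube_top \<mu>"
        and \<mu>_tube: "\<And>b z. b \<in> B \<Longrightarrow> cmod z \<le> 1 \<Longrightarrow> \<mu> (tube (b, z)) = (b, z)"
        by (auto simp: homeomorphic_maps_def)
      have snd: "continuous_map ?Z ?I snd"
      proof -
        have "N \<subseteq> tube ` (B \<times> cball 0 1)"
          using r by (auto simp: N_def)
        then show ?thesis
          using False continuous_map_from_subtopology[OF continuous_map_snd[of euclideanreal X]]
          by (auto simp: continuous_map_in_subtopology T_def)
      qed
      have fst: "continuous_map ?Z euclideanreal fst"
        by (intro continuous_map_from_subtopology continuous_map_fst)
      have ms: "continuous_map ?Z tube_top (\<lambda>z. \<mu> (snd z))"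
        using continuous_map_compose[OF snd \<mu>_cont] by (simp add: o_def)
      have m1: "continuous_map ?Z (subtopology X B) (\<lambda>z. fst (\<mu> (snd z)))"
        using continuous_map_compose[OF ms continuous_map_fst] by (simp add: o_def)
      have m2: "continuous_map ?Z (top_of_set (cball 0 1)) (\<lambda>z. snd (\<mu> (snd z)))"
        using continuous_map_compose[OF ms continuous_map_snd] by (simp add: o_def)
      have m2': "continuous_map ?Z euclidean (\<lambda>z. snd (\<mu> (snd z)))"
        and m2_le: "\<And>z. z \<in> topspace ?Z \<Longrightarrow> cmod (snd (\<mu> (snd z))) \<le> 1"
        using m2 by (auto simp: continuous_map_in_subtopology Pi_iff)
      have "continuous_map ?Z euclidean (\<lambda>z. cis (fst z))"
        by (rule continuous_map_euclidean_compose[OF fst]) (intro continuous_intros)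
      with m2' have "continuous_map ?Z euclidean (\<lambda>z. cis (fst z) * snd (\<mu> (snd z)))"
        by (auto simp: continuous_map_atin intro!: tendsto_mult)
      with m2_le have "continuous_map ?Z (top_of_set (cball 0 1)) (\<lambda>z. cis (fst z) * snd (\<mu> (snd z)))"
        by (auto simp: continuous_map_in_subtopology norm_mult)
      with m1 have "continuous_map ?Z tube_top (\<lambda>z. (fst (\<mu> (snd z)), cis (fst z) * snd (\<mu> (snd z))))"
        by (rule continuous_map_pairedI)
      from continuous_map_compose[OF this continuous_map_tube]
      have "continuous_map ?Z X (\<lambda>z. tube (fst (\<mu> (snd z)), cis (fst z) * snd (\<mu> (snd z))))"
        by (simp add: o_def)
      then show ?thesis
      proof (rule continuous_map_eq)
        fix z assume "z \<in> topspace ?Z"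
        then obtain \<theta> b w where z: "z = (\<theta>, tube (b, w))" "b \<in> B" "cmod w < r"
          using False by (auto simp: T_def N_def)
        then show "tube (fst (\<mu> (snd z)), cis (fst z) * snd (\<mu> (snd z))) = (\<lambda>(\<theta>, x). unit_flow \<theta> x) z"
          using r by (simp add: \<mu>_tube unit_flow_tube)
      qed
    qed
  next
    fix z assume "z \<in> topspace ?R"
    moreover have "b \<in> N" if "b \<in> B" for b
      using that r tube_0[OF that] by (auto simp: N_def intro!: image_eqI[of _ _ "(b, 0)"])
    ultimately show "\<exists>i. i \<in> UNIV \<and> z \<in> T i \<and> (case z of (\<theta>, x) \<Rightarrow> unit_flow \<theta> x) = (case z of (\<theta>, x) \<Rightarrow> unit_flow \<theta> x)"
      unfolding T_def by (cases "snd z \<in> B") (auto intro: exI[of _ False] exI[of _ True])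
  qed auto
qed

lemma normalized_unit_flow: "normalized_flow X B p unit_flow"
  unfolding normalized_flow_def flow_on_def
  using continuous_map_unit_flow unit_flow_0 unit_flow_add unit_flow_in_complement fibration_unit_flow
  by auto

text \<open>The orbit is back on the page exactly when \<open>angle t x\<close> is a multiple of
  \<open>2 * pi\<close>, and the angle increases with \<open>t\<close>, so the first return is at
  angle \<open>2 * pi\<close>.\<close>

lemma return_map_unit_flow:
  assumes "x \<in> page X B p \<zeta>"
  shows "return_map (page X B p \<zeta>) B \<Phi> x = unit_flow (2 * pi) x"
proof (cases "x \<in> B")
  case False
  with assms have x: "x \<in> topspace X - B" and px: "p x = \<zeta>"
    by (auto simp: page_def)
  have page_iff: "\<Phi> t x \<in> page X B p \<zeta> \<longleftrightarrow> cis (angle t x) = 1" for t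
    using flow_complement[OF x, of t] fibration_flow[OF x, of t] norm_fibration[OF x] px
    by (auto simp: page_def)
  have "(LEAST t. 0 < t \<and> \<Phi> t x \<in> page X B p \<zeta>) = time (2 * pi) x"
  proof (rule Least_equality)
    show "0 < time (2 * pi) x \<and> \<Phi> (time (2 * pi) x) x \<in> page X B p \<zeta>"
      using x angle_0[OF x] by (simp add: page_iff less_time_iff)
  next
    fix t assume t: "0 < t \<and> \<Phi> t x \<in> page X B p \<zeta>"
    then have "cos (angle t x) = 1"
      by (simp add: page_iff complex_eq_iff)
    then obtain n :: int where n: "angle t x = of_int n * 2 * pi"
      by (auto simp: cos_one_2pi_int)
    moreover have "0 < angle t x"
      using angle_less_iff[OF x, of 0 t] angle_0[OF x] t by simp
    ultimately have "0 < n"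
      by (simp add: zero_less_mult_iff)
    then have "1 * (2 * pi) \<le> of_int n * (2 * pi)"
      by (intro mult_right_mono) auto
    then have "\<not> angle t x < 2 * pi"
      using n by simp
    then show "time (2 * pi) x \<le> t"
      using less_time_iff[OF x, of t "2 * pi"] by linarith
  qed
  then show ?thesis
    using False by (simp add: return_map_def unit_flow_complement)
qed (simp add: return_map_def)

end

context open_book begin

lemma normalized_flow_of_open_book_flow:
  assumes "open_book_flow X B p \<Phi>"
  obtains \<Psi> where "normalized_flow X B p \<Psi>"
    "\<And>\<zeta> x. x \<in> page X B p \<zeta> \<Longrightarrow> return_map (page X B p \<zeta>) B \<Phi> x = \<Psi> (2 * pi) x"
proof -
  interpret open_book_with_flow X B p \<Phi>
    by unfold_locales (rule assms)
  show ?thesis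
    using that normalized_unit_flow return_map_unit_flow by blast
qed

end

section \<open>Isotopies and transport of mapping classes\<close>

text \<open>Replacing maps by their restrictions inside \<open>homotopic_with\<close> requires a
  predicate that depends only on the values on the space.\<close>

lemma homeomorphic_map_fixing_cong:
  assumes "D \<subseteq> topspace X" "\<And>x. x \<in> topspace X \<Longrightarrow> h x = k x"
  shows "homeomorphic_map X Y h \<and> (\<forall>x\<in>D. h x = e x) \<longleftrightarrow>
    homeomorphic_map X Y k \<and> (\<forall>x\<in>D. k x = e x)"
  using assms homeomorphic_map_eq[of X Y h k] homeomorphic_map_eq[of X Y k h]
  by (metis subsetD)

lemma equiv_isotopy_rel:
  assumes "D \<subseteq> topspace X"
  shows "equiv (homeos_fixing X D) (isotopy_rel X D)"
proof (rule equivI)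
  show "isotopy_rel X D \<subseteq> homeos_fixing X D \<times> homeos_fixing X D"
    by (auto simp: isotopy_rel_def)
  show "refl_on (homeos_fixing X D) (isotopy_rel X D)"
    unfolding isotopy_rel_def homeos_fixing_def
    by (auto simp: refl_on_def homotopic_with_refl homeomorphic_imp_continuous_map)
  show "sym (isotopy_rel X D)"
    by (auto simp: sym_def isotopy_rel_def homotopic_with_symD)
  show "trans (isotopy_rel X D)"
    unfolding trans_def isotopy_rel_def by (auto intro: homotopic_with_trans)
qed

lemma homeos_fixing_in_topspace:
  assumes "f \<in> homeos_fixing X D" "x \<in> topspace X"
  shows "f x \<in> topspace X"
proof -
  have "f ` topspace X = topspace X"
    using assms(1) homeomorphic_imp_surjective_map[of X X f] by (simp add: homeos_fixing_def)
  with assms(2) show ?thesis by blast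
qed

lemma restrict_in_homeos_fixing:
  assumes "D \<subseteq> topspace X" "homeomorphic_map X X f" "\<And>x. x \<in> D \<Longrightarrow> f x = x"
  shows "restrict f (topspace X) \<in> homeos_fixing X D"
proof -
  have "homeomorphic_map X X (restrict f (topspace X))"
    using assms(2) by (rule homeomorphic_map_eq) simp
  then show ?thesis
    using assms by (auto simp: homeos_fixing_def)
qed

lemma mapping_class_in_group:
  assumes "D \<subseteq> topspace X" "homeomorphic_map X X f" "\<And>x. x \<in> D \<Longrightarrow> f x = x"
  shows "mapping_class X D f \<in> mapping_class_group X D"
  unfolding mapping_class_def mapping_class_group_def
  by (rule quotientI) (rule restrict_in_homeos_fixing[OF assms])

lemma mapping_class_cong:
  assumes "\<And>x. x \<in> topspace X \<Longrightarrow> f x = h x"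
  shows "mapping_class X D f = mapping_class X D h"
proof -
  have "restrict f (topspace X) = restrict h (topspace X)"
    using assms by (intro restrict_ext) auto
  then show ?thesis by (simp add: mapping_class_def)
qed

lemma mapping_class_eqI:
  fixes k :: "real \<Rightarrow> 'a \<Rightarrow> 'a"
  assumes D: "D \<subseteq> topspace X"
    and cont: "continuous_map (prod_topology (top_of_set {0..1}) X) X (\<lambda>(t, x). k t x)"
    and hom: "\<And>t. t \<in> {0..1} \<Longrightarrow> homeomorphic_map X X (k t)"
    and fixD: "\<And>t x. t \<in> {0..1} \<Longrightarrow> x \<in> D \<Longrightarrow> k t x = x"
  shows "mapping_class X D (k 0) = mapping_class X D (k 1)"
proof -
  have "homotopic_with (\<lambda>k. homeomorphic_map X X k \<and> (\<forall>x\<in>D. k x = x)) X X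
      (restrict (k 0) (topspace X)) (restrict (k 1) (topspace X))"
  proof (subst homotopic_with)
    show "(homeomorphic_map X X h \<and> (\<forall>x\<in>D. h x = x)) = (homeomorphic_map X X k \<and> (\<forall>x\<in>D. k x = x))"
      if "\<And>x. x \<in> topspace X \<Longrightarrow> h x = k x" for h k
      by (rule homeomorphic_map_fixing_cong[OF D that])
    show "\<exists>h. continuous_map (prod_topology (top_of_set {0..1::real}) X) X h \<and>
      (\<forall>x\<in>topspace X. h (0, x) = restrict (k 0) (topspace X) x) \<and>
      (\<forall>x\<in>topspace X. h (1, x) = restrict (k 1) (topspace X) x) \<and>
      (\<forall>t\<in>{0..1}. homeomorphic_map X X (\<lambda>x. h (t, x)) \<and> (\<forall>x\<in>D. h (t, x) = x))"
      by (rule exI[of _ "\<lambda>(t, x). k t x"]) (use cont hom fixD in simp)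
  qed
  then have "(restrict (k 0) (topspace X), restrict (k 1) (topspace X)) \<in> isotopy_rel X D"
    using hom fixD by (auto simp: isotopy_rel_def intro!: restrict_in_homeos_fixing[OF D])
  then show ?thesis
    unfolding mapping_class_def by (rule equiv_class_eq[OF equiv_isotopy_rel[OF D]])
qed

lemma isotopy_rel_transport:
  assumes g: "homeomorphic_maps X Y g g'" and D: "D \<subseteq> topspace X"
    and fh: "(f, h) \<in> isotopy_rel X D"
  shows "(restrict (g \<circ> f \<circ> g') (topspace Y), restrict (g \<circ> h \<circ> g') (topspace Y)) \<in> isotopy_rel Y (g ` D)"
proof -
  have gD: "g ` D \<subseteq> topspace Y"
    using g D homeomorphic_maps_map homeomorphic_imp_surjective_map by (metis image_mono)
  have hg: "homeomorphic_map X Y g" and hg': "homeomorphic_map Y X g'"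
    using g homeomorphic_maps_map by blast+
  have g'g: "g' (g x) = x" if "x \<in> D" for x
    using g D that by (auto simp: homeomorphic_maps_def)
  let ?P = "\<lambda>k. homeomorphic_map X X k \<and> (\<forall>x\<in>D. k x = x)"
  let ?Q = "\<lambda>k. homeomorphic_map Y Y k \<and> (\<forall>x\<in>g ` D. k x = x)"
  have conj: "?Q (g \<circ> k \<circ> g')" if "?P k" for k
    using that hg hg' g'g by (auto intro!: homeomorphic_map_compose)
  have f: "?P f" and h: "?P h" and hom: "homotopic_with ?P X X f h"
    using fh by (auto simp: isotopy_rel_def homeos_fixing_def)
  \<comment> \<open>Halfway the maps go from \<open>X\<close> to \<open>Y\<close>, so the predicate
    is imposed on their composites with \<open>g'\<close>.\<close>
  have "homotopic_with (\<lambda>k. ?Q (k \<circ> g')) X Y (g \<circ> f) (g \<circ> h)"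
    by (rule homotopic_with_compose_continuous_map_left[OF hom homeomorphic_imp_continuous_map[OF hg]])
       (rule conj)
  then have "homotopic_with ?Q Y Y (g \<circ> f \<circ> g') (g \<circ> h \<circ> g')"
    by (rule homotopic_with_compose_continuous_map_right[OF _ homeomorphic_imp_continuous_map[OF hg']])
  then have "homotopic_with ?Q Y Y (restrict (g \<circ> f \<circ> g') (topspace Y)) (restrict (g \<circ> h \<circ> g') (topspace Y))"
  proof (rule homotopic_with_eq)
    show "?Q h \<longleftrightarrow> ?Q k" if "\<And>x. x \<in> topspace Y \<Longrightarrow> h x = k x" for h k
      by (rule homeomorphic_map_fixing_cong[OF gD that])
  qed simp_all
  moreover have "restrict (g \<circ> k \<circ> g') (topspace Y) \<in> homeos_fixing Y (g ` D)" if "?P k" for k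
    using conj[OF that] by (intro restrict_in_homeos_fixing[OF gD]) blast+
  ultimately show ?thesis
    using f h by (simp add: isotopy_rel_def)
qed

text \<open>Conjugation carries an isotopy class into an isotopy class. That the image is the whole
  class follows by conjugating back with \<open>tr'\<close>.\<close>

lemma transport_mapping_class:
  assumes g: "homeomorphic_maps X Y g g'" and D: "D \<subseteq> topspace X"
    and f: "restrict f (topspace X) \<in> homeos_fixing X D"
  shows "transport_class Y g g' (mapping_class X D f) = mapping_class Y (g ` D) (g \<circ> f \<circ> g')"
proof -
  define tr where "tr k = restrict (g \<circ> k \<circ> g') (topspace Y)" for k
  define tr' where "tr' k = restrict (g' \<circ> k \<circ> g) (topspace X)" for k
  have gX: "g x \<in> topspace Y" "g' (g x) = x" if "x \<in> topspace X" for x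
    using g that homeomorphic_imp_surjective_map by (auto simp: homeomorphic_maps_def homeomorphic_maps_map continuous_map_def)
  have g'Y: "g' y \<in> topspace X" "g (g' y) = y" if "y \<in> topspace Y" for y
    using g that by (auto simp: homeomorphic_maps_def continuous_map_def)
  have D': "g' ` g ` D = D" "g ` D \<subseteq> topspace Y"
    using D gX by (force simp: image_image)+
  have tr: "(tr h, tr k) \<in> isotopy_rel Y (g ` D)" if "(h, k) \<in> isotopy_rel X D" for h k
    unfolding tr_def by (rule isotopy_rel_transport[OF g D that])
  have tr': "(tr' h, tr' k) \<in> isotopy_rel X D" if "(h, k) \<in> isotopy_rel Y (g ` D)" for h k
    using isotopy_rel_transport[OF homeomorphic_maps_sym[THEN iffD1, OF g] D'(2) that]
    by (simp only: tr'_def D'(1))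
  have tr_tr': "tr (tr' k) = k" if "k \<in> homeos_fixing Y (g ` D)" for k
  proof (rule extensionalityI[of _ "topspace Y"])
    fix y assume y: "y \<in> topspace Y"
    then have "k y \<in> topspace Y"
      by (rule homeos_fixing_in_topspace[OF that])
    then show "tr (tr' k) y = k y"
      using y g'Y gX by (simp add: tr_def tr'_def)
  qed (use that in \<open>auto simp: tr_def homeos_fixing_def\<close>)
  have trf: "tr (restrict f (topspace X)) = restrict (g \<circ> f \<circ> g') (topspace Y)"
    unfolding tr_def using g'Y by (intro restrict_ext) auto
  have tr'_tr: "tr' (tr k) = k" if "k \<in> homeos_fixing X D" for k
  proof (rule extensionalityI[of _ "topspace X"])
    fix x assume x: "x \<in> topspace X"
    then have "k x \<in> topspace X"
      by (rule homeos_fixing_in_topspace[OF that])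
    then show "tr' (tr k) x = k x"
      using x g'Y gX by (simp add: tr_def tr'_def)
  qed (use that in \<open>auto simp: tr'_def homeos_fixing_def\<close>)
  have "tr ` (isotopy_rel X D `` {f'}) = isotopy_rel Y (g ` D) `` {tr f'}"
    if "f' \<in> homeos_fixing X D" for f'
  proof
    show "isotopy_rel Y (g ` D) `` {tr f'} \<subseteq> tr ` (isotopy_rel X D `` {f'})"
    proof
      fix h assume "h \<in> isotopy_rel Y (g ` D) `` {tr f'}"
      then have h: "(tr f', h) \<in> isotopy_rel Y (g ` D)" by simp
      then have "h \<in> homeos_fixing Y (g ` D)"
        by (simp add: isotopy_rel_def)
      moreover have "(f', tr' h) \<in> isotopy_rel X D"
        using tr'[OF h] tr'_tr[OF that] by simp
      ultimately show "h \<in> tr ` (isotopy_rel X D `` {f'})"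
        by (intro image_eqI[of _ _ "tr' h"]) (simp_all add: tr_tr')
    qed
  qed (use tr in auto)
  from this[OF f] show ?thesis
    unfolding mapping_class_def transport_class_def trf[symmetric] by (simp add: tr_def)
qed

section \<open>Independence of the monodromy from the flow\<close>

context open_book begin

lemma binding_subset_page: "B \<subseteq> topspace (subtopology X (page X B p \<zeta>))"
  using closedin_subset[OF closed] by (auto simp: page_def)

lemma normalized_flow_in_topspace:
  assumes "normalized_flow X B p \<Psi>" "x \<in> topspace X"
  shows "\<Psi> \<theta> x \<in> topspace X"
  using assms flow_on_in_topspace[of X \<Psi> x \<theta>] by (simp add: normalized_flow_def)

lemma normalized_flow_0:
  assumes "normalized_flow X B p \<Psi>" "x \<in> topspace X"
  shows "\<Psi> 0 x = x"
  using assms by (simp add: normalized_flow_def flow_on_def)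

lemma normalized_flow_cancel:
  assumes "normalized_flow X B p \<Psi>" "x \<in> topspace X"
  shows "\<Psi> (- \<theta>) (\<Psi> \<theta> x) = x" "\<Psi> \<theta> (\<Psi> (- \<theta>) x) = x"
proof -
  have "\<Psi> (- \<theta> + \<theta>) x = \<Psi> (- \<theta>) (\<Psi> \<theta> x)" "\<Psi> (\<theta> + - \<theta>) x = \<Psi> \<theta> (\<Psi> (- \<theta>) x)" "\<Psi> 0 x = x"
    using assms unfolding normalized_flow_def flow_on_def by blast+
  then show "\<Psi> (- \<theta>) (\<Psi> \<theta> x) = x" "\<Psi> \<theta> (\<Psi> (- \<theta>) x) = x" by simp_all
qed

text \<open>The argument of \<open>p\<close> advances by \<open>s + t\<close>, a whole number of
  turns. A general \<open>n\<close> covers the exchange maps (\<open>n = 1\<close>) and their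
  inverses (\<open>n = -1\<close>).\<close>

lemma normalized_flow_exchange:
  assumes \<Psi>: "normalized_flow X B p \<Psi>" and \<Psi>': "normalized_flow X B p \<Psi>'"
    and x: "x \<in> page X B p \<zeta>" and st: "s + t = 2 * pi * of_int n"
  shows "\<Psi>' s (\<Psi> t x) \<in> page X B p \<zeta>"
proof (cases "x \<in> B")
  case True
  then show ?thesis
    using \<Psi> \<Psi>' by (simp add: normalized_flow_def page_def)
next
  case False
  then have x': "x \<in> topspace X - B" and px: "p x = \<zeta>"
    using x by (auto simp: page_def)
  then have y: "\<Psi> t x \<in> topspace X - B"
    using \<Psi> flow_on_in_topspace[of X \<Psi> x t] by (simp add: normalized_flow_def)
  have "cis (s + t) = 1"
    unfolding st by (simp add: complex_eq_iff)
  moreover have "p (\<Psi>' s (\<Psi> t x)) = cis (s + t) * p x"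
    using \<Psi> \<Psi>' x' y by (simp add: normalized_flow_def cis_mult flip: mult.assoc)
  ultimately have "p (\<Psi>' s (\<Psi> t x)) = \<zeta>"
    using px by simp
  moreover have "\<Psi>' s (\<Psi> t x) \<in> topspace X - B"
    using \<Psi>' y flow_on_in_topspace[of X \<Psi>' "\<Psi> t x" s] by (simp add: normalized_flow_def)
  ultimately show ?thesis
    by (simp add: page_def)
qed

lemma homeomorphic_map_exchange:
  assumes \<Psi>: "normalized_flow X B p \<Psi>" and \<Psi>': "normalized_flow X B p \<Psi>'"
    and st: "s + t = 2 * pi"
  shows "homeomorphic_map (subtopology X (page X B p \<zeta>)) (subtopology X (page X B p \<zeta>)) (\<lambda>x. \<Psi>' s (\<Psi> t x))"
proof -
  let ?P = "subtopology X (page X B p \<zeta>)"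
  have cont: "continuous_map ?P ?P (\<lambda>x. \<Xi>' u (\<Xi> v x))"
    if "normalized_flow X B p \<Xi>" "normalized_flow X B p \<Xi>'" "u + v = 2 * pi * of_int n" for \<Xi> \<Xi>' u v n
  proof -
    have "continuous_map ?P X (\<lambda>x. \<Xi>' u (\<Xi> v x))"
    proof (rule continuous_map_flow_on[where \<Phi> = \<Xi>' and f = "\<lambda>_. u" and g = "\<Xi> v"])
      show "flow_on X \<Xi>'" using that(2) by (simp add: normalized_flow_def)
      show "continuous_map ?P X (\<Xi> v)"
      proof (rule continuous_map_flow_on[where \<Phi> = \<Xi> and f = "\<lambda>_. v" and g = "\<lambda>x. x"])
        show "flow_on X \<Xi>" using that(1) by (simp add: normalized_flow_def)
      qed (simp_all add: continuous_map_from_subtopology)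
    qed simp
    then show ?thesis
      unfolding continuous_map_in_subtopology
      using normalized_flow_exchange[OF that(1,2) _ that(3), of _ \<zeta>] by simp
  qed
  have "homeomorphic_maps ?P ?P (\<lambda>x. \<Psi>' s (\<Psi> t x)) (\<lambda>x. \<Psi> (-t) (\<Psi>' (-s) x))"
    unfolding homeomorphic_maps_def
  proof (intro conjI ballI)
    show "continuous_map ?P ?P (\<lambda>x. \<Psi>' s (\<Psi> t x))"
      by (rule cont[OF \<Psi> \<Psi>', of _ _ 1]) (use st in simp)
    show "continuous_map ?P ?P (\<lambda>x. \<Psi> (- t) (\<Psi>' (- s) x))"
      by (rule cont[OF \<Psi>' \<Psi>, of _ _ "-1"]) (use st in simp)
    fix x assume "x \<in> topspace ?P"
    then have x: "x \<in> topspace X" by simp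
    then have "\<Psi> t x \<in> topspace X" "\<Psi>' (- s) x \<in> topspace X"
      by (simp_all add: normalized_flow_in_topspace[OF \<Psi>] normalized_flow_in_topspace[OF \<Psi>'])
    then show "\<Psi> (- t) (\<Psi>' (- s) (\<Psi>' s (\<Psi> t x))) = x" "\<Psi>' s (\<Psi> t (\<Psi> (- t) (\<Psi>' (- s) x))) = x"
      using x by (simp_all add: normalized_flow_cancel[OF \<Psi>] normalized_flow_cancel[OF \<Psi>'])
  qed
  then show ?thesis
    by (meson homeomorphic_maps_map)
qed

lemma homeomorphic_map_normalized_flow:
  assumes "normalized_flow X B p \<Psi>"
  shows "homeomorphic_map (subtopology X (page X B p \<zeta>)) (subtopology X (page X B p \<zeta>)) (\<Psi> (2 * pi))"
  by (rule homeomorphic_map_eq[OF homeomorphic_map_exchange[OF assms assms, of 0 "2 * pi"]])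
    (simp_all add: normalized_flow_0[OF assms] normalized_flow_in_topspace[OF assms])

lemma normalized_flow_mapping_class_eq:
  assumes \<Psi>: "normalized_flow X B p \<Psi>" and \<Psi>': "normalized_flow X B p \<Psi>'"
  shows "mapping_class (subtopology X (page X B p \<zeta>)) B (\<Psi> (2 * pi)) =
    mapping_class (subtopology X (page X B p \<zeta>)) B (\<Psi>' (2 * pi))"
proof -
  let ?P = "subtopology X (page X B p \<zeta>)"
  define k where "k \<tau> x = \<Psi>' (2 * pi * (1 - \<tau>)) (\<Psi> (2 * pi * \<tau>) x)" for \<tau> x
  have "mapping_class ?P B (k 0) = mapping_class ?P B (k 1)"
  proof (rule mapping_class_eqI[OF binding_subset_page])
    let ?Z = "prod_topology (top_of_set {0..1::real}) ?P"
    have "continuous_map ?Z euclideanreal fst"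
      using continuous_map_fst[of "top_of_set {0..1::real}" ?P] by (simp add: continuous_map_in_subtopology)
    then have t: "continuous_map ?Z euclideanreal (\<lambda>z. f (fst z))" if "continuous_on UNIV f" for f
      by (rule continuous_map_euclidean_compose) (rule that)
    have snd: "continuous_map ?Z X snd"
      using continuous_map_snd[of "top_of_set {0..1::real}" ?P] by (simp add: continuous_map_in_subtopology)
    have "continuous_map ?Z X (\<lambda>z. \<Psi>' (2 * pi * (1 - fst z)) (\<Psi> (2 * pi * fst z) (snd z)))"
    proof (rule continuous_map_flow_on[where \<Phi> = \<Psi>'
          and f = "\<lambda>z. 2 * pi * (1 - fst z)" and g = "\<lambda>z. \<Psi> (2 * pi * fst z) (snd z)"])
      show "flow_on X \<Psi>'" using \<Psi>' by (simp add: normalized_flow_def)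
      show "continuous_map ?Z X (\<lambda>z. \<Psi> (2 * pi * fst z) (snd z))"
      proof (rule continuous_map_flow_on[where \<Phi> = \<Psi> and f = "\<lambda>z. 2 * pi * fst z" and g = snd])
        show "flow_on X \<Psi>" using \<Psi> by (simp add: normalized_flow_def)
        show "continuous_map ?Z euclideanreal (\<lambda>z. 2 * pi * fst z)"
          by (rule t) (intro continuous_intros)
        show "continuous_map ?Z X snd" by (rule snd)
      qed
      show "continuous_map ?Z euclideanreal (\<lambda>z. 2 * pi * (1 - fst z))"
        by (rule t) (intro continuous_intros)
    qed
    moreover have "k (fst z) (snd z) \<in> page X B p \<zeta>" if "z \<in> topspace ?Z" for z
      unfolding k_def
      by (rule normalized_flow_exchange[OF \<Psi> \<Psi>', of _ _ _ _ 1]) (use that in \<open>auto simp: algebra_simps\<close>)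
    ultimately show "continuous_map ?Z ?P (\<lambda>(\<tau>, x). k \<tau> x)"
      unfolding continuous_map_in_subtopology by (simp add: k_def case_prod_unfold image_subset_iff)
    show "homeomorphic_map ?P ?P (k \<tau>)" for \<tau>
      unfolding k_def[abs_def] by (rule homeomorphic_map_exchange[OF \<Psi> \<Psi>']) (simp add: algebra_simps)
    show "k \<tau> x = x" if "x \<in> B" for \<tau> x
      using \<Psi> \<Psi>' that by (simp add: normalized_flow_def k_def)
  qed
  moreover have "mapping_class ?P B (k 0) = mapping_class ?P B (\<Psi>' (2 * pi))"
    by (rule mapping_class_cong) (simp add: k_def normalized_flow_0[OF \<Psi>])
  moreover have "mapping_class ?P B (k 1) = mapping_class ?P B (\<Psi> (2 * pi))"
    by (rule mapping_class_cong)
      (simp add: k_def normalized_flow_0[OF \<Psi>'] normalized_flow_in_topspace[OF \<Psi>])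
  ultimately show ?thesis by simp
qed

theorem is_monodromy_normalized_flow:
  assumes "open_book_flow X B p \<Phi>" and \<Psi>: "normalized_flow X B p \<Psi>"
  shows "is_monodromy X B p \<zeta> (mapping_class (subtopology X (page X B p \<zeta>)) B (\<Psi> (2 * pi)))"
  unfolding is_monodromy_def
proof (intro conjI allI impI)
  show "mapping_class (subtopology X (page X B p \<zeta>)) B (\<Psi> (2 * pi))
      \<in> mapping_class_group (subtopology X (page X B p \<zeta>)) B"
    using \<Psi> by (intro mapping_class_in_group[OF binding_subset_page] homeomorphic_map_normalized_flow)
      (auto simp: normalized_flow_def)
  show "\<exists>\<Phi>. open_book_flow X B p \<Phi>"
    using assms(1) by blast
next
  fix \<Phi>' assume "open_book_flow X B p \<Phi>'"
  then obtain \<Psi>' where "normalized_flow X B p \<Psi>'"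
    and ret: "\<And>\<zeta> x. x \<in> page X B p \<zeta> \<Longrightarrow> return_map (page X B p \<zeta>) B \<Phi>' x = \<Psi>' (2 * pi) x"
    by (rule normalized_flow_of_open_book_flow) blast
  moreover have "mapping_class (subtopology X (page X B p \<zeta>)) B (return_map (page X B p \<zeta>) B \<Phi>') =
      mapping_class (subtopology X (page X B p \<zeta>)) B (\<Psi>' (2 * pi))"
    using ret by (intro mapping_class_cong) simp
  ultimately show "mapping_class (subtopology X (page X B p \<zeta>)) B (return_map (page X B p \<zeta>) B \<Phi>') =
      mapping_class (subtopology X (page X B p \<zeta>)) B (\<Psi> (2 * pi))"
    using normalized_flow_mapping_class_eq[OF \<Psi>] by simp
qed

end

section \<open>Coordinates on the total space\<close>

abbreviation model :: "(complex \<times> complex) set" where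
  "model \<equiv> cball 0 1 \<times> sphere 0 1"

text \<open>\<open>Arg2pi\<close> selects \<open>t\<close> in \<open>[0, 1)\<close>. Its jump at
  \<open>w = 1\<close> is absorbed by the gluing of the two ends, because
  \<open>cis pi = -1\<close>.\<close>

definition klassen_proj :: "complex \<times> complex \<Rightarrow> (complex \<times> real) set" where
  "klassen_proj = (\<lambda>(v, w). let t = Arg2pi w / (2 * pi) in
     glue_proj solid_cylinder klassen_rel (cis (- pi * t) * v, t))"

lemma klassen_proj_cis:
  assumes "cmod z \<le> 1" "t \<in> {0..1}"
  shows "klassen_proj (cis (pi * t) * z, cis (2 * pi * t)) = glue_proj solid_cylinder klassen_rel (z, t)"
proof (cases "t = 1")
  case True
  \<comment> \<open>At \<open>t = 1\<close> the second coordinate is \<open>1\<close>, for which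
    \<open>klassen_proj\<close> uses the slice \<open>0\<close>; the factor \<open>cis pi\<close>
    supplies the sign.\<close>
  have "klassen_proj (cis (pi * t) * z, cis (2 * pi * t)) = glue_proj solid_cylinder klassen_rel (- z, 0)"
    using True Arg2pi_unique[of 1 0 1] by (simp add: klassen_proj_def)
  also have "\<dots> = glue_proj solid_cylinder klassen_rel (z, t)"
    using True assms by (intro glue_proj_eqI [symmetric]) (auto simp: klassen_rel_def)
  finally show ?thesis .
next
  case False
  then have "Arg2pi (cis (2 * pi * t)) = 2 * pi * t"
    using assms by (intro Arg2pi_unique[of 1]) (auto simp: cis_conv_exp)
  then show ?thesis
    by (simp add: klassen_proj_def cis_mult flip: mult.assoc)
qed

lemma model_cases:
  assumes "a \<in> model"
  obtains z t where "cmod z \<le> 1" "t \<in> {0..<1}" "a = (cis (pi * t) * z, cis (2 * pi * t))"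
proof -
  obtain v w where a: "a = (v, w)" "cmod v \<le> 1" "cmod w = 1"
    using assms by auto
  define t where "t = Arg2pi w / (2 * pi)"
  have "t \<in> {0..<1}" "cis (2 * pi * t) = w"
    using Arg2pi_ge_0 [of w] Arg2pi_lt_2pi [of w] a Arg2pi_eq [of w]
    by (auto simp: t_def cis_conv_exp divide_simps)
  moreover have "cis (pi * t) * (cis (- pi * t) * v) = v"
    by (simp only: cis_mult flip: mult.assoc) simp
  ultimately show ?thesis
    using that[of "cis (- pi * t) * v" t] a by (simp add: norm_mult)
qed

text \<open>The jump of \<open>Arg2pi\<close> is never examined: \<open>G\<close> is a quotient map,
  being a continuous surjection from a compact to a Hausdorff space, and
  \<open>klassen_proj \<circ> G\<close> is the original gluing projection.\<close>

lemma quotient_map_klassen_proj: "quotient_map (top_of_set model) klassen_space klassen_proj"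
proof -
  define G where "G = (\<lambda>(z::complex, t::real). (cis (pi * t) * z, cis (2 * pi * t)))"
  have G: "continuous_map solid_cylinder (top_of_set model) G"
    unfolding G_def case_prod_unfold cis_conv_exp
    by (auto intro!: continuous_intros simp: norm_mult)
  have "G ` topspace solid_cylinder = model"
  proof
    show "model \<subseteq> G ` topspace solid_cylinder"
    proof
      fix a assume "a \<in> model"
      then obtain z t where "cmod z \<le> 1" "t \<in> {0..<1}" "a = (cis (pi * t) * z, cis (2 * pi * t))"
        by (rule model_cases)
      then show "a \<in> G ` topspace solid_cylinder"
        by (intro image_eqI[of _ _ "(z, t)"]) (auto simp: G_def)
    qed
  qed (auto simp: G_def norm_mult)
  moreover have "compact_space solid_cylinder"
    by (simp add: compact_space_subtopology compact_Times compactin_subtopology)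
  ultimately have qG: "quotient_map solid_cylinder (top_of_set model) G"
    using G by (intro continuous_imp_quotient_map) (auto simp: Hausdorff_space_subtopology)
  have eq: "klassen_proj (G x) = glue_proj solid_cylinder klassen_rel x" if "x \<in> topspace solid_cylinder" for x
    using that klassen_proj_cis by (auto simp: G_def)
  have q: "quotient_map solid_cylinder klassen_space (klassen_proj \<circ> G)"
    by (rule quotient_map_eq[OF quotient_map_glue[of solid_cylinder klassen_rel, folded klassen_space_def]])
       (simp only: eq o_def)
  show ?thesis
    by (rule quotient_map_from_composition[OF G continuous_compose_quotient_map[OF qG] q])
       (rule quotient_imp_continuous_map[OF q])
qed

lemma klassen_proj_eq_iff:
  assumes "(v, w) \<in> model" "(v', w') \<in> model"
  shows "klassen_proj (v, w) = klassen_proj (v', w') \<longleftrightarrow> w = w' \<and> (v = v' \<or> v' = - v \<and> cmod v = 1)"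
proof -
  let ?Q = "glue_proj solid_cylinder klassen_rel"
  \<comment> \<open>In the new coordinates these invariants are \<open>v\<^sup>2\<close>,
    \<open>w\<close> and \<open>(1 - cmod v) * v\<close>. The first fixes \<open>v\<close> up to
    sign; the last detects the sign when \<open>cmod v < 1\<close>.\<close>
  define H where "H = (\<lambda>(z::complex, t::real). (cis (2 * pi * t) * z\<^sup>2, cis (2 * pi * t), complex_of_real (1 - cmod z) * (cis (pi * t) * z)))"
  have H1: "H a = H b" if "(a, b) \<in> klassen_rel" for a b
    using that unfolding klassen_rel_def H_def by auto
  have H: "H a = H b" if "(a, b) \<in> (klassen_rel \<union> klassen_rel\<inverse>)\<^sup>*" for a b
    using that by (induction rule: rtrancl_induct) (auto dest: H1)
  obtain z t where zt: "cmod z \<le> 1" "t \<in> {0..<1}" "(v, w) = (cis (pi * t) * z, cis (2 * pi * t))"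
    by (rule model_cases[OF assms(1)])
  obtain z' t' where zt': "cmod z' \<le> 1" "t' \<in> {0..<1}" "(v', w') = (cis (pi * t') * z', cis (2 * pi * t'))"
    by (rule model_cases[OF assms(2)])
  have Q: "klassen_proj (v, w) = ?Q (z, t)" "klassen_proj (v', w') = ?Q (z', t')"
    using zt zt' klassen_proj_cis[of z t] klassen_proj_cis[of z' t'] by auto
  show ?thesis
  proof
    assume "klassen_proj (v, w) = klassen_proj (v', w')"
    then have "?Q (z, t) = ?Q (z', t')"
      by (simp only: Q)
    then have "((z, t), (z', t')) \<in> (klassen_rel \<union> klassen_rel\<inverse>)\<^sup>*"
      using zt zt' by (subst (asm) glue_proj_eq_iff) auto
    then have "H (z, t) = H (z', t')"
      by (rule H)
    moreover have "cis (2 * pi * t) = (cis (pi * t))\<^sup>2" for t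
      by (simp add: Complex.DeMoivre mult.assoc)
    ultimately have w: "w = w'" and sq: "v\<^sup>2 = v'\<^sup>2"
      and *: "complex_of_real (1 - cmod v) * v = complex_of_real (1 - cmod v') * v'"
      using zt zt' by (auto simp: H_def power_mult_distrib norm_mult)
    from sq have "v = v' \<or> v' = - v"
      by (metis minus_minus power2_eq_iff)
    moreover have "v = v' \<or> cmod v = 1" if "v' = - v"
    proof -
      define c where "c = complex_of_real (1 - cmod v) * v"
      have "c = - c"
        using * unfolding that c_def by (simp only: norm_minus_cancel mult_minus_right)
      then have "c + c = 0"
        using eq_neg_iff_add_eq_0 by blast
      then have "complex_of_real (1 - cmod v) * v = 0"
        unfolding c_def [symmetric] by (simp flip: mult_2)
      then have "complex_of_real (1 - cmod v) = 0 \<or> v = 0"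
        by (simp only: mult_eq_0_iff)
      then have "1 - cmod v = 0 \<or> v = 0"
        by (simp only: of_real_eq_0_iff)
      with that show ?thesis by auto
    qed
    ultimately show "w = w' \<and> (v = v' \<or> v' = - v \<and> cmod v = 1)"
      using w by blast
  next
    assume R: "w = w' \<and> (v = v' \<or> v' = - v \<and> cmod v = 1)"
    show "klassen_proj (v, w) = klassen_proj (v', w')"
    proof (cases "v = v'")
      case False
      with R have vw: "w' = w" "v' = - v" "cmod v = 1" by auto
      define t where "t = Arg2pi w / (2 * pi)"
      have t: "t \<in> {0..1}"
        using Arg2pi_ge_0[of w] Arg2pi_lt_2pi[of w] by (simp add: t_def divide_simps)
      show ?thesis
        unfolding klassen_proj_def vw Let_def case_prod_conv t_def[symmetric]
        by (rule glue_proj_eqI) (use vw(3) t in \<open>auto simp: klassen_rel_def norm_mult\<close>)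
    qed (use R in simp)
  qed
qed

lemma Hausdorff_klassen_space: "Hausdorff_space klassen_space"
  using homeomorphic_Hausdorff_space[OF klassen_space_homeomorphic] Hausdorff_projective_plane
  by (simp add: Hausdorff_space_prod_topology Hausdorff_space_subtopology)

lemma topspace_klassen_space: "topspace klassen_space = klassen_proj ` model"
  using quotient_imp_surjective_map[OF quotient_map_klassen_proj] by simp

lemma compact_klassen_space: "compact_space klassen_space"
proof -
  have "compactin (top_of_set model) model"
    by (simp add: compactin_subtopology compact_Times)
  from image_compactin[OF this quotient_imp_continuous_map[OF quotient_map_klassen_proj]]
  show ?thesis
    by (simp add: compact_space_def topspace_klassen_space)
qed

section \<open>Functions on the quotient and the defining function of the binding\<close>

definition klassen_lift :: "(complex \<times> complex \<Rightarrow> 'b) \<Rightarrow> (complex \<times> real) set \<Rightarrow> 'b" where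
  "klassen_lift F x = F (inv_into model klassen_proj x)"

lemma klassen_lift_proj:
  assumes F: "\<And>v w. cmod v = 1 \<Longrightarrow> cmod w = 1 \<Longrightarrow> F (- v, w) = F (v, w)" and a: "a \<in> model"
  shows "klassen_lift F (klassen_proj a) = F a"
proof -
  define b where "b = inv_into model klassen_proj (klassen_proj a)"
  have "klassen_proj b = klassen_proj a" "b \<in> model"
    unfolding b_def using a by (auto intro!: f_inv_into_f inv_into_into)
  moreover obtain v w v' w' where vw: "a = (v, w)" "b = (v', w')"
    by (metis surj_pair)
  ultimately have "w' = w" "v' = v \<or> v = - v' \<and> cmod v' = 1"
    using a klassen_proj_eq_iff[of v' w' v w] by auto
  then have "F b = F a"
    using vw a F[of v' w] by auto
  then show ?thesis
    by (simp add: klassen_lift_def b_def)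
qed

definition binding_coord :: "complex \<times> complex \<Rightarrow> complex" where
  "binding_coord = (\<lambda>(v, w). v\<^sup>2 - w / 4)"

definition binding_fun :: "(complex \<times> real) set \<Rightarrow> complex" where
  "binding_fun = klassen_lift binding_coord"

lemma binding_fun_proj: "a \<in> model \<Longrightarrow> binding_fun (klassen_proj a) = binding_coord a"
  unfolding binding_fun_def by (rule klassen_lift_proj) (simp_all add: binding_coord_def)

lemma continuous_map_binding_fun: "continuous_map klassen_space euclidean binding_fun"
proof (rule continuous_compose_quotient_map[OF quotient_map_klassen_proj])
  have "continuous_map (top_of_set model) euclidean binding_coord"
    unfolding binding_coord_def case_prod_unfold by (simp, intro continuous_intros) simp
  then show "continuous_map (top_of_set model) euclidean (binding_fun \<circ> klassen_proj)"
    by (rule continuous_map_eq) (simp add: binding_fun_proj)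
qed

lemma binding_coord_cis:
  "binding_coord (cis (pi * t) * z, cis (2 * pi * t)) = cis (2 * pi * t) * (z\<^sup>2 - 1/4)"
proof -
  have "cis (2 * pi * t) = (cis (pi * t))\<^sup>2"
    by (simp add: Complex.DeMoivre mult.assoc)
  then show ?thesis
    by (simp add: binding_coord_def power_mult_distrib algebra_simps)
qed

lemma klassen_fibration_eq:
  assumes "x \<in> topspace klassen_space"
  shows "klassen_fibration x = sgn (binding_fun x)"
proof -
  obtain a where "a \<in> model" "x = klassen_proj a"
    using assms by (auto simp: topspace_klassen_space)
  then obtain z t where zt: "cmod z \<le> 1" "t \<in> {0..<1}" "a = (cis (pi * t) * z, cis (2 * pi * t))"
    using model_cases by metis
  have "klassen_fibration x = klassen_formula (z, t)"
    using zt klassen_fibration_proj[of "(z, t)"] klassen_proj_cis[of z t] \<open>x = _\<close> by auto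
  also have "\<dots> = sgn (binding_coord a)"
  proof -
    have "exp (2 * complex_of_real pi * \<i> * complex_of_real t) = cis (2 * pi * t)"
      by (simp add: cis_conv_exp mult_ac)
    then show ?thesis
      unfolding zt(3) binding_coord_cis sgn_mult sgn_cis
      by (simp add: klassen_formula_def sgn_eq)
  qed
  finally show ?thesis
    using \<open>a \<in> model\<close> \<open>x = _\<close> by (simp add: binding_fun_proj)
qed

lemma klassen_binding_eq: "klassen_binding = {x \<in> topspace klassen_space. binding_fun x = 0}"
proof -
  let ?Q = "glue_proj solid_cylinder klassen_rel"
  have eq: "binding_fun (?Q (z, t)) = cis (2 * pi * t) * (z\<^sup>2 - 1/4)" "?Q (z, t) \<in> topspace klassen_space"
    if "cmod z \<le> 1" "t \<in> {0..1}" for z t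
    using that binding_fun_proj[of "(cis (pi * t) * z, cis (2 * pi * t))"]
    by (auto simp: norm_mult binding_coord_cis topspace_klassen_space simp flip: klassen_proj_cis)
  have quarter: "z\<^sup>2 = 1/4 \<longleftrightarrow> z \<in> {- 1/2, 1/2}" for z :: complex
    using power2_eq_iff[of z "1/2"] by (auto simp: power2_eq_square)
  show ?thesis
  proof (intro equalityI subsetI)
    fix x assume "x \<in> klassen_binding"
    then obtain z t where "z \<in> {- 1/2, 1/2::complex}" "t \<in> {0..1}" "x = ?Q (z, t)"
      unfolding klassen_binding_def by blast
    moreover from this(1) have "cmod z \<le> 1"
      by (elim insertE emptyE; simp only:) (simp_all add: norm_divide)
    ultimately show "x \<in> {x \<in> topspace klassen_space. binding_fun x = 0}"
      using eq[of z t] quarter[of z] by simp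
  next
    fix x assume x: "x \<in> {x \<in> topspace klassen_space. binding_fun x = 0}"
    then have "x \<in> ?Q ` (cball 0 1 \<times> {0..1})"
      using quotient_imp_surjective_map[OF quotient_map_glue, of solid_cylinder klassen_rel]
      by (simp add: klassen_space_def)
    then obtain a where a: "a \<in> cball 0 1 \<times> {0..1}" "x = ?Q a"
      by blast
    obtain z t where "a = (z, t)"
      by (cases a)
    with a have zt: "cmod z \<le> 1" "t \<in> {0..1}" "x = ?Q (z, t)"
      by auto
    then have "z\<^sup>2 = 1/4"
      using eq[of z t] x by simp
    then show "x \<in> klassen_binding"
      using zt quarter[of z] unfolding klassen_binding_def by blast
  qed
qed

section \<open>Flows on the total space\<close>

text \<open>The solution of \<open>v\<^sup>2 - w / 4 = c\<close> with \<open>w = u\<^sup>2\<close>.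
  The parameter is a square root of \<open>w\<close> because the binding, the curve
  \<open>(u / 2, u\<^sup>2)\<close> at \<open>c = 0\<close>, runs twice around the circle of
  \<open>w\<close>.\<close>

definition tube_model :: "complex \<times> complex \<Rightarrow> complex \<times> complex" where
  "tube_model = (\<lambda>(u, c). (u * csqrt (1/4 + c / u\<^sup>2), u\<^sup>2))"

definition tube_angle :: "complex \<times> complex \<Rightarrow> complex" where
  "tube_angle = (\<lambda>(v, w). v / csqrt (v\<^sup>2 / w))"

abbreviation tube_domain :: "(complex \<times> complex) set" where
  "tube_domain \<equiv> sphere 0 1 \<times> cball 0 (3/16)"

text \<open>The origin of \<open>3/16\<close>: a radius below \<open>1/4\<close> keeps
  \<open>v\<^sup>2 / w = 1/4 + d\<close> in the right half plane, where \<open>csqrt\<close> is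
  continuous and nonzero; its modulus also stays below \<open>1\<close>, away from the glued circle
  \<open>cmod v = 1\<close>.\<close>

lemma near_quarter:
  fixes d :: complex
  assumes "cmod d \<le> 3/16"
  shows "Re (1/4 + d) > 0" "cmod (1/4 + d) < 1"
proof -
  have "\<bar>Re d\<bar> \<le> 3/16"
    using abs_Re_le_cmod[of d] assms by linarith
  then show "Re (1/4 + d) > 0" by simp
  have "cmod (1/4 + d) \<le> cmod (1/4) + cmod d"
    by (rule norm_triangle_ineq)
  then show "cmod (1/4 + d) < 1"
    using assms by (simp add: norm_divide)
qed

context
  fixes u c :: complex
  assumes u: "cmod u = 1" and c: "cmod c \<le> 3/16"
begin

lemma norm_tube_quotient: "cmod (c / u\<^sup>2) \<le> 3/16" "u \<noteq> 0"
  using u c by (auto simp: norm_divide norm_power)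

lemma norm_fst_tube_model: "cmod (fst (tube_model (u, c))) < 1"
proof -
  have "(cmod (csqrt (1/4 + c / u\<^sup>2)))\<^sup>2 < 1"
    using near_quarter(2)[OF norm_tube_quotient(1)] by (simp flip: norm_power)
  then show ?thesis
    using u by (simp add: tube_model_def norm_mult power_less_one_iff abs_square_less_1)
qed

lemma tube_model_in_model: "tube_model (u, c) \<in> model"
  using norm_fst_tube_model u by (auto simp: tube_model_def norm_power less_imp_le)

lemma binding_coord_tube_model: "binding_coord (tube_model (u, c)) = c"
  using norm_tube_quotient(2) by (simp add: binding_coord_def tube_model_def power_mult_distrib field_simps)

lemma tube_angle_tube_model: "tube_angle (tube_model (u, c)) = u"
proof -
  have "(u * csqrt (1/4 + c / u\<^sup>2))\<^sup>2 / u\<^sup>2 = 1/4 + c / u\<^sup>2"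
    using norm_tube_quotient(2) by (simp add: power_mult_distrib)
  moreover have "csqrt (1/4 + c / u\<^sup>2) \<noteq> 0"
    using near_quarter(1)[OF norm_tube_quotient(1)] by (metis csqrt_eq_0 less_irrefl zero_complex.sel(1))
  ultimately show ?thesis
    by (simp add: tube_angle_def tube_model_def)
qed

lemma tube_model_uminus: "tube_model (- u, c) = (- fst (tube_model (u, c)), snd (tube_model (u, c)))"
  by (simp add: tube_model_def)

end

lemma tube_model_tube_angle:
  assumes a: "a \<in> model" and c: "cmod (binding_coord a) \<le> 3/16"
  shows "cmod (tube_angle a) = 1" "tube_model (tube_angle a, binding_coord a) = a"
proof -
  obtain v w where vw: "a = (v, w)" "cmod w = 1" using a by auto
  then have "w \<noteq> 0" by auto
  define z where "z = csqrt (v\<^sup>2 / w)"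
  have z2: "z\<^sup>2 = v\<^sup>2 / w" "v\<^sup>2 / w = 1/4 + binding_coord a / w"
    using \<open>w \<noteq> 0\<close> by (simp_all add: z_def vw(1) binding_coord_def field_simps)
  have "Re (v\<^sup>2 / w) > 0"
    unfolding z2(2) using c vw by (intro near_quarter) (simp add: norm_divide)
  then have "v \<noteq> 0" "z \<noteq> 0"
    by (auto simp: z_def)
  have "(cmod v)\<^sup>2 = (cmod z)\<^sup>2"
    using arg_cong[OF z2(1), of cmod] vw by (simp add: norm_power norm_divide)
  then have "cmod v = cmod z"
    by simp
  then show 1: "cmod (tube_angle a) = 1"
    using \<open>z \<noteq> 0\<close> by (simp add: tube_angle_def vw(1) norm_divide flip: z_def)
  have ta: "tube_angle a = v / z"
    by (simp add: tube_angle_def vw(1) z_def)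
  have sq: "(v / z)\<^sup>2 = w"
    using z2(1) \<open>v \<noteq> 0\<close> \<open>w \<noteq> 0\<close> by (simp add: power_divide)
  have "csqrt (1/4 + binding_coord a / w) = z"
    using z2(2) by (simp add: z_def)
  then show "tube_model (tube_angle a, binding_coord a) = a"
    using \<open>z \<noteq> 0\<close> by (simp add: tube_model_def ta sq) (simp add: vw(1))
qed

lemma continuous_on_tube_model: "continuous_on tube_domain tube_model"
proof -
  have "Re (1/4 + c / u\<^sup>2) > 0 \<and> u \<noteq> 0" if "(u, c) \<in> tube_domain" for u c
    using that by (auto intro!: near_quarter simp: norm_divide norm_power simp del: plus_complex.sel)
  then show ?thesis
    unfolding tube_model_def case_prod_unfold
    by (intro continuous_intros continuous_on_compose2[OF continuous_on_csqrt])
       (force simp: complex_nonpos_Reals_iff)+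
qed

lemma continuous_on_binding_coord: "continuous_on S binding_coord"
  unfolding binding_coord_def case_prod_unfold by (intro continuous_intros) simp

definition tube_region :: "(complex \<times> complex) set" where
  "tube_region = {a \<in> model. cmod (binding_coord a) \<le> 3/16}"

lemma continuous_on_tube_angle: "continuous_on tube_region tube_angle"
proof -
  have "Re (v\<^sup>2 / w) > 0 \<and> w \<noteq> 0" if "(v, w) \<in> tube_region" for v w
  proof -
    have w: "cmod w = 1" using that by (auto simp: tube_region_def)
    then have "w \<noteq> 0" by auto
    then have "v\<^sup>2 / w = 1/4 + binding_coord (v, w) / w"
      by (simp add: binding_coord_def field_simps)
    moreover have "Re (1/4 + binding_coord (v, w) / w) > 0"
      using that w by (intro near_quarter) (simp add: tube_region_def norm_divide)
    ultimately show ?thesis using \<open>w \<noteq> 0\<close> by simp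
  qed
  then show ?thesis
    unfolding tube_angle_def case_prod_unfold
    by (intro continuous_intros continuous_on_compose2[OF continuous_on_csqrt])
       (force simp: complex_nonpos_Reals_iff)+
qed

text \<open>On the tube the flow only turns the meridians where \<open>\<rho> = 1\<close> and follows the circle
  factor where \<open>\<rho> = 0\<close>.\<close>

definition flow_model :: "(real \<Rightarrow> real) \<Rightarrow> real \<Rightarrow> complex \<times> complex \<Rightarrow> complex \<times> complex" where
  "flow_model \<rho> \<theta> a =
     (if cmod (binding_coord a) \<le> 3/16
      then tube_model (tube_angle a * cis ((1 - \<rho> (cmod (binding_coord a))) * \<theta> / 2), cis \<theta> * binding_coord a)
      else (cis (\<theta> / 2) * fst a, cis \<theta> * snd a))"

lemma flow_model_tube:
  assumes "cmod u = 1" "cmod c \<le> 3/16"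
  shows "flow_model \<rho> \<theta> (tube_model (u, c)) = tube_model (u * cis ((1 - \<rho> (cmod c)) * \<theta> / 2), cis \<theta> * c)"
  using assms by (simp add: flow_model_def binding_coord_tube_model tube_angle_tube_model)

lemma flow_model_outside:
  assumes "cmod (binding_coord a) > 3/16"
  shows "flow_model \<rho> \<theta> a = (cis (\<theta> / 2) * fst a, cis \<theta> * snd a)"
  using assms by (simp add: flow_model_def)

lemma binding_coord_rotate: "binding_coord (cis (\<theta> / 2) * fst a, cis \<theta> * snd a) = cis \<theta> * binding_coord a"
proof -
  have "(cis (\<theta> / 2))\<^sup>2 = cis \<theta>"
    by (simp add: Complex.DeMoivre)
  then show ?thesis
    by (simp add: binding_coord_def case_prod_unfold power_mult_distrib algebra_simps)
qed

lemma tube_model_cases: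
  assumes "a \<in> model"
  obtains u c where "cmod u = 1" "cmod c \<le> 3/16" "a = tube_model (u, c)"
  | "cmod (binding_coord a) > 3/16"
proof (cases "cmod (binding_coord a) \<le> 3/16")
  case True
  show ?thesis
    by (rule that(1)[OF tube_model_tube_angle(1)[OF assms True] True tube_model_tube_angle(2)[OF assms True, symmetric]])
qed (use that(2) in simp)

lemma flow_model_in_model:
  assumes "a \<in> model" shows "flow_model \<rho> \<theta> a \<in> model"
  using assms
proof (cases rule: tube_model_cases)
  case (1 u c)
  then show ?thesis
    by (simp add: flow_model_tube tube_model_in_model norm_mult del: mem_Times_iff)
next
  case 2
  then show ?thesis
    using assms by (auto simp: flow_model_outside norm_mult)
qed

lemma binding_coord_flow_model:
  assumes "a \<in> model" shows "binding_coord (flow_model \<rho> \<theta> a) = cis \<theta> * binding_coord a"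
  using assms
proof (cases rule: tube_model_cases)
  case (1 u c)
  then show ?thesis
    by (simp add: flow_model_tube binding_coord_tube_model norm_mult)
next
  case 2
  then show ?thesis
    by (simp add: flow_model_outside binding_coord_rotate del: split_paired_All)
qed

lemma flow_model_0:
  assumes "a \<in> model" shows "flow_model \<rho> 0 a = a"
  using assms
proof (cases rule: tube_model_cases)
  case (1 u c)
  then show ?thesis by (simp add: flow_model_tube)
next
  case 2
  then show ?thesis by (simp add: flow_model_outside)
qed

text \<open>In the tube \<open>cmod c\<close> is constant along an orbit, hence so is the rate
  \<open>(1 - \<rho> (cmod c)) / 2\<close> at which \<open>u\<close> turns.\<close>

lemma flow_model_add:
  assumes "a \<in> model" shows "flow_model \<rho> (s + t) a = flow_model \<rho> s (flow_model \<rho> t a)"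
  using assms
proof (cases rule: tube_model_cases)
  case (1 u c)
  then show ?thesis
    by (simp add: flow_model_tube norm_mult mult.assoc cis_mult add_divide_distrib[symmetric]
        distrib_left[symmetric] add.commute)
       (simp flip: mult.assoc add: cis_mult add.commute)
next
  case 2
  moreover have "cmod (binding_coord (flow_model \<rho> t a)) > 3/16"
    using 2 by (simp add: binding_coord_flow_model[OF assms] norm_mult)
  ultimately show ?thesis
    by (simp add: flow_model_outside cis_mult add_divide_distrib flip: mult.assoc)
qed

text \<open>Points are glued only where \<open>cmod v = 1\<close>. There the rotation formula
  applies, and it commutes with \<open>v \<mapsto> - v\<close>, so the flow descends to the
  quotient.\<close>

lemma norm_1_outside_tube:
  assumes "cmod v = 1" "cmod w = 1"
  shows "cmod (binding_coord (v, w)) > 3/16"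
proof -
  have "cmod (v\<^sup>2) - cmod (w / 4) \<le> cmod (v\<^sup>2 - w / 4)"
    by (rule norm_triangle_ineq2)
  then show ?thesis
    using assms by (simp add: binding_coord_def norm_power norm_divide)
qed

lemma continuous_on_flow_model:
  assumes \<rho>: "continuous_on UNIV \<rho>" "\<rho> (3/16) = 0"
  shows "continuous_on (UNIV \<times> model) (\<lambda>(\<theta>, a). flow_model \<rho> \<theta> a)"
proof -
  define f where "f = (\<lambda>(\<theta>, a). tube_model (tube_angle a * cis ((1 - \<rho> (cmod (binding_coord a))) * \<theta> / 2), cis \<theta> * binding_coord a))"
  define g where "g = (\<lambda>(\<theta>, a :: complex \<times> complex). (cis (\<theta> / 2) * fst a, cis \<theta> * snd a))"
  let ?S = "UNIV \<times> tube_region" and ?T = "UNIV \<times> {a \<in> model. cmod (binding_coord a) \<ge> 3/16}"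
  have cl: "closed model" by (intro closed_Times) auto
  have cont: "continuous_on model (\<lambda>a. cmod (binding_coord a))"
    by (intro continuous_intros continuous_on_binding_coord)
  have eqS: "tube_region = model \<inter> (\<lambda>a. cmod (binding_coord a)) -` {..3/16}"
    and eqT: "{a \<in> model. cmod (binding_coord a) \<ge> 3/16} = model \<inter> (\<lambda>a. cmod (binding_coord a)) -` {3/16..}"
    unfolding tube_region_def by blast+
  have clS: "closed tube_region"
    unfolding eqS by (rule continuous_closed_preimage[OF cont cl closed_atMost])
  have clT: "closed {a \<in> model. cmod (binding_coord a) \<ge> 3/16}"
    unfolding eqT by (rule continuous_closed_preimage[OF cont cl closed_atLeast])
  have "continuous_on ?S f"
  proof -
    have "continuous_on ?S (\<lambda>x. tube_angle (snd x))" "continuous_on ?S (\<lambda>x. binding_coord (snd x))"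
      by (rule continuous_on_compose2[OF continuous_on_tube_angle], auto intro!: continuous_intros)
        (rule continuous_on_compose2[OF continuous_on_binding_coord[of UNIV]], auto intro!: continuous_intros)
    note c = this
    have r: "continuous_on ?S (\<lambda>x. \<rho> (cmod (binding_coord (snd x))))"
      by (rule continuous_on_compose2[OF \<rho>(1)]) (auto intro!: continuous_intros c)
    show ?thesis
      unfolding f_def case_prod_unfold
    proof (rule continuous_on_compose2[OF continuous_on_tube_model])
      show "continuous_on ?S (\<lambda>x. (tube_angle (snd x) * cis ((1 - \<rho> (cmod (binding_coord (snd x)))) * fst x / 2),
          cis (fst x) * binding_coord (snd x)))"
        by (intro continuous_intros c r) auto
    qed (auto simp: tube_region_def tube_model_tube_angle norm_mult)
  qed
  moreover have "continuous_on ?T g"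
    unfolding g_def case_prod_unfold by (intro continuous_intros) auto
  \<comment> \<open>The two formulas agree on the boundary of the tube since
    \<open>\<rho> (3/16) = 0\<close>: turning \<open>u\<close> by \<open>\<theta> / 2\<close> and
    \<open>c\<close> by \<open>\<theta>\<close> multiplies \<open>v\<close> by
    \<open>cis (\<theta> / 2)\<close> and \<open>w\<close> by \<open>cis \<theta>\<close>.\<close>
  moreover have "f (\<theta>, a) = g (\<theta>, a)" if "a \<in> model" "cmod (binding_coord a) = 3/16" for \<theta> a
  proof -
    define u c where "u = tube_angle a" and "c = binding_coord a"
    have uc: "cmod u = 1" "cmod c \<le> 3/16" "a = tube_model (u, c)"
      using tube_model_tube_angle[OF that(1)] that(2) by (simp_all add: u_def c_def)
    then have "f (\<theta>, a) = tube_model (u * cis (\<theta> / 2), cis \<theta> * c)"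
    proof -
      have "\<rho> (cmod c) = 0"
        using \<rho>(2) by (simp only: c_def that(2))
      then show ?thesis
        using uc(1,2) by (simp add: uc(3) f_def tube_angle_tube_model binding_coord_tube_model)
    qed
    also have "\<dots> = g (\<theta>, a)"
    proof -
      have "(cis (\<theta> / 2))\<^sup>2 = cis \<theta>"
        by (simp add: Complex.DeMoivre)
      then show ?thesis
        using uc by (simp add: g_def tube_model_def power_mult_distrib mult_ac)
    qed
    finally show ?thesis .
  qed
  ultimately have "continuous_on (?S \<union> ?T) (\<lambda>x. if cmod (binding_coord (snd x)) \<le> 3/16 then f x else g x)"
    using clS clT
    by (intro continuous_on_cases closed_Times) (auto simp: tube_region_def)
  then show ?thesis
    by (rule continuous_on_cong[THEN iffD1, rotated -1]) (auto simp: f_def g_def flow_model_def tube_region_def)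
qed

section \<open>Descent of the flow to the quotient\<close>

definition klassen_flow :: "(real \<Rightarrow> real) \<Rightarrow> real \<Rightarrow> (complex \<times> real) set \<Rightarrow> (complex \<times> real) set" where
  "klassen_flow \<rho> \<theta> = klassen_lift (\<lambda>a. klassen_proj (flow_model \<rho> \<theta> a))"

lemma klassen_flow_proj:
  assumes "a \<in> model"
  shows "klassen_flow \<rho> \<theta> (klassen_proj a) = klassen_proj (flow_model \<rho> \<theta> a)"
  unfolding klassen_flow_def
proof (rule klassen_lift_proj[OF _ assms])
  fix v w :: complex assume vw: "cmod v = 1" "cmod w = 1"
  show "klassen_proj (flow_model \<rho> \<theta> (- v, w)) = klassen_proj (flow_model \<rho> \<theta> (v, w))"
    using vw norm_1_outside_tube[OF vw] norm_1_outside_tube[of "- v" w]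
    by (simp add: flow_model_outside klassen_proj_eq_iff norm_mult)
qed

interpretation klassen: open_book klassen_space klassen_binding klassen_fibration
proof
  show "closedin klassen_space klassen_binding"
    unfolding klassen_binding_eq
    using closedin_continuous_map_preimage[OF continuous_map_binding_fun, of "{0}"] by simp
  let ?Y = "subtopology klassen_space (topspace klassen_space - klassen_binding)"
  have "continuous_map ?Y (top_of_set (- {0})) binding_fun"
    using continuous_map_from_subtopology[OF continuous_map_binding_fun]
    by (auto simp: continuous_map_in_subtopology klassen_binding_eq)
  moreover have "continuous_map (top_of_set (- {0 :: complex})) euclidean sgn"
    by (simp, intro continuous_intros) auto
  ultimately have "continuous_map ?Y euclidean (sgn \<circ> binding_fun)"
    by (rule continuous_map_compose)
  then show "continuous_map ?Y euclidean klassen_fibration"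
    by (rule continuous_map_eq) (simp add: klassen_fibration_eq)
qed (rule compact_klassen_space Hausdorff_klassen_space)+

lemma klassen_flow_in_topspace:
  "x \<in> topspace klassen_space \<Longrightarrow> klassen_flow \<rho> \<theta> x \<in> topspace klassen_space"
  using klassen_flow_proj flow_model_in_model by (auto simp: topspace_klassen_space simp del: mem_Times_iff)

lemma binding_fun_klassen_flow:
  assumes "x \<in> topspace klassen_space"
  shows "binding_fun (klassen_flow \<rho> \<theta> x) = cis \<theta> * binding_fun x"
proof -
  obtain a where a: "a \<in> model" "x = klassen_proj a"
    using assms unfolding topspace_klassen_space by blast
  then show ?thesis
    by (simp only: klassen_flow_proj binding_fun_proj flow_model_in_model binding_coord_flow_model)
qed

text \<open>The value at \<open>0\<close> makes the binding stationary; the value at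
  \<open>3/16\<close> makes the flow continuous across the boundary of the tube.\<close>

definition flow_profile :: "(real \<Rightarrow> real) \<Rightarrow> bool" where
  "flow_profile \<rho> \<longleftrightarrow> continuous_on UNIV \<rho> \<and> \<rho> 0 = 1 \<and> \<rho> (3/16) = 0"

lemma flow_on_klassen_flow:
  assumes "flow_profile \<rho>"
  shows "flow_on klassen_space (klassen_flow \<rho>)"
  unfolding flow_on_def
proof (intro conjI ballI allI)
  let ?q = "\<lambda>(\<theta>::real, a). (\<theta>, klassen_proj a)"
  \<comment> \<open>Local compactness of the time axis makes the product of its identity with
    \<open>klassen_proj\<close> a quotient map, so that joint continuity can be checked on the
    model.\<close>
  have "locally_compact_space euclideanreal"
    unfolding locally_compact_space_def
  proof
    fix x :: real
    show "\<exists>U K. openin euclideanreal U \<and> compactin euclideanreal K \<and> x \<in> U \<and> U \<subseteq> K"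
      by (intro exI[of _ "ball x 1"] exI[of _ "cball x 1"]) auto
  qed
  then have q: "quotient_map (prod_topology euclideanreal (top_of_set model)) (prod_topology euclideanreal klassen_space) ?q"
    by (intro quotient_map_prod_right quotient_map_klassen_proj) auto
  have dom: "prod_topology euclideanreal (top_of_set model) = top_of_set (UNIV \<times> model)"
    using prod_topology_subtopology_eu[of "UNIV :: real set" model] by (simp only: subtopology_UNIV)
  have "continuous_map (top_of_set (UNIV \<times> model)) (top_of_set model) (\<lambda>(\<theta>, a). flow_model \<rho> \<theta> a)"
    using continuous_on_flow_model[of \<rho>] assms flow_model_in_model
    by (auto simp: flow_profile_def simp del: mem_Times_iff)
  from continuous_map_compose[OF this quotient_imp_continuous_map[OF quotient_map_klassen_proj]]
  have "continuous_map (top_of_set (UNIV \<times> model)) klassen_space (\<lambda>(\<theta>, a). klassen_proj (flow_model \<rho> \<theta> a))"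
    by (simp add: o_def case_prod_unfold)
  then have "continuous_map (top_of_set (UNIV \<times> model)) klassen_space ((\<lambda>(\<theta>, x). klassen_flow \<rho> \<theta> x) \<circ> ?q)"
    by (rule continuous_map_eq) (auto simp: klassen_flow_proj)
  then show "continuous_map (prod_topology euclideanreal klassen_space) klassen_space (\<lambda>(\<theta>, x). klassen_flow \<rho> \<theta> x)"
    by (intro continuous_compose_quotient_map[OF q]) (simp only: dom)
next
  fix x assume "x \<in> topspace klassen_space"
  then obtain a where a: "a \<in> model" "x = klassen_proj a"
    unfolding topspace_klassen_space by blast
  show "klassen_flow \<rho> 0 x = x"
    using a by (simp only: klassen_flow_proj flow_model_0)
  show "klassen_flow \<rho> (s + t) x = klassen_flow \<rho> s (klassen_flow \<rho> t x)" for s t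
    using a by (simp only: klassen_flow_proj flow_model_add flow_model_in_model)
qed

definition klassen_tube :: "complex \<times> complex \<Rightarrow> (complex \<times> real) set" where
  "klassen_tube d = klassen_proj (tube_model d)"

lemma klassen_tube_in_topspace: "cmod u = 1 \<Longrightarrow> cmod c \<le> 3/16 \<Longrightarrow> klassen_tube (u, c) \<in> topspace klassen_space"
  unfolding klassen_tube_def topspace_klassen_space using tube_model_in_model by blast

lemma binding_fun_klassen_tube:
  "cmod u = 1 \<Longrightarrow> cmod c \<le> 3/16 \<Longrightarrow> binding_fun (klassen_tube (u, c)) = c"
  unfolding klassen_tube_def by (simp only: binding_fun_proj tube_model_in_model binding_coord_tube_model)

lemma klassen_flow_tube:
  "cmod u = 1 \<Longrightarrow> cmod c \<le> 3/16 \<Longrightarrow>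
    klassen_flow \<rho> \<theta> (klassen_tube (u, c)) = klassen_tube (u * cis ((1 - \<rho> (cmod c)) * \<theta> / 2), cis \<theta> * c)"
  unfolding klassen_tube_def by (simp only: klassen_flow_proj tube_model_in_model flow_model_tube)

lemma klassen_tube_surj:
  assumes "x \<in> topspace klassen_space" "cmod (binding_fun x) \<le> 3/16"
  obtains u where "cmod u = 1" "x = klassen_tube (u, binding_fun x)"
proof -
  obtain a where a: "a \<in> model" "x = klassen_proj a"
    using assms unfolding topspace_klassen_space by blast
  with assms(2) have c: "cmod (binding_coord a) \<le> 3/16"
    by (simp only: binding_fun_proj)
  show ?thesis
    using that[OF tube_model_tube_angle(1)[OF a(1) c]] tube_model_tube_angle(2)[OF a(1) c] a
    by (simp only: klassen_tube_def binding_fun_proj)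
qed

lemma inj_on_klassen_tube: "inj_on klassen_tube tube_domain"
proof (rule inj_onI)
  fix d d' assume d: "d \<in> tube_domain" "d' \<in> tube_domain" and eq: "klassen_tube d = klassen_tube d'"
  obtain u c u' c' where dd: "d = (u, c)" "d' = (u', c')"
    by (metis surj_pair)
  have uc: "cmod u = 1" "cmod c \<le> 3/16" "cmod u' = 1" "cmod c' \<le> 3/16"
    using d dd by auto
  \<comment> \<open>On the tube \<open>cmod v < 1\<close>, where \<open>klassen_proj\<close>
    identifies no two points.\<close>
  have "tube_model d = tube_model d'"
    using eq klassen_proj_eq_iff[of "fst (tube_model d)" "snd (tube_model d)" "fst (tube_model d')" "snd (tube_model d')"]
      tube_model_in_model[OF uc(1,2)] tube_model_in_model[OF uc(3,4)] norm_fst_tube_model[OF uc(1,2)]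
    by (simp add: klassen_tube_def dd prod_eq_iff del: mem_Times_iff)
  then show "d = d'"
    using tube_angle_tube_model[OF uc(1,2)] tube_angle_tube_model[OF uc(3,4)]
      binding_coord_tube_model[OF uc(1,2)] binding_coord_tube_model[OF uc(3,4)]
    by (simp add: dd)
qed

lemma continuous_map_klassen_tube: "continuous_map (top_of_set tube_domain) klassen_space klassen_tube"
proof -
  have "continuous_map (top_of_set tube_domain) (top_of_set model) tube_model"
    using continuous_on_tube_model tube_model_in_model by (auto simp del: mem_Times_iff)
  from continuous_map_compose[OF this quotient_imp_continuous_map[OF quotient_map_klassen_proj]]
  show ?thesis by (simp add: o_def klassen_tube_def[abs_def])
qed

lemma normalized_klassen_flow:
  assumes "flow_profile \<rho>"
  shows "normalized_flow klassen_space klassen_binding klassen_fibration (klassen_flow \<rho>)"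
  unfolding normalized_flow_def
proof (intro conjI ballI allI)
  fix x \<theta> assume "x \<in> klassen_binding"
  then have x: "x \<in> topspace klassen_space" "binding_fun x = 0"
    by (simp_all add: klassen_binding_eq)
  then obtain u where u: "cmod u = 1" "x = klassen_tube (u, 0)"
    using klassen_tube_surj[of x] by auto
  then show "klassen_flow \<rho> \<theta> x = x"
    using assms by (simp add: klassen_flow_tube flow_profile_def)
next
  fix x \<theta> assume "x \<in> topspace klassen_space - klassen_binding"
  then have x: "x \<in> topspace klassen_space" "binding_fun x \<noteq> 0"
    by (auto simp: klassen_binding_eq)
  note y = klassen_flow_in_topspace[OF x(1), of \<rho> \<theta>]
  show "klassen_flow \<rho> \<theta> x \<notin> klassen_binding"
    using x by (simp add: klassen_binding_eq binding_fun_klassen_flow)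
  show "klassen_fibration (klassen_flow \<rho> \<theta> x) = cis \<theta> * klassen_fibration x"
    by (simp add: klassen_fibration_eq[OF y] klassen_fibration_eq[OF x(1)] binding_fun_klassen_flow[OF x(1)] sgn_mult)
qed (rule flow_on_klassen_flow[OF assms])

text \<open>Identically \<open>1\<close> up to \<open>R = 1/8\<close>, so that orbits within this
  radius are true meridian circles.\<close>

definition flat_profile :: "real \<Rightarrow> real" where
  "flat_profile R = max 0 (min 1 (3 - 16 * R))"

text \<open>With \<open>R = 3 / 16 * u\<close> this is \<open>1 - u\<close>: the turning of the tube
  parameter is then linear in the collar parameter \<open>u\<close>, as in
  \<open>half_twist\<close>.\<close>

definition linear_profile :: "real \<Rightarrow> real" where
  "linear_profile R = 1 - 16 * R / 3"

lemma flow_profile_flat: "flow_profile flat_profile"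
  unfolding flow_profile_def flat_profile_def[abs_def] by (auto intro!: continuous_intros)

lemma flow_profile_linear: "flow_profile linear_profile"
  unfolding flow_profile_def linear_profile_def[abs_def] by (auto intro!: continuous_intros)

lemma open_book_flow_klassen_flow:
  "open_book_flow klassen_space klassen_binding klassen_fibration (klassen_flow flat_profile)"
  unfolding open_book_flow_def
proof (intro conjI)
  let ?\<Phi> = "klassen_flow flat_profile"
  have nf: "normalized_flow klassen_space klassen_binding klassen_fibration ?\<Phi>"
    by (rule normalized_klassen_flow[OF flow_profile_flat])
  show "flow_on klassen_space ?\<Phi>"
    by (rule flow_on_klassen_flow[OF flow_profile_flat])
  show "transverse_to_pages klassen_space klassen_binding klassen_fibration ?\<Phi>"
    unfolding transverse_to_pages_def
  proof
    fix x assume x: "x \<in> topspace klassen_space - klassen_binding"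
    then have "klassen_fibration x = cis (Arg (binding_fun x))"
      by (auto simp: klassen_fibration_eq klassen_binding_eq cis_Arg)
    then show "\<exists>a. continuous_on UNIV a \<and> strict_mono a \<and>
        (\<forall>t. ?\<Phi> t x \<notin> klassen_binding \<and> klassen_fibration (?\<Phi> t x) = cis (a t))"
      using nf x unfolding normalized_flow_def
      by (intro exI[of _ "\<lambda>t. t + Arg (binding_fun x)"])
         (auto intro!: continuous_intros simp: strict_mono_def cis_mult)
  qed
  show "meridional_near_binding klassen_space klassen_binding klassen_fibration ?\<Phi>"
  proof -
    \<comment> \<open>The definition of meridionality takes the binding itself as base of the tube;
      the inverse \<open>\<beta>\<close> of \<open>core\<close> converts from the parameter
      circle.\<close>
    define core where "core = (\<lambda>u. klassen_tube (u, 0))"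
    have core_cont: "continuous_map (top_of_set (sphere 0 1)) klassen_space core"
    proof -
      have "continuous_map (top_of_set (sphere (0::complex) 1)) (top_of_set tube_domain) (\<lambda>u. (u, 0))"
        by (auto intro!: continuous_intros)
      from continuous_map_compose[OF this continuous_map_klassen_tube] show ?thesis
        by (simp add: o_def core_def)
    qed
    have core_img: "core ` sphere 0 1 = klassen_binding"
    proof
      show "core ` sphere 0 1 \<subseteq> klassen_binding"
        by (auto simp: core_def klassen_binding_eq klassen_tube_in_topspace binding_fun_klassen_tube)
      show "klassen_binding \<subseteq> core ` sphere 0 1"
      proof
        fix x assume "x \<in> klassen_binding"
        then have x: "x \<in> topspace klassen_space" "binding_fun x = 0"
          by (simp_all add: klassen_binding_eq)
        then obtain u where "cmod u = 1" "x = klassen_tube (u, 0)"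
          using klassen_tube_surj[of x] by auto
        then show "x \<in> core ` sphere 0 1" by (simp add: core_def)
      qed
    qed
    define \<beta> where "\<beta> = inv_into (sphere 0 1) core"
    have inj: "inj_on core (sphere 0 1)"
    proof (rule inj_onI)
      fix u u' assume "u \<in> sphere 0 1" "u' \<in> sphere 0 1" "core u = core u'"
      then have "(u, 0 :: complex) = (u', 0)"
        by (intro inj_onD[OF inj_on_klassen_tube]) (auto simp: core_def)
      then show "u = u'" by simp
    qed
    have \<beta>_core: "\<beta> (core u) = u" if "cmod u = 1" for u
      unfolding \<beta>_def using that inj by simp
    have \<beta>: "cmod (\<beta> b) = 1" "core (\<beta> b) = b" if "b \<in> klassen_binding" for b
      using that core_img inv_into_into[of b core "sphere 0 1"] f_inv_into_f[of b core "sphere 0 1"]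
      by (auto simp: \<beta>_def)
    have \<beta>_cont: "continuous_map (subtopology klassen_space klassen_binding) (top_of_set (sphere 0 1)) \<beta>"
      by (rule continuous_inverse_map[OF _ Hausdorff_klassen_space core_cont])
         (simp_all add: compact_space_subtopology core_img \<beta>_core)
    \<comment> \<open>The factor \<open>1/8\<close> shrinks the unit disc to the radius within which
      \<open>flat_profile\<close> is \<open>1\<close>.\<close>
    define \<nu> where "\<nu> = (\<lambda>(b, z). klassen_tube (\<beta> b, z / 8))"
    let ?T = "prod_topology (subtopology klassen_space klassen_binding) (top_of_set (cball (0::complex) 1))"
    have topT: "topspace ?T = klassen_binding \<times> cball 0 1"
      using closedin_subset[OF klassen.closed] by auto
    have "continuous_map ?T klassen_space \<nu>"
    proof -
      have b: "continuous_map ?T (top_of_set (sphere 0 1)) (\<lambda>z. \<beta> (fst z))"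
        using continuous_map_compose[OF continuous_map_fst \<beta>_cont] by (simp add: o_def)
      have "continuous_map (top_of_set (cball (0::complex) 1)) (top_of_set (cball 0 (3/16))) (\<lambda>z. z / 8)"
        by (auto intro!: continuous_intros simp: norm_divide)
      from continuous_map_compose[OF continuous_map_snd this]
      have "continuous_map ?T (top_of_set (cball 0 (3/16))) (\<lambda>z. snd z / 8)"
        by (simp add: o_def)
      from continuous_map_pairedI[OF b this]
      have "continuous_map ?T (top_of_set tube_domain) (\<lambda>z. (\<beta> (fst z), snd z / 8))"
        by (simp add: prod_topology_subtopology_eu)
      from continuous_map_compose[OF this continuous_map_klassen_tube] show ?thesis
        by (simp add: o_def \<nu>_def case_prod_unfold)
    qed
    moreover have "compact_space ?T"
      using closedin_compact_space[OF compact_klassen_space klassen.closed]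
      by (simp add: compact_space_prod_topology compact_space_subtopology)
    moreover have "inj_on \<nu> (topspace ?T)"
    proof (rule inj_onI)
      fix x y assume xy: "x \<in> topspace ?T" "y \<in> topspace ?T" "\<nu> x = \<nu> y"
      obtain b z b' z' where bz: "x = (b, z)" "y = (b', z')"
        by (metis surj_pair)
      have b: "b \<in> klassen_binding" "b' \<in> klassen_binding" "cmod z \<le> 1" "cmod z' \<le> 1"
        using xy(1,2) unfolding topT bz by auto
      have "(\<beta> b, z / 8) = (\<beta> b', z' / 8)"
        using xy(3) b \<beta>(1) by (intro inj_onD[OF inj_on_klassen_tube]) (auto simp: \<nu>_def bz norm_divide)
      then show "x = y"
        using \<beta>(2) b by (metis bz Pair_inject divide_cancel_right zero_neq_numeral)
    qed
    ultimately have emb: "embedding_map ?T klassen_space \<nu>"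
      by (intro continuous_imp_embedding_map Hausdorff_klassen_space)
    have nbhd: "\<exists>U. openin klassen_space U \<and> klassen_binding \<subseteq> U \<and> U \<subseteq> \<nu> ` (klassen_binding \<times> cball 0 1)"
    proof (intro exI conjI)
      let ?U = "{x \<in> topspace klassen_space. binding_fun x \<in> ball 0 (1/8)}"
      show "openin klassen_space ?U"
        by (rule openin_continuous_map_preimage[OF continuous_map_binding_fun]) simp
      show "klassen_binding \<subseteq> ?U"
        by (auto simp: klassen_binding_eq)
      show "?U \<subseteq> \<nu> ` (klassen_binding \<times> cball 0 1)"
      proof
        fix x assume x: "x \<in> ?U"
        then obtain u where u: "cmod u = 1" "x = klassen_tube (u, binding_fun x)"
          using klassen_tube_surj[of x] by auto
        then have "x = \<nu> (core u, 8 * binding_fun x)"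
          by (simp add: \<nu>_def \<beta>_core)
        moreover have "core u \<in> klassen_binding"
          using u(1) core_img by auto
        moreover have "cmod (8 * binding_fun x) \<le> 1"
          using x by (simp add: norm_mult)
        ultimately show "x \<in> \<nu> ` (klassen_binding \<times> cball 0 1)"
          by (intro image_eqI[of _ _ "(core u, 8 * binding_fun x)"]) auto
      qed
    qed
    have zero: "\<nu> (b, 0) = b" if "b \<in> klassen_binding" for b
      using \<beta>(2)[OF that] by (simp add: \<nu>_def core_def)
    have fib: "klassen_fibration (\<nu> (b, z)) = z / complex_of_real (cmod z)"
      if "b \<in> klassen_binding" "z \<in> cball 0 1 - {0}" for b z
    proof -
      have z: "cmod (z / 8) \<le> 3/16" using that by (simp add: norm_divide)
      show ?thesis
        using \<beta>(1)[OF that(1)] z that(2)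
        by (simp add: \<nu>_def klassen_fibration_eq klassen_tube_in_topspace binding_fun_klassen_tube)
           (simp add: sgn_eq norm_divide)
    qed
    have orbit: "\<exists>w. cmod w = cmod z \<and> ?\<Phi> t (\<nu> (b, z)) = \<nu> (b, w)"
      if "b \<in> klassen_binding" "z \<in> cball 0 1" for b z t
    proof -
      have z: "cmod (z / 8) \<le> 3/16" "flat_profile (cmod (z / 8)) = 1"
        using that by (simp_all add: norm_divide flat_profile_def)
      show ?thesis
        using klassen_flow_tube[OF \<beta>(1)[OF that(1)] z(1), of flat_profile t] z(2)
        by (intro exI[of _ "cis t * z"]) (simp add: \<nu>_def norm_mult)
    qed
    show ?thesis
      unfolding meridional_near_binding_def
      by (intro exI[of _ \<nu>] conjI ballI allI emb nbhd zero fib orbit)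
  qed
qed

section \<open>A quarter of the octagon\<close>

text \<open>On the closed upper half plane this is the square root in the closed first quadrant. The
  formula is continuous on the whole plane, whereas \<open>csqrt\<close> jumps across the negative
  axis.\<close>

definition first_root :: "complex \<Rightarrow> complex" where
  "first_root z = Complex (sqrt ((cmod z + Re z) / 2)) (sqrt ((cmod z - Re z) / 2))"

lemma first_root_square:
  assumes "Im z \<ge> 0" shows "(first_root z)\<^sup>2 = z"
proof -
  have nn: "0 \<le> cmod z + Re z" "0 \<le> cmod z - Re z"
    using abs_Re_le_cmod[of z] by linarith+
  have "(cmod z + Re z) / 2 * ((cmod z - Re z) / 2) = (Im z / 2)\<^sup>2"
    using cmod_power2[of z] by (simp add: power2_eq_square algebra_simps)
  then have "sqrt ((cmod z + Re z) / 2) * sqrt ((cmod z - Re z) / 2) = Im z / 2"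
    using assms by (simp only: real_sqrt_mult[symmetric]) simp
  moreover have "(cmod z + Re z) / 2 - (cmod z - Re z) / 2 = Re z"
    by (simp add: field_simps)
  ultimately show ?thesis
    using nn unfolding first_root_def power2_eq_square
    by (simp add: complex_eq_iff mult.commute)
qed

lemma continuous_on_first_root [continuous_intros]:
  "continuous_on S f \<Longrightarrow> continuous_on S (\<lambda>x. first_root (f x))"
  unfolding first_root_def Complex_eq by (intro continuous_intros) auto

lemma first_root_nonneg: "0 \<le> x \<Longrightarrow> first_root (of_real x) = of_real (sqrt x)"
  by (simp add: first_root_def complex_eq_iff)

lemma first_root_nonpos: "x \<le> 0 \<Longrightarrow> first_root (of_real x) = \<i> * of_real (sqrt (- x))"
  by (simp add: first_root_def complex_eq_iff)

text \<open>\<open>page_width q\<close> is the distance, along the ray of direction \<open>1\<close>, from \<open>- cis (pi * q) / 4\<close> to the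
  unit circle.\<close>

definition page_width :: "real \<Rightarrow> real" where
  "page_width q = sqrt (1 - (sin (pi * q))\<^sup>2 / 16) - cos (pi * q) / 4"

lemma page_width_root_ge: "1/2 < sqrt (1 - (sin t)\<^sup>2 / 16)"
proof -
  have "(sin t)\<^sup>2 \<le> 1" by (simp add: abs_square_le_1)
  then have "(1/2)\<^sup>2 < 1 - (sin t)\<^sup>2 / 16" by (simp add: power2_eq_square)
  then show ?thesis by (rule real_less_rsqrt)
qed

lemma page_width_pos: "0 < page_width q"
  using page_width_root_ge[of "pi * q"] cos_le_one[of "pi * q"] unfolding page_width_def by linarith

text \<open>Completing the square turns the squared modulus minus \<open>1\<close> into
  \<open>(R + ?c)\<^sup>2 - ?s\<^sup>2\<close>. The bound \<open>- ?s < R + ?c\<close> excludes the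
  negative root and leaves \<open>R = ?s - ?c\<close>.\<close>

lemma norm_add_cis_le_1_iff:
  assumes "0 \<le> R"
  shows "cmod (of_real R + cis (pi * q) / 4) \<le> 1 \<longleftrightarrow> R \<le> page_width q"
    and "cmod (of_real R + cis (pi * q) / 4) = 1 \<longleftrightarrow> R = page_width q"
proof -
  let ?c = "cos (pi * q) / 4" and ?s = "sqrt (1 - (sin (pi * q))\<^sup>2 / 16)"
  have s2: "?s\<^sup>2 = 1 - (sin (pi * q))\<^sup>2 / 16"
    using page_width_root_ge[of "pi * q"] by (intro real_sqrt_pow2) (metis half_gt_zero less_eq_real_def less_trans real_sqrt_gt_0_iff zero_less_one)
  have n: "(cmod (of_real R + cis (pi * q) / 4))\<^sup>2 - 1 = (R + ?c)\<^sup>2 - ?s\<^sup>2"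
    unfolding s2 cmod_power2 by (simp add: power_divide)
  have "\<bar>?c\<bar> \<le> 1/4" by (simp add: abs_cos_le_one)
  then have lower: "- ?s < R + ?c" "0 < ?s"
    using page_width_root_ge[of "pi * q"] assms by linarith+
  have "cmod (of_real R + cis (pi * q) / 4) \<le> 1 \<longleftrightarrow> (cmod (of_real R + cis (pi * q) / 4))\<^sup>2 \<le> 1"
    by (simp add: abs_square_le_1)
  also have "\<dots> \<longleftrightarrow> (R + ?c)\<^sup>2 \<le> ?s\<^sup>2"
    using n by linarith
  also have "\<dots> \<longleftrightarrow> R \<le> page_width q"
    using lower by (simp only: abs_le_square_iff[symmetric]) (auto simp: page_width_def abs_if)
  finally show "cmod (of_real R + cis (pi * q) / 4) \<le> 1 \<longleftrightarrow> R \<le> page_width q" .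
  have "cmod (of_real R + cis (pi * q) / 4) = 1 \<longleftrightarrow> (cmod (of_real R + cis (pi * q) / 4))\<^sup>2 = 1"
    by (simp add: abs_square_eq_1)
  also have "\<dots> \<longleftrightarrow> (R + ?c)\<^sup>2 = ?s\<^sup>2"
    using n by linarith
  also have "\<dots> \<longleftrightarrow> R = page_width q"
    unfolding power2_eq_iff page_width_def using lower by arith
  finally show "cmod (of_real R + cis (pi * q) / 4) = 1 \<longleftrightarrow> R = page_width q" .
qed

text \<open>The value \<open>radial_profile (1/3) = 1/5\<close> puts the branch point of the page at the midpoint
  \<open>(0, 1)\<close> of the top edge of the octagon.\<close>

definition radial_profile :: "real \<Rightarrow> real" where
  "radial_profile x = (2 * x + 3 * x\<^sup>2) / 5"

lemma radial_profile_less: "0 \<le> x \<Longrightarrow> x < y \<Longrightarrow> radial_profile x < radial_profile y"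
  unfolding radial_profile_def by (intro divide_strict_right_mono add_strict_mono mult_strict_left_mono power_strict_mono) auto

lemma radial_profile_eq_iff: "0 \<le> x \<Longrightarrow> 0 \<le> y \<Longrightarrow> radial_profile x = radial_profile y \<longleftrightarrow> x = y"
  using radial_profile_less[of x y] radial_profile_less[of y x] by (cases x y rule: linorder_cases) auto

lemma radial_profile_less_iff: "0 \<le> x \<Longrightarrow> 0 \<le> y \<Longrightarrow> radial_profile x < radial_profile y \<longleftrightarrow> x < y"
  using radial_profile_less[of x y] radial_profile_less[of y x] by (cases x y rule: linorder_cases) auto

lemma radial_profile_le: "0 \<le> x \<Longrightarrow> x \<le> y \<Longrightarrow> radial_profile x \<le> radial_profile y"
  using radial_profile_less[of x y] by (cases "x = y") auto

lemma radial_profile_surj: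
  assumes "0 \<le> y" "y \<le> 1"
  shows "\<exists>x. 0 \<le> x \<and> x \<le> 1 \<and> radial_profile x = y"
  using assms unfolding radial_profile_def
  by (intro IVT'[where a = 0 and b = 1]) (auto intro!: continuous_intros)

section \<open>Polar coordinates on the quarter octagon\<close>

definition quarter :: "(real \<times> real) set" where
  "quarter = {(a, b). 0 \<le> a \<and> a \<le> 1 \<and> 0 \<le> b \<and> b \<le> 1 \<and> a + b \<le> 3/2}"

text \<open>The level lines of \<open>quarter_angle\<close> are L-shaped: they run from the cut corner horizontally to the
  left and then straight down to the side \<open>b = 0\<close>, with \<open>a + b\<close> decreasing along them. The left and
  the top sides together form the level line of the value \<open>1\<close>.\<close>

definition quarter_angle :: "real \<Rightarrow> real \<Rightarrow> real" where
  "quarter_angle a b = max (1 - a) (2 * b - 1)"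

text \<open>On the level line of \<open>q\<close> the sum \<open>a + b\<close> falls from
  \<open>3/2\<close> at the cut corner to \<open>1 - q\<close> on the side \<open>b = 0\<close>, so
  the quotient runs from \<open>0\<close> to \<open>1\<close>. The radius thus leads from the
  binding (\<open>R = 0\<close>) to the glued circle \<open>cmod v = 1\<close>.\<close>

definition quarter_radius :: "real \<Rightarrow> real \<Rightarrow> real" where
  "quarter_radius a b =
     page_width (quarter_angle a b) * radial_profile ((3/2 - a - b) / (1/2 + quarter_angle a b))"

definition quarter_map :: "real \<times> real \<Rightarrow> complex \<times> complex" where
  "quarter_map = (\<lambda>(a, b).
     (first_root (of_real (quarter_radius a b) + cis (pi * quarter_angle a b) / 4), cis (pi * quarter_angle a b)))"

context
  fixes a b :: real
  assumes ab: "(a, b) \<in> quarter"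
begin

lemma quarter_angle_bounds: "0 \<le> quarter_angle a b" "quarter_angle a b \<le> 1"
  using ab by (auto simp: quarter_def quarter_angle_def)

lemma quarter_fraction_bounds:
  "0 \<le> (3/2 - a - b) / (1/2 + quarter_angle a b)" "(3/2 - a - b) / (1/2 + quarter_angle a b) \<le> 1"
proof -
  have "0 \<le> 3/2 - a - b" "3/2 - a - b \<le> 1/2 + quarter_angle a b" "0 < 1/2 + quarter_angle a b"
    using ab by (auto simp: quarter_def quarter_angle_def)
  then show "0 \<le> (3/2 - a - b) / (1/2 + quarter_angle a b)" "(3/2 - a - b) / (1/2 + quarter_angle a b) \<le> 1"
    by simp_all
qed

lemma quarter_radius_bounds: "0 \<le> quarter_radius a b" "quarter_radius a b \<le> page_width (quarter_angle a b)"
proof -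
  let ?f = "(3/2 - a - b) / (1/2 + quarter_angle a b)"
  have "0 \<le> radial_profile ?f" "radial_profile ?f \<le> 1"
    using radial_profile_le[OF _ quarter_fraction_bounds(1)] radial_profile_le[OF quarter_fraction_bounds]
    by (simp_all add: radial_profile_def[of 0] radial_profile_def[of 1])
  then show "0 \<le> quarter_radius a b" "quarter_radius a b \<le> page_width (quarter_angle a b)"
    using page_width_pos[of "quarter_angle a b"] by (auto simp: quarter_radius_def mult_left_le)
qed

lemma quarter_radius_eq_iff:
  "quarter_radius a b = page_width (quarter_angle a b) \<longleftrightarrow> b = 0"
  "quarter_radius a b = 0 \<longleftrightarrow> a + b = 3/2"
proof -
  let ?f = "(3/2 - a - b) / (1/2 + quarter_angle a b)"
  have pos: "0 < page_width (quarter_angle a b)" "0 < 1/2 + quarter_angle a b"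
    using page_width_pos quarter_angle_bounds by auto
  have "quarter_radius a b = page_width (quarter_angle a b) \<longleftrightarrow> radial_profile ?f = radial_profile 1"
    using pos by (simp add: quarter_radius_def radial_profile_def)
  also have "\<dots> \<longleftrightarrow> ?f = 1"
    using quarter_fraction_bounds by (intro radial_profile_eq_iff) auto
  also have "\<dots> \<longleftrightarrow> 1 - a - b = quarter_angle a b"
    using pos by (auto simp: divide_simps)
  also have "\<dots> \<longleftrightarrow> b = 0"
    using ab by (auto simp: quarter_def quarter_angle_def max_def)
  finally show "quarter_radius a b = page_width (quarter_angle a b) \<longleftrightarrow> b = 0" .
  have "quarter_radius a b = 0 \<longleftrightarrow> radial_profile ?f = radial_profile 0"
    using pos by (simp add: quarter_radius_def radial_profile_def)
  also have "\<dots> \<longleftrightarrow> ?f = 0"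
    using quarter_fraction_bounds by (intro radial_profile_eq_iff) auto
  also have "\<dots> \<longleftrightarrow> a + b = 3/2"
    using pos by auto
  finally show "quarter_radius a b = 0 \<longleftrightarrow> a + b = 3/2" .
qed

lemma sin_quarter_angle: "0 \<le> sin (pi * quarter_angle a b)"
  using quarter_angle_bounds by (intro sin_ge_zero) auto

lemma fst_quarter_map_square:
  "(fst (quarter_map (a, b)))\<^sup>2 = of_real (quarter_radius a b) + snd (quarter_map (a, b)) / 4"
  using sin_quarter_angle by (simp add: quarter_map_def first_root_square)

lemma norm_quarter_map:
  "cmod (snd (quarter_map (a, b))) = 1" "cmod (fst (quarter_map (a, b))) \<le> 1"
  "cmod (fst (quarter_map (a, b))) = 1 \<longleftrightarrow> b = 0"
proof -
  have sq: "(cmod (fst (quarter_map (a, b))))\<^sup>2 =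
      cmod (of_real (quarter_radius a b) + cis (pi * quarter_angle a b) / 4)"
    using arg_cong[OF fst_quarter_map_square, of cmod] by (simp add: norm_power quarter_map_def)
  show "cmod (snd (quarter_map (a, b))) = 1"
    by (simp add: quarter_map_def)
  show "cmod (fst (quarter_map (a, b))) \<le> 1"
    using sq norm_add_cis_le_1_iff(1)[OF quarter_radius_bounds(1), of "quarter_angle a b"] quarter_radius_bounds(2)
      abs_square_le_1[of "cmod (fst (quarter_map (a, b)))"] by simp
  show "cmod (fst (quarter_map (a, b))) = 1 \<longleftrightarrow> b = 0"
    using sq norm_add_cis_le_1_iff(2)[OF quarter_radius_bounds(1), of "quarter_angle a b"] quarter_radius_eq_iff(1)
      abs_square_eq_1[of "cmod (fst (quarter_map (a, b)))"] by simp
qed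

lemma Im_snd_quarter_map: "0 \<le> Im (snd (quarter_map (a, b)))"
  using sin_quarter_angle by (simp add: quarter_map_def)

lemma quarter_angle_real:
  assumes "Im (snd (quarter_map (a, b))) = 0"
  shows "quarter_angle a b = 0 \<or> quarter_angle a b = 1"
proof (rule ccontr)
  assume "\<not> ?thesis"
  then have "0 < sin (pi * quarter_angle a b)"
    using quarter_angle_bounds by (intro sin_gt_zero) auto
  with assms show False by (simp add: quarter_map_def)
qed

text \<open>Conjugation fixes \<open>w\<close> only on these sides, so conjugate quarters can meet
  nowhere else.\<close>

lemma quarter_map_real:
  assumes "Im (snd (quarter_map (a, b))) = 0"
  shows "a = 0 \<or> a = 1 \<or> b = 1"
  using quarter_angle_real[OF assms] ab by (auto simp: quarter_def quarter_angle_def max_def split: if_splits)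

text \<open>For \<open>w = -1\<close> the square \<open>v\<^sup>2 = R - 1/4\<close> changes sign at
  \<open>R = 1/4\<close>. Here the width is \<open>5/4\<close>, and \<open>a + b = 1\<close> gives
  the fraction \<open>1/3\<close>, whose profile value \<open>1/5\<close> yields exactly
  \<open>1/4\<close>. This separates the left side, with real roots, from the top side, with
  imaginary ones.\<close>

lemma quarter_radius_top:
  assumes "quarter_angle a b = 1"
  shows "quarter_radius a b = 1/4 \<longleftrightarrow> a + b = 1" "quarter_radius a b < 1/4 \<longleftrightarrow> a + b > 1"
proof -
  let ?f = "(3/2 - a - b) / (3/2)"
  have w: "page_width 1 = 5/4" "radial_profile (1/3) = 1/5"
    by (simp_all add: page_width_def radial_profile_def power2_eq_square)
  have R: "quarter_radius a b = 5/4 * radial_profile ?f"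
    using assms w by (simp add: quarter_radius_def)
  have f: "0 \<le> ?f"
    using quarter_fraction_bounds assms by simp
  have "quarter_radius a b = 1/4 \<longleftrightarrow> radial_profile ?f = radial_profile (1/3)"
    unfolding R w by auto
  also have "\<dots> \<longleftrightarrow> ?f = 1/3"
    using f by (intro radial_profile_eq_iff) auto
  finally show "quarter_radius a b = 1/4 \<longleftrightarrow> a + b = 1"
    by auto
  have "quarter_radius a b < 1/4 \<longleftrightarrow> radial_profile ?f < radial_profile (1/3)"
    unfolding R w by auto
  also have "\<dots> \<longleftrightarrow> ?f < 1/3"
    using f by (intro radial_profile_less_iff) auto
  finally show "quarter_radius a b < 1/4 \<longleftrightarrow> a + b > 1"
    by auto
qed

end

text \<open>Here \<open>w = -1\<close> and \<open>R \<ge> 1/4\<close>, so the root is real and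
  conjugate quarters agree along the axis \<open>x\<^sub>1 = 0\<close>.\<close>

lemma quarter_map_left:
  assumes "(0, b) \<in> quarter"
  shows "snd (quarter_map (0, b)) = -1" "cnj (fst (quarter_map (0, b))) = fst (quarter_map (0, b))"
proof -
  have q: "quarter_angle 0 b = 1"
    using assms by (auto simp: quarter_def quarter_angle_def)
  then show "snd (quarter_map (0, b)) = -1"
    by (simp add: quarter_map_def)
  have "quarter_radius 0 b \<ge> 1/4"
    using quarter_radius_top(2)[OF assms q] assms by (auto simp: quarter_def)
  then have "fst (quarter_map (0, b)) = of_real (sqrt (quarter_radius 0 b - 1/4))"
    using first_root_nonneg[of "quarter_radius 0 b - 1/4"] by (simp add: quarter_map_def q)
  then show "cnj (fst (quarter_map (0, b))) = fst (quarter_map (0, b))"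
    by simp
qed

text \<open>Here \<open>w = 1\<close> and the root is real, which accounts for the gluing of
  \<open>(-1, s)\<close> to \<open>(1, s)\<close>.\<close>

lemma quarter_map_right:
  assumes "(1, b) \<in> quarter"
  shows "snd (quarter_map (1, b)) = 1" "cnj (fst (quarter_map (1, b))) = fst (quarter_map (1, b))"
proof -
  have q: "quarter_angle 1 b = 0"
    using assms by (auto simp: quarter_def quarter_angle_def)
  then show "snd (quarter_map (1, b)) = 1"
    by (simp add: quarter_map_def)
  have "fst (quarter_map (1, b)) = of_real (sqrt (quarter_radius 1 b + 1/4))"
    using first_root_nonneg[of "quarter_radius 1 b + 1/4"] quarter_radius_bounds(1)[OF assms]
    by (simp add: quarter_map_def q)
  then show "cnj (fst (quarter_map (1, b))) = fst (quarter_map (1, b))"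
    by simp
qed

text \<open>Here \<open>w = -1\<close> and \<open>R \<le> 1/4\<close>, so the root is imaginary and
  conjugation acts on it as a change of sign. This is why the top is glued to the bottom with a
  flip.\<close>

lemma quarter_map_top:
  assumes "(a, 1) \<in> quarter"
  shows "snd (quarter_map (a, 1)) = -1" "cnj (fst (quarter_map (a, 1))) = - fst (quarter_map (a, 1))"
proof -
  have q: "quarter_angle a 1 = 1"
    using assms by (auto simp: quarter_def quarter_angle_def)
  then show "snd (quarter_map (a, 1)) = -1"
    by (simp add: quarter_map_def)
  have "quarter_radius a 1 \<le> 1/4"
    using quarter_radius_top[OF assms q] assms by (auto simp: quarter_def)
  then have "fst (quarter_map (a, 1)) = \<i> * of_real (sqrt (1/4 - quarter_radius a 1))"
    using first_root_nonpos[of "quarter_radius a 1 - 1/4"] by (simp add: quarter_map_def q)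
  then show "cnj (fst (quarter_map (a, 1))) = - fst (quarter_map (a, 1))"
    by simp
qed

lemma fst_quarter_map_eq_0:
  assumes ab: "(a, b) \<in> quarter" and 0: "fst (quarter_map (a, b)) = 0"
  shows "a = 0 \<and> b = 1"
proof -
  have V: "of_real (quarter_radius a b) + cis (pi * quarter_angle a b) / 4 = 0"
    using fst_quarter_map_square[OF ab] 0 by (simp add: quarter_map_def)
  then have im: "Im (snd (quarter_map (a, b))) = 0"
    by (simp add: complex_eq_iff quarter_map_def)
  have "quarter_angle a b \<noteq> 0"
    using V quarter_radius_bounds(1)[OF ab] by (auto simp: complex_eq_iff)
  then have q: "quarter_angle a b = 1"
    using quarter_angle_real[OF ab im] by blast
  then have "quarter_radius a b = 1/4"
    using V by (simp add: complex_eq_iff)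
  then have "a + b = 1"
    using quarter_radius_top(1)[OF ab q] by simp
  with q ab show ?thesis
    by (auto simp: quarter_def quarter_angle_def max_def split: if_splits)
qed

text \<open>The cosine is injective on \<open>[0, pi]\<close>, so \<open>w\<close> determines the
  level line; on it the radius determines \<open>a + b\<close>, which is strictly monotone along the
  line.\<close>

lemma quarter_map_inj:
  assumes ab: "(a, b) \<in> quarter" and ab': "(a', b') \<in> quarter"
    and w: "snd (quarter_map (a, b)) = snd (quarter_map (a', b'))"
    and R: "quarter_radius a b = quarter_radius a' b'"
  shows "a = a' \<and> b = b'"
proof -
  have "cos (pi * quarter_angle a b) = cos (pi * quarter_angle a' b')"
    using w by (simp add: quarter_map_def complex_eq_iff)
  then have "pi * quarter_angle a b = pi * quarter_angle a' b'"
    using quarter_angle_bounds[OF ab] quarter_angle_bounds[OF ab']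
    by - (rule cos_inj_pi, auto)
  then have q: "quarter_angle a b = quarter_angle a' b'"
    by simp
  then have "radial_profile ((3/2 - a - b) / (1/2 + quarter_angle a b)) = radial_profile ((3/2 - a' - b') / (1/2 + quarter_angle a b))"
    using R page_width_pos[of "quarter_angle a b"] by (simp add: quarter_radius_def)
  then have "(3/2 - a - b) / (1/2 + quarter_angle a b) = (3/2 - a' - b') / (1/2 + quarter_angle a b)"
    using quarter_fraction_bounds(1)[OF ab] quarter_fraction_bounds(1)[OF ab'] q
    by (subst (asm) radial_profile_eq_iff) auto
  then have "a + b = a' + b'"
    using quarter_angle_bounds[OF ab] by auto
  with q show ?thesis
    unfolding quarter_angle_def by linarith
qed

lemma quarter_map_surj:
  assumes v: "cmod v \<le> 1" and w: "cmod w = 1" "Im w \<ge> 0"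
    and R: "v\<^sup>2 - w / 4 = of_real R" "R \<ge> 0"
  shows "\<exists>a b. (a, b) \<in> quarter \<and> snd (quarter_map (a, b)) = w \<and> (fst (quarter_map (a, b)))\<^sup>2 = v\<^sup>2"
proof -
  define q where "q = Arg w / pi"
  have "w \<noteq> 0" using w(1) by auto
  have q: "0 \<le> q" "q \<le> 1"
    using w(2) Arg_le_pi[of w] Arg_less_0[of w] by (auto simp: q_def divide_simps not_less)
  have cis_q: "cis (pi * q) = w"
    using w(1) \<open>w \<noteq> 0\<close> cis_Arg[of w] by (simp add: q_def sgn_eq)
  have V: "v\<^sup>2 = of_real R + cis (pi * q) / 4"
    using R(1) by (simp add: cis_q algebra_simps)
  have "cmod (v\<^sup>2) \<le> 1"
    using v by (simp add: norm_power power_le_one)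
  then have "R \<le> page_width q"
    using norm_add_cis_le_1_iff(1)[OF R(2), of q] by (simp add: V)
  then have "0 \<le> R / page_width q" "R / page_width q \<le> 1"
    using R(2) page_width_pos[of q] by auto
  then obtain x where x: "0 \<le> x" "x \<le> 1" "radial_profile x = R / page_width q"
    using radial_profile_surj by blast
  define m where "m = x * (1/2 + q)"
  have m: "0 \<le> m" "m \<le> 1/2 + q" "m / (1/2 + q) = x"
    using x q by (auto simp: m_def intro: mult_left_le_one_le)
  \<comment> \<open>The point at distance \<open>m\<close> in \<open>a + b\<close> from the cut
    corner: it lies on the horizontal leg \<open>b = (1 + q) / 2\<close> as long as
    \<open>m \<le> q / 2\<close>, and afterwards on the vertical leg
    \<open>a = 1 - q\<close>.\<close>
  have "\<exists>a b. (a, b) \<in> quarter \<and> quarter_angle a b = q \<and> 3/2 - a - b = m"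
  proof (cases "m \<le> q / 2")
    case True
    then show ?thesis
      using m q by (intro exI[of _ "1 - m - q / 2"] exI[of _ "(1 + q) / 2"])
        (auto simp: quarter_def quarter_angle_def max_def field_simps)
  next
    case False
    then show ?thesis
      using m q by (intro exI[of _ "1 - q"] exI[of _ "1/2 - m + q"])
        (auto simp: quarter_def quarter_angle_def max_def field_simps)
  qed
  then obtain a b where ab: "(a, b) \<in> quarter" "quarter_angle a b = q" "3/2 - a - b = m"
    by blast
  have "quarter_radius a b = R"
    using ab m x page_width_pos[of q] by (simp add: quarter_radius_def)
  then have "snd (quarter_map (a, b)) = w" "(fst (quarter_map (a, b)))\<^sup>2 = v\<^sup>2"
    using fst_quarter_map_square[OF ab(1)] by (simp_all add: quarter_map_def ab(2) cis_q V)
  with ab(1) show ?thesis by blast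
qed

lemma continuous_on_quarter_map: "continuous_on quarter quarter_map"
proof -
  have "1/2 + max (1 - fst p) (2 * snd p - 1) \<noteq> 0" if "p \<in> quarter" for p
    using that by (auto simp: quarter_def)
  then show ?thesis
    unfolding quarter_map_def quarter_radius_def quarter_angle_def page_width_def radial_profile_def
      case_prod_unfold
    by (intro continuous_intros) auto
qed

section \<open>The page as a quotient of the octagon\<close>

text \<open>The root of \<open>R + w / 4\<close> in the first quadrant is used on the quarter \<open>x\<^sub>1, x\<^sub>2 \<ge> 0\<close>; the reflections
  in the axes act by conjugation and by \<open>v \<mapsto> - v\<close>.\<close>

definition half_map :: "real \<times> real \<Rightarrow> complex \<times> complex" where
  "half_map = (\<lambda>(x\<^sub>1, x\<^sub>2). let (v, w) = quarter_map (\<bar>x\<^sub>1\<bar>, \<bar>x\<^sub>2\<bar>) in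
     if x\<^sub>1 < 0 then (cnj v, cnj w) else (v, w))"

definition rotate_model :: "real \<Rightarrow> complex \<times> complex \<Rightarrow> complex \<times> complex" where
  "rotate_model \<theta> = (\<lambda>(v, w). (cis (\<theta> / 2) * v, cis \<theta> * w))"

text \<open>The sign makes this map jump across \<open>x\<^sub>2 = 0\<close>. There
  \<open>cmod v = 1\<close>, so the jump disappears under \<open>klassen_proj\<close>. The rotation
  carries the page of argument \<open>0\<close> to that of argument \<open>\<theta>\<close>.\<close>

definition octagon_map :: "real \<Rightarrow> real \<times> real \<Rightarrow> complex \<times> complex" where
  "octagon_map \<theta> x = rotate_model \<theta> (if snd x < 0 then (- fst (half_map x), snd (half_map x)) else half_map x)"

lemma octagon_iff_quarter: "(x\<^sub>1, x\<^sub>2) \<in> octagon \<longleftrightarrow> (\<bar>x\<^sub>1\<bar>, \<bar>x\<^sub>2\<bar>) \<in> quarter"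
  by (auto simp: octagon_def quarter_def)

lemma binding_coord_rotate_model: "binding_coord (rotate_model \<theta> a) = cis \<theta> * binding_coord a"
  using binding_coord_rotate[of \<theta> a] by (simp add: rotate_model_def case_prod_unfold)

context
  fixes x\<^sub>1 x\<^sub>2 :: real
  assumes x: "(x\<^sub>1, x\<^sub>2) \<in> octagon"
begin

lemma octagon_quarter: "(\<bar>x\<^sub>1\<bar>, \<bar>x\<^sub>2\<bar>) \<in> quarter"
  using x by (simp add: octagon_iff_quarter)

lemma half_map_in_model: "half_map (x\<^sub>1, x\<^sub>2) \<in> model"
  using norm_quarter_map[OF octagon_quarter]
  by (auto simp: half_map_def case_prod_unfold Let_def mem_Times_iff)

lemma norm_fst_half_map: "cmod (fst (half_map (x\<^sub>1, x\<^sub>2))) = 1 \<longleftrightarrow> x\<^sub>2 = 0"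
  using norm_quarter_map(3)[OF octagon_quarter] by (auto simp: half_map_def case_prod_unfold Let_def)

lemma binding_coord_half_map: "binding_coord (half_map (x\<^sub>1, x\<^sub>2)) = of_real (quarter_radius \<bar>x\<^sub>1\<bar> \<bar>x\<^sub>2\<bar>)"
proof -
  obtain v w where vw: "quarter_map (\<bar>x\<^sub>1\<bar>, \<bar>x\<^sub>2\<bar>) = (v, w)"
    by fastforce
  have "v\<^sup>2 - w / 4 = of_real (quarter_radius \<bar>x\<^sub>1\<bar> \<bar>x\<^sub>2\<bar>)"
    using fst_quarter_map_square[OF octagon_quarter] by (simp add: vw)
  moreover from arg_cong[OF this, of cnj]
  have "(cnj v)\<^sup>2 - cnj w / 4 = of_real (quarter_radius \<bar>x\<^sub>1\<bar> \<bar>x\<^sub>2\<bar>)"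
    by simp
  ultimately show ?thesis
    by (simp only: half_map_def case_prod_conv Let_def vw binding_coord_def split: if_split) simp
qed

lemma octagon_map_in_model: "octagon_map \<theta> (x\<^sub>1, x\<^sub>2) \<in> model"
  using half_map_in_model
  by (cases "half_map (x\<^sub>1, x\<^sub>2)") (auto simp: octagon_map_def rotate_model_def norm_mult)

lemma binding_coord_octagon_map:
  "binding_coord (octagon_map \<theta> (x\<^sub>1, x\<^sub>2)) = cis \<theta> * of_real (quarter_radius \<bar>x\<^sub>1\<bar> \<bar>x\<^sub>2\<bar>)"
  using binding_coord_half_map
  by (simp add: octagon_map_def binding_coord_rotate_model) (simp add: binding_coord_def case_prod_unfold)

end

lemma compact_octagon: "compact octagon"
proof -
  have "octagon = ({-1..1} \<times> {-1..1}) \<inter> (\<lambda>x. \<bar>fst x\<bar> + \<bar>snd x\<bar>) -` {..3/2}"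
    by (auto simp: octagon_def)
  moreover have "compact (({-1..1} \<times> {-1..1}) \<inter> (\<lambda>x::real \<times> real. \<bar>fst x\<bar> + \<bar>snd x\<bar>) -` {..3/2})"
    by (intro compact_Int_closed compact_Times closed_vimage continuous_intros) auto
  ultimately show ?thesis by simp
qed

lemma continuous_on_half_map: "continuous_on octagon half_map"
proof -
  define f where "f = (\<lambda>x::real \<times> real. quarter_map (\<bar>fst x\<bar>, \<bar>snd x\<bar>))"
  have f: "continuous_on octagon f"
    unfolding f_def
    by (rule continuous_on_compose2[OF continuous_on_quarter_map])
      (auto intro!: continuous_intros simp: octagon_iff_quarter)
  let ?S = "octagon \<inter> {x. fst x \<le> 0}" and ?T = "octagon \<inter> {x. 0 \<le> fst x}"
  have oct: "closed octagon"
    by (rule compact_imp_closed[OF compact_octagon])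
  have "closed ?S" "closed ?T"
    by (auto intro!: closed_Int oct closed_Collect_le continuous_intros)
  moreover have "continuous_on ?S (\<lambda>x. (cnj (fst (f x)), cnj (snd (f x))))" "continuous_on ?T f"
    using f by (auto intro!: continuous_intros intro: continuous_on_subset)
  moreover have "(cnj (fst (f x)), cnj (snd (f x))) = f x" if "x \<in> octagon" "fst x = 0" for x
    using that quarter_map_left[of "\<bar>snd x\<bar>"] octagon_iff_quarter[of 0 "snd x"]
    by (cases x) (auto simp: f_def prod_eq_iff)
  ultimately have "continuous_on (?S \<union> ?T) (\<lambda>x. if fst x \<le> 0 then (cnj (fst (f x)), cnj (snd (f x))) else f x)"
    by (intro continuous_on_cases) auto
  moreover have "?S \<union> ?T = octagon" by auto
  ultimately have c: "continuous_on octagon (\<lambda>x. if fst x \<le> 0 then (cnj (fst (f x)), cnj (snd (f x))) else f x)"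
    by simp
  have eq: "half_map x = (if fst x \<le> 0 then (cnj (fst (f x)), cnj (snd (f x))) else f x)" if "x \<in> octagon" for x
    using that quarter_map_left[of "\<bar>snd x\<bar>"] octagon_iff_quarter[of 0 "snd x"]
    by (cases x) (auto simp: half_map_def f_def case_prod_unfold Let_def prod_eq_iff)
  show ?thesis
    by (rule continuous_on_eq[OF c]) (simp only: eq)
qed

section \<open>The map from the octagon onto a page\<close>

abbreviation klein_proj :: "real \<times> real \<Rightarrow> (real \<times> real) set" where
  "klein_proj \<equiv> glue_proj (top_of_set octagon) octagon_rel"

definition page_map :: "real \<Rightarrow> real \<times> real \<Rightarrow> (complex \<times> real) set" where
  "page_map \<theta> x = klassen_proj (octagon_map \<theta> x)"

text \<open>Reflection switches the sign in \<open>octagon_map\<close>. On the midline it moves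
  nothing, but there \<open>cmod v = 1\<close>, so \<open>(v, w)\<close> and \<open>(- v, w)\<close>
  are the same point.\<close>

lemma page_map_reflect:
  assumes "(x\<^sub>1, x\<^sub>2) \<in> octagon" "octagon_map \<theta> (x\<^sub>1, x\<^sub>2) = (v, w)"
  shows "page_map \<theta> (x\<^sub>1, - x\<^sub>2) = klassen_proj (- v, w)"
proof -
  have half: "half_map (x\<^sub>1, - x\<^sub>2) = half_map (x\<^sub>1, x\<^sub>2)"
    by (simp add: half_map_def)
  show ?thesis
  proof (cases "x\<^sub>2 = 0")
    case True
    then have "cmod v = 1" "(v, w) \<in> model"
      using norm_fst_half_map[OF assms(1)] octagon_map_in_model[OF assms(1), of \<theta>] assms(2)
      by (auto simp: octagon_map_def rotate_model_def case_prod_unfold norm_mult)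
    then show ?thesis
      using assms(2) True by (auto simp: page_map_def klassen_proj_eq_iff)
  next
    case False
    then show ?thesis
      using assms(2) half
      by (auto simp: page_map_def octagon_map_def rotate_model_def case_prod_unfold split: if_splits)
  qed
qed

lemma continuous_map_page_map: "continuous_map (top_of_set octagon) klassen_space (page_map \<theta>)"
proof -
  \<comment> \<open>Each sign is used on the whole octagon and projected first; the pasting is done
    after projection, since \<open>octagon_map\<close> itself is not continuous.\<close>
  define h where "h = (\<lambda>(upper::bool) x. klassen_proj (rotate_model \<theta> (if upper then half_map x else (- fst (half_map x), snd (half_map x)))))"
  have h: "continuous_map (top_of_set octagon) klassen_space (h i)" for i
  proof -
    have "continuous_on octagon (\<lambda>x. rotate_model \<theta> (if i then half_map x else (- fst (half_map x), snd (half_map x))))"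
      unfolding rotate_model_def case_prod_unfold
      by (cases i) (auto intro!: continuous_intros continuous_on_half_map)
    moreover have "rotate_model \<theta> (if i then half_map x else (- fst (half_map x), snd (half_map x))) \<in> model" if "x \<in> octagon" for x
    proof -
      obtain x\<^sub>1 x\<^sub>2 where "x = (x\<^sub>1, x\<^sub>2)" by (cases x)
      with half_map_in_model[of x\<^sub>1 x\<^sub>2] that show ?thesis
        by (cases "half_map x") (auto simp: rotate_model_def norm_mult)
    qed
    ultimately have "continuous_map (top_of_set octagon) (top_of_set model)
        (\<lambda>x. rotate_model \<theta> (if i then half_map x else (- fst (half_map x), snd (half_map x))))"
      by auto
    from continuous_map_compose[OF this quotient_imp_continuous_map[OF quotient_map_klassen_proj]]
    show ?thesis by (simp add: h_def o_def)
  qed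
  define T where "T = (\<lambda>upper. octagon \<inter> {x. if upper then 0 \<le> snd x else snd x \<le> 0})"
  have page_h: "page_map \<theta> x = h i x" if x: "x \<in> T i" for x i
  proof -
    obtain x\<^sub>1 x\<^sub>2 where xx: "x = (x\<^sub>1, x\<^sub>2)" by (cases x)
    have "x\<^sub>2 = 0" if "snd x < 0 \<longleftrightarrow> i"
      using that x by (auto simp: T_def xx split: if_splits)
    moreover have "klassen_proj (rotate_model \<theta> (- fst (half_map x), snd (half_map x))) = klassen_proj (rotate_model \<theta> (half_map x))" if "x\<^sub>2 = 0"
    proof -
      have "cmod (fst (half_map x)) = 1" "half_map x \<in> model"
        using x that norm_fst_half_map[of x\<^sub>1 x\<^sub>2] half_map_in_model[of x\<^sub>1 x\<^sub>2] by (auto simp: T_def xx)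
      then show ?thesis
        by (cases "half_map x") (auto simp: rotate_model_def klassen_proj_eq_iff norm_mult)
    qed
    ultimately show ?thesis
      by (auto simp: page_map_def octagon_map_def h_def)
  qed
  show ?thesis
  proof (rule pasting_lemma_closed[where I = UNIV and T = T and f = h])
    show "closedin (top_of_set octagon) (T i)" for i
      unfolding T_def
      by (intro closedin_closed_Int) (cases i; simp; intro closed_Collect_le continuous_intros)
    show "continuous_map (subtopology (top_of_set octagon) (T i)) klassen_space (h i)" for i
      by (intro continuous_map_from_subtopology h)
    show "h i x = h j x" if "x \<in> topspace (top_of_set octagon) \<inter> T i \<inter> T j" for i j x
      using that page_h by (metis IntD1 IntD2)
    show "\<exists>j. j \<in> UNIV \<and> x \<in> T j \<and> page_map \<theta> x = h j x" if "x \<in> topspace (top_of_set octagon)" for x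
      using that page_h[of x True] page_h[of x False] by (cases "0 \<le> snd x") (auto simp: T_def)
  qed simp
qed

lemma page_map_resp:
  assumes "(x, y) \<in> octagon_rel"
  shows "page_map \<theta> x = page_map \<theta> y"
proof -
  have "half_map (-1, s) = half_map (1, s)" if "(1, s) \<in> octagon" for s
    using quarter_map_right[of "\<bar>s\<bar>"] that
    by (simp add: half_map_def case_prod_unfold Let_def octagon_iff_quarter prod_eq_iff)
  moreover have "octagon_map \<theta> (s, 1) = octagon_map \<theta> (- s, -1)" if "(s, 1) \<in> octagon" for s
  proof -
    have s: "(\<bar>s\<bar>, 1) \<in> quarter"
      using that by (simp add: octagon_iff_quarter)
    \<comment> \<open>At \<open>s = 0\<close> neither of the two glued points is conjugated, yet
      their signs differ. They agree because the root is real as well as imaginary there, hence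
      \<open>0\<close>.\<close>
    have "fst (quarter_map (0, 1)) = 0" if "s = 0"
      using quarter_map_left[of 1] quarter_map_top[of 0] s that
      by (simp add: complex_eq_iff)
    then show ?thesis
      using quarter_map_top[OF s]
      by (auto simp: octagon_map_def half_map_def case_prod_unfold Let_def prod_eq_iff rotate_model_def)
  qed
  ultimately show ?thesis
    using assms by (auto simp: octagon_rel_def page_map_def octagon_map_def)
qed

lemma klein_proj_sides:
  assumes "(1, s) \<in> octagon"
  shows "klein_proj (- 1, s) = klein_proj (1, s)"
  using assms by (intro glue_proj_eqI) (auto simp: octagon_rel_def octagon_def)

lemma klein_proj_top_bottom:
  assumes "(s, 1) \<in> octagon"
  shows "klein_proj (s, 1) = klein_proj (- s, - 1)"
  using assms by (intro glue_proj_eqI) (auto simp: octagon_rel_def octagon_def)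

text \<open>The value of \<open>w\<close> up to conjugation and the radius determine
  \<open>(\<bar>x\<^sub>1\<bar>, \<bar>x\<^sub>2\<bar>)\<close>, so only signs are left. The sign of
  a nonzero \<open>x\<^sub>1\<close> shows in \<open>Im w\<close> unless \<open>w\<close> is real,
  and that of a nonzero \<open>x\<^sub>2\<close> shows in the sign of the root unless the root is
  \<open>0\<close>.\<close>

lemma page_map_inj:
  assumes x: "x \<in> octagon" and y: "y \<in> octagon" and eq: "page_map \<theta> x = page_map \<theta> y"
  shows "klein_proj x = klein_proj y"
proof -
  obtain x\<^sub>1 x\<^sub>2 y\<^sub>1 y\<^sub>2 where xy: "x = (x\<^sub>1, x\<^sub>2)" "y = (y\<^sub>1, y\<^sub>2)"
    by (cases x, cases y)
  note x' = x[unfolded xy] and y' = y[unfolded xy]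
  note qx = octagon_quarter[OF x'] and qy = octagon_quarter[OF y']
  define v w v' w' where "v = fst (half_map x)" and "w = snd (half_map x)"
    and "v' = fst (half_map y)" and "w' = snd (half_map y)"
  define \<sigma> \<sigma>' :: complex where "\<sigma> = (if x\<^sub>2 < 0 then -1 else 1)" and "\<sigma>' = (if y\<^sub>2 < 0 then -1 else 1)"
  have \<sigma>: "cmod \<sigma> = 1" by (simp add: \<sigma>_def)
  have ox: "octagon_map \<theta> x = (cis (\<theta> / 2) * (\<sigma> * v), cis \<theta> * w)"
    and oy: "octagon_map \<theta> y = (cis (\<theta> / 2) * (\<sigma>' * v'), cis \<theta> * w')"
    by (simp_all add: octagon_map_def rotate_model_def xy v_def v'_def w_def w'_def \<sigma>_def \<sigma>'_def case_prod_unfold)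
  have "klassen_proj (cis (\<theta> / 2) * (\<sigma> * v), cis \<theta> * w) = klassen_proj (cis (\<theta> / 2) * (\<sigma>' * v'), cis \<theta> * w')"
    using eq by (simp only: page_map_def ox oy)
  then have "cis \<theta> * w = cis \<theta> * w'"
    and V: "cis (\<theta> / 2) * (\<sigma> * v) = cis (\<theta> / 2) * (\<sigma>' * v') \<or> cmod (cis (\<theta> / 2) * (\<sigma> * v)) = 1"
    using octagon_map_in_model[OF x', of \<theta>] octagon_map_in_model[OF y', of \<theta>]
    by (auto simp only: klassen_proj_eq_iff ox oy xy[symmetric])
  then have ww: "w = w'" by simp
  have vv: "\<sigma> * v = \<sigma>' * v' \<or> cmod v = 1"
    using V \<sigma> by (auto simp: norm_mult)
  define Q where "Q = quarter_map (\<bar>x\<^sub>1\<bar>, \<bar>x\<^sub>2\<bar>)"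
  define Q' where "Q' = quarter_map (\<bar>y\<^sub>1\<bar>, \<bar>y\<^sub>2\<bar>)"
  have hx: "v = (if x\<^sub>1 < 0 then cnj (fst Q) else fst Q)" "w = (if x\<^sub>1 < 0 then cnj (snd Q) else snd Q)"
    and hy: "v' = (if y\<^sub>1 < 0 then cnj (fst Q') else fst Q')" "w' = (if y\<^sub>1 < 0 then cnj (snd Q') else snd Q')"
    by (simp_all add: v_def w_def v'_def w'_def xy half_map_def Q_def Q'_def case_prod_unfold Let_def)
  have Im: "0 \<le> Im (snd Q)" "0 \<le> Im (snd Q')"
    using Im_snd_quarter_map[OF qx] Im_snd_quarter_map[OF qy] by (simp_all add: Q_def Q'_def)
  have sndQ: "snd Q = snd Q'"
    using ww Im unfolding hx hy by (auto simp: complex_eq_iff split: if_splits)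
  have "binding_fun (page_map \<theta> x) = binding_fun (page_map \<theta> y)"
    using eq by simp
  then have "quarter_radius \<bar>x\<^sub>1\<bar> \<bar>x\<^sub>2\<bar> = quarter_radius \<bar>y\<^sub>1\<bar> \<bar>y\<^sub>2\<bar>"
    using octagon_map_in_model[OF x', of \<theta>] octagon_map_in_model[OF y', of \<theta>]
    by (simp add: page_map_def xy binding_fun_proj binding_coord_octagon_map[OF x'] binding_coord_octagon_map[OF y'] del: mem_Times_iff)
  from quarter_map_inj[OF qx qy _ this] sndQ
  have ab: "\<bar>x\<^sub>1\<bar> = \<bar>y\<^sub>1\<bar>" "\<bar>x\<^sub>2\<bar> = \<bar>y\<^sub>2\<bar>"
    by (simp_all add: Q_def Q'_def)
  then have QQ: "Q' = Q" by (simp add: Q_def Q'_def)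
  have flip: "y\<^sub>1 = - x\<^sub>1 \<and> x\<^sub>1 \<noteq> 0 \<and> (\<bar>x\<^sub>1\<bar> = 1 \<or> \<bar>x\<^sub>2\<bar> = 1)" if "x\<^sub>1 \<noteq> y\<^sub>1"
  proof -
    have y1: "y\<^sub>1 = - x\<^sub>1" "x\<^sub>1 \<noteq> 0" using ab(1) that by auto
    then have "Im (snd Q) = 0"
      using ww unfolding hx hy QQ by (auto simp: complex_eq_iff split: if_splits)
    with y1 quarter_map_real[OF qx] show ?thesis
      by (auto simp: Q_def)
  qed
  have nz: "fst Q \<noteq> 0 \<or> (x\<^sub>1 = 0 \<and> \<bar>x\<^sub>2\<bar> = 1)"
    using fst_quarter_map_eq_0[OF qx] by (auto simp: Q_def)
  have sides: "klein_proj x = klein_proj y" if "\<bar>x\<^sub>1\<bar> = 1" "y\<^sub>1 = - x\<^sub>1" "x\<^sub>2 = y\<^sub>2"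
    using that x' y' klein_proj_sides[of x\<^sub>2] unfolding xy by (auto simp: abs_if split: if_splits)
  have topbot: "klein_proj x = klein_proj y" if "\<bar>x\<^sub>2\<bar> = 1" "y\<^sub>1 = - x\<^sub>1" "y\<^sub>2 = - x\<^sub>2"
    using that x' y' klein_proj_top_bottom[of x\<^sub>1] klein_proj_top_bottom[of y\<^sub>1]
    unfolding xy by (auto simp: abs_if split: if_splits)
  show ?thesis
  proof (cases "x\<^sub>2 = 0")
    case True
    then have x2: "x\<^sub>2 = y\<^sub>2" using ab(2) by simp
    show ?thesis
    proof (cases "x\<^sub>1 = y\<^sub>1")
      case neq: False
      have "\<bar>x\<^sub>1\<bar> = 1" "y\<^sub>1 = - x\<^sub>1"
        using flip[OF neq] True by simp_all
      then show ?thesis using x2 by (rule sides)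
    qed (simp add: xy x2)
  next
    case False
    then have "cmod v \<noteq> 1"
      using norm_fst_half_map[OF x'] by (simp add: v_def xy)
    then have vv: "\<sigma> * v = \<sigma>' * v'" using vv by blast
    show ?thesis
    proof (cases "x\<^sub>1 = y\<^sub>1")
      case True
      then have "v' = v" using hx hy QQ by simp
      show ?thesis
      proof (cases "x\<^sub>2 = y\<^sub>2")
        case neq: False
        then have y2: "y\<^sub>2 = - x\<^sub>2" using ab(2) by auto
        then have "v = 0"
          using vv \<open>v' = v\<close> False by (auto simp: \<sigma>_def \<sigma>'_def split: if_splits)
        then have "x\<^sub>1 = 0 \<and> \<bar>x\<^sub>2\<bar> = 1" using nz hx(1) by (auto split: if_splits)
        then show ?thesis using topbot True y2 by auto
      qed (use True in \<open>simp add: xy\<close>)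
    next
      case neq: False
      from flip[OF neq] have y1: "y\<^sub>1 = - x\<^sub>1" "x\<^sub>1 \<noteq> 0" and or: "\<bar>x\<^sub>1\<bar> = 1 \<or> \<bar>x\<^sub>2\<bar> = 1" by auto
      with nz have Q0: "fst Q \<noteq> 0" by simp
      show ?thesis
      \<comment> \<open>With \<open>x\<^sub>1\<close> and \<open>y\<^sub>1\<close> opposite, the
        root is real on the vertical sides, so conjugation is invisible and
        \<open>x\<^sub>2 = y\<^sub>2\<close>. On the horizontal sides it is imaginary, so
        conjugation is a sign change that \<open>y\<^sub>2 = - x\<^sub>2\<close> must undo.\<close>
      proof (cases "\<bar>x\<^sub>1\<bar> = 1")
        case True
        then have "cnj (fst Q) = fst Q"
          using quarter_map_right[of "\<bar>x\<^sub>2\<bar>"] qx by (simp add: Q_def)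
        then have "v = fst Q" "v' = fst Q" using hx hy QQ by auto
        then have "x\<^sub>2 = y\<^sub>2"
          using vv Q0 ab(2) False by (auto simp: \<sigma>_def \<sigma>'_def abs_if split: if_splits)
        then show ?thesis using sides True y1 by blast
      next
        case False
        with or have x2: "\<bar>x\<^sub>2\<bar> = 1" by simp
        then have "cnj (fst Q) = - fst Q"
          using quarter_map_top[of "\<bar>x\<^sub>1\<bar>"] qx by (simp add: Q_def)
        then have "v' = - v" "v \<noteq> 0" using hx hy QQ y1 Q0 by auto
        then have "y\<^sub>2 = - x\<^sub>2"
          using vv ab(2) x2 by (auto simp: \<sigma>_def \<sigma>'_def abs_if split: if_splits)
        then show ?thesis using topbot x2 y1 by blast
      qed
    qed
  qed
qed

text \<open>Conjugation reduces to \<open>Im w \<ge> 0\<close>. The root found there agrees with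
  \<open>v\<close> up to sign, and a wrong sign is repaired by reflecting in the horizontal
  axis.\<close>

lemma page_map_surj:
  assumes c: "c \<in> topspace klassen_space" and R: "binding_fun c = cis \<theta> * of_real R" "0 \<le> R"
  shows "\<exists>x\<in>octagon. page_map \<theta> x = c"
proof -
  obtain V W where VW: "(V, W) \<in> model" "c = klassen_proj (V, W)"
    using c unfolding topspace_klassen_space by auto
  define v w where "v = cis (- \<theta> / 2) * V" and "w = cis (- \<theta>) * W"
  have rot: "rotate_model \<theta> (v, w) = (V, W)" "rotate_model \<theta> (- v, w) = (- V, W)"
    by (simp_all add: rotate_model_def v_def w_def cis_mult flip: mult.assoc)
  have vw: "cmod v \<le> 1" "cmod w = 1"
    using VW(1) by (auto simp: v_def w_def norm_mult)
  have "cis \<theta> * binding_coord (v, w) = cis \<theta> * of_real R"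
    using R(1) VW binding_coord_rotate_model[of \<theta> "(v, w)"] by (simp add: rot binding_fun_proj)
  then have bc: "v\<^sup>2 - w / 4 = of_real R"
    by (simp add: binding_coord_def)
  have "\<exists>x\<^sub>1 x\<^sub>2 h. (x\<^sub>1, x\<^sub>2) \<in> octagon \<and> 0 \<le> x\<^sub>2 \<and> half_map (x\<^sub>1, x\<^sub>2) = (h, w) \<and> h\<^sup>2 = v\<^sup>2"
  proof (cases "0 \<le> Im w")
    case True
    then obtain a b where ab: "(a, b) \<in> quarter" "snd (quarter_map (a, b)) = w" "(fst (quarter_map (a, b)))\<^sup>2 = v\<^sup>2"
      using quarter_map_surj[OF vw True bc R(2)] by blast
    then have "0 \<le> a" "0 \<le> b" by (auto simp: quarter_def)
    then show ?thesis
      using ab by (intro exI[of _ a] exI[of _ b] exI[of _ "fst (quarter_map (a, b))"])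
        (auto simp: octagon_iff_quarter half_map_def case_prod_unfold Let_def)
  next
    case False
    have "(cnj v)\<^sup>2 - cnj w / 4 = of_real R"
      using arg_cong[OF bc, of cnj] by simp
    then obtain a b where ab: "(a, b) \<in> quarter" "snd (quarter_map (a, b)) = cnj w"
        "(fst (quarter_map (a, b)))\<^sup>2 = (cnj v)\<^sup>2"
      using quarter_map_surj[of "cnj v" "cnj w" R] vw False R(2) by auto
    then have "0 \<le> a" "0 \<le> b" by (auto simp: quarter_def)
    \<comment> \<open>The point \<open>(- a, b)\<close> is conjugated by \<open>half_map\<close>
      only if \<open>- a < 0\<close>; the value \<open>a = 0\<close> would make \<open>w\<close>
      real.\<close>
    moreover have "a \<noteq> 0"
      using quarter_map_left(1)[of b] ab False by (auto simp: complex_eq_iff)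
    moreover have "(cnj (fst (quarter_map (a, b))))\<^sup>2 = v\<^sup>2"
      using arg_cong[OF ab(3), of cnj] by simp
    ultimately show ?thesis
      using ab by (intro exI[of _ "- a"] exI[of _ b] exI[of _ "cnj (fst (quarter_map (a, b)))"])
        (auto simp: octagon_iff_quarter half_map_def case_prod_unfold Let_def)
  qed
  then obtain x\<^sub>1 x\<^sub>2 h where x: "(x\<^sub>1, x\<^sub>2) \<in> octagon" "0 \<le> x\<^sub>2" "half_map (x\<^sub>1, x\<^sub>2) = (h, w)" "h\<^sup>2 = v\<^sup>2"
    by blast
  then have o: "octagon_map \<theta> (x\<^sub>1, x\<^sub>2) = rotate_model \<theta> (h, w)"
    by (simp add: octagon_map_def)
  from x(4) consider "h = v" | "h = - v"
    by (auto simp: power2_eq_iff)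
  then show ?thesis
  proof cases
    case 1
    then show ?thesis
      using x(1) o rot VW(2) by (intro bexI[of _ "(x\<^sub>1, x\<^sub>2)"]) (simp_all add: page_map_def)
  next
    case 2
    then have "page_map \<theta> (x\<^sub>1, - x\<^sub>2) = c"
      using page_map_reflect[OF x(1), of \<theta> "- V" W] o rot VW(2) by simp
    moreover have "(x\<^sub>1, - x\<^sub>2) \<in> octagon"
      using x(1) by (simp add: octagon_def)
    ultimately show ?thesis by blast
  qed
qed

lemma binding_fun_page_map:
  assumes "(x\<^sub>1, x\<^sub>2) \<in> octagon"
  shows "binding_fun (page_map \<theta> (x\<^sub>1, x\<^sub>2)) = cis \<theta> * of_real (quarter_radius \<bar>x\<^sub>1\<bar> \<bar>x\<^sub>2\<bar>)"
  using octagon_map_in_model[OF assms] binding_coord_octagon_map[OF assms]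
  by (simp only: page_map_def binding_fun_proj)

lemma page_map_in_topspace: "x \<in> octagon \<Longrightarrow> page_map \<theta> x \<in> topspace klassen_space"
  using octagon_map_in_model by (cases x) (auto simp: page_map_def topspace_klassen_space simp del: mem_Times_iff)

abbreviation klassen_page_set :: "real \<Rightarrow> (complex \<times> real) set set" where
  "klassen_page_set \<theta> \<equiv> page klassen_space klassen_binding klassen_fibration (cis \<theta>)"

lemma klassen_page_iff:
  "c \<in> klassen_page_set \<theta> \<longleftrightarrow> c \<in> topspace klassen_space \<and> (\<exists>R\<ge>0. binding_fun c = cis \<theta> * of_real R)"
proof
  assume c: "c \<in> klassen_page_set \<theta>"
  then have top: "c \<in> topspace klassen_space"
    by (auto simp: page_def klassen_binding_eq)
  have "binding_fun c = sgn (binding_fun c) * of_real (cmod (binding_fun c))"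
    by (simp add: sgn_eq)
  moreover have "sgn (binding_fun c) = cis \<theta>" if "binding_fun c \<noteq> 0"
    using c that top by (auto simp: page_def klassen_binding_eq klassen_fibration_eq)
  ultimately have "binding_fun c = cis \<theta> * of_real (cmod (binding_fun c))"
    by (cases "binding_fun c = 0") auto
  with top show "c \<in> topspace klassen_space \<and> (\<exists>R\<ge>0. binding_fun c = cis \<theta> * of_real R)"
    using norm_ge_zero by blast
next
  assume c: "c \<in> topspace klassen_space \<and> (\<exists>R\<ge>0. binding_fun c = cis \<theta> * of_real R)"
  then obtain R where R: "R \<ge> 0" "binding_fun c = cis \<theta> * of_real R" by blast
  show "c \<in> klassen_page_set \<theta>"
  proof (cases "R = 0")
    case True
    then show ?thesis using c R by (simp add: page_def klassen_binding_eq)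
  next
    case False
    then have "sgn (binding_fun c) = cis \<theta>"
      using R by (simp add: sgn_mult sgn_of_real sgn_cis)
    then show ?thesis
      using c by (auto simp: page_def klassen_fibration_eq)
  qed
qed

lemma page_map_image: "page_map \<theta> ` octagon = klassen_page_set \<theta>"
proof
  show "page_map \<theta> ` octagon \<subseteq> klassen_page_set \<theta>"
  proof
    fix c assume "c \<in> page_map \<theta> ` octagon"
    then obtain x\<^sub>1 x\<^sub>2 where x: "(x\<^sub>1, x\<^sub>2) \<in> octagon" "c = page_map \<theta> (x\<^sub>1, x\<^sub>2)" by auto
    then show "c \<in> klassen_page_set \<theta>"
      using page_map_in_topspace[OF x(1)] binding_fun_page_map[OF x(1)] quarter_radius_bounds(1)[OF octagon_quarter[OF x(1)]]
      by (auto simp: klassen_page_iff)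
  qed
  show "klassen_page_set \<theta> \<subseteq> page_map \<theta> ` octagon"
  proof
    fix c assume "c \<in> klassen_page_set \<theta>"
    then obtain R where "c \<in> topspace klassen_space" "binding_fun c = cis \<theta> * of_real R" "0 \<le> R"
      unfolding klassen_page_iff by blast
    from page_map_surj[OF this] show "c \<in> page_map \<theta> ` octagon" by blast
  qed
qed

lemma page_identification_ex:
  "\<exists>G. homeomorphic_map klein_hole (subtopology klassen_space (klassen_page_set \<theta>)) G \<and>
     (\<forall>x\<in>octagon. G (klein_proj x) = page_map \<theta> x)"
proof -
  have resp: "page_map \<theta> x = page_map \<theta> y" if "(x, y) \<in> (octagon_rel \<union> octagon_rel\<inverse>)\<^sup>*" for x y
    using that by (induction rule: rtrancl_induct) (auto dest: page_map_resp[of _ _ \<theta>])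
  have q: "quotient_map (top_of_set octagon) klein_hole klein_proj"
    unfolding klein_hole_def by (rule quotient_map_glue)
  have top: "topspace klein_hole = klein_proj ` octagon"
    using quotient_imp_surjective_map[OF q] by simp
  obtain G where G: "continuous_map klein_hole klassen_space G"
    "\<And>x. x \<in> octagon \<Longrightarrow> G (klein_proj x) = page_map \<theta> x"
  proof (rule quotient_map_lift_exists[OF q continuous_map_page_map])
    fix x y assume xy: "x \<in> topspace (top_of_set octagon)" "y \<in> topspace (top_of_set octagon)"
      "klein_proj x = klein_proj y"
    show "page_map \<theta> x = page_map \<theta> y"
      by (rule resp) (use xy glue_proj_eq_iff[of x "top_of_set octagon" y octagon_rel] in simp)
  qed (use that in simp)
  have img: "G ` topspace klein_hole = klassen_page_set \<theta>"
    using G(2) by (simp add: top image_image flip: page_map_image)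
  have "inj_on G (topspace klein_hole)"
  proof (rule inj_onI)
    fix a b assume "a \<in> topspace klein_hole" "b \<in> topspace klein_hole" and eq: "G a = G b"
    then obtain x y where xy: "x \<in> octagon" "a = klein_proj x" "y \<in> octagon" "b = klein_proj y"
      unfolding top by blast
    with eq have "page_map \<theta> x = page_map \<theta> y"
      by (simp add: G(2))
    from page_map_inj[OF xy(1,3) this] show "a = b"
      by (simp only: xy)
  qed
  moreover have "compact_space klein_hole"
  proof -
    have "compactin (top_of_set octagon) octagon"
      by (simp add: compactin_subtopology compact_octagon)
    from image_compactin[OF this quotient_imp_continuous_map[OF q]] show ?thesis
      by (simp add: compact_space_def top)
  qed
  moreover have "continuous_map klein_hole (subtopology klassen_space (klassen_page_set \<theta>)) G"
    using G(1) img by (auto simp: continuous_map_in_subtopology)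
  moreover have "G ` topspace klein_hole = topspace (subtopology klassen_space (klassen_page_set \<theta>))"
    using img by (auto simp: klassen_page_iff)
  ultimately have "homeomorphic_map klein_hole (subtopology klassen_space (klassen_page_set \<theta>)) G"
    by (intro continuous_imp_homeomorphic_map Hausdorff_space_subtopology Hausdorff_klassen_space)
  with G(2) show ?thesis by blast
qed

section \<open>The monodromy as a crosscap slide\<close>

locale klassen_identification =
  fixes \<theta> :: real and G :: "(real \<times> real) set \<Rightarrow> (complex \<times> real) set"
    and g :: "(complex \<times> real) set \<Rightarrow> (real \<times> real) set"
  assumes hom: "homeomorphic_maps (subtopology klassen_space (klassen_page_set \<theta>)) klein_hole g G"
    and G_proj: "x \<in> octagon \<Longrightarrow> G (klein_proj x) = page_map \<theta> x"
begin

abbreviation page_top :: "(complex \<times> real) set topology" where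
  "page_top \<equiv> subtopology klassen_space (klassen_page_set \<theta>)"

lemma topspace_klein_hole: "topspace klein_hole = klein_proj ` octagon"
  using quotient_imp_surjective_map[OF quotient_map_glue, of "top_of_set octagon" octagon_rel]
  by (simp add: klein_hole_def)

lemma topspace_page_top: "topspace page_top = klassen_page_set \<theta>"
  by (auto simp: klassen_page_iff)

lemma continuous_g: "continuous_map page_top klein_hole g"
  and continuous_G: "continuous_map klein_hole page_top G"
  using hom by (simp_all add: homeomorphic_maps_def)

lemma g_G: "k \<in> topspace klein_hole \<Longrightarrow> g (G k) = k"
  and G_g: "c \<in> klassen_page_set \<theta> \<Longrightarrow> G (g c) = c"
  using hom topspace_page_top unfolding homeomorphic_maps_def by blast+

lemma G_in_page: "k \<in> topspace klein_hole \<Longrightarrow> G k \<in> klassen_page_set \<theta>"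
  using continuous_map_image_subset_topspace[OF continuous_G] topspace_page_top by blast

lemma g_in_klein_hole: "c \<in> klassen_page_set \<theta> \<Longrightarrow> g c \<in> topspace klein_hole"
  using continuous_map_image_subset_topspace[OF continuous_g] topspace_page_top by blast

lemma g_eq_iff: "c \<in> klassen_page_set \<theta> \<Longrightarrow> d \<in> klassen_page_set \<theta> \<Longrightarrow> g c = g d \<longleftrightarrow> c = d"
  using G_g by metis

lemma Hausdorff_klein_hole: "Hausdorff_space klein_hole"
proof -
  have "page_top homeomorphic_space klein_hole"
    using hom by (auto simp: homeomorphic_space_def)
  then show ?thesis
    using homeomorphic_Hausdorff_space Hausdorff_space_subtopology[OF Hausdorff_klassen_space] by blast
qed

text \<open>\<open>klein_reflection\<close> takes images of classes, so the reflection must map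
  classes onto classes. It preserves the gluing pairs of the vertical sides and turns those of the
  horizontal sides into reversed pairs.\<close>

lemma klein_reflection_proj:
  assumes "(x\<^sub>1, x\<^sub>2) \<in> octagon"
  shows "klein_reflection (klein_proj (x\<^sub>1, x\<^sub>2)) = klein_proj (x\<^sub>1, - x\<^sub>2)"
proof -
  define \<rho> :: "real \<times> real \<Rightarrow> real \<times> real" where "\<rho> = (\<lambda>(x\<^sub>1, x\<^sub>2). (x\<^sub>1, - x\<^sub>2))"
  have \<rho>\<rho>: "\<rho> (\<rho> x) = x" for x by (simp add: \<rho>_def case_prod_unfold)
  have oct: "\<rho> x \<in> octagon" if "x \<in> octagon" for x
    using that by (auto simp: \<rho>_def octagon_def)
  have step: "(\<rho> x, \<rho> y) \<in> octagon_rel \<union> octagon_rel\<inverse>" if "(x, y) \<in> octagon_rel" for x y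
    using that unfolding octagon_rel_def octagon_def \<rho>_def by auto
  have rel: "(\<rho> x, \<rho> y) \<in> (octagon_rel \<union> octagon_rel\<inverse>)\<^sup>*" if "(x, y) \<in> (octagon_rel \<union> octagon_rel\<inverse>)\<^sup>*" for x y
    using that
  proof (induction rule: rtrancl_induct)
    case (step y z)
    then have "(\<rho> y, \<rho> z) \<in> octagon_rel \<union> octagon_rel\<inverse>"
      using \<open>\<And>x y. (x, y) \<in> octagon_rel \<Longrightarrow> (\<rho> x, \<rho> y) \<in> octagon_rel \<union> octagon_rel\<inverse>\<close> by blast
    with step.IH show ?case by (rule rtrancl_into_rtrancl)
  qed simp
  have proj: "y \<in> klein_proj x \<longleftrightarrow> x \<in> octagon \<and> y \<in> octagon \<and> (x, y) \<in> (octagon_rel \<union> octagon_rel\<inverse>)\<^sup>*" for x y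
    by (auto simp: glue_proj_def glue_rel_def)
  have sub: "\<rho> y \<in> klein_proj (\<rho> x)" if "y \<in> klein_proj x" for x y
    using that oct rel unfolding proj by blast
  have "\<rho> ` klein_proj x = klein_proj (\<rho> x)" for x
  proof (intro equalityI subsetI)
    fix y assume "y \<in> klein_proj (\<rho> x)"
    from sub[OF this] have "\<rho> y \<in> klein_proj x" by (simp only: \<rho>\<rho>)
    then show "y \<in> \<rho> ` klein_proj x"
      by (intro image_eqI[of _ _ "\<rho> y"]) (simp_all only: \<rho>\<rho>)
  qed (use sub in blast)
  from this[of "(x\<^sub>1, x\<^sub>2)"] show ?thesis
    by (simp add: klein_reflection_def \<rho>_def)
qed

text \<open>An arbitrary representative \<open>(v, w)\<close> is allowed, so that the lemma applies
  to \<open>tube_model\<close> in the collar and to the rotation formula outside it.\<close>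

lemma klein_reflection_identification:
  assumes k: "k \<in> topspace klein_hole" and vw: "(v, w) \<in> model" "G k = klassen_proj (v, w)"
  shows "klein_reflection k \<in> topspace klein_hole" "G (klein_reflection k) = klassen_proj (- v, w)"
proof -
  obtain x where x: "x \<in> octagon" "k = klein_proj x"
    using k unfolding topspace_klein_hole by blast
  obtain x\<^sub>1 x\<^sub>2 where xx: "x = (x\<^sub>1, x\<^sub>2)" by (cases x)
  have x': "(x\<^sub>1, x\<^sub>2) \<in> octagon" "(x\<^sub>1, - x\<^sub>2) \<in> octagon"
    using x(1) by (auto simp: xx octagon_def)
  have r: "klein_reflection k = klein_proj (x\<^sub>1, - x\<^sub>2)"
    unfolding x(2) xx by (rule klein_reflection_proj[OF x'(1)])
  then show "klein_reflection k \<in> topspace klein_hole"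
    using x'(2) by (simp add: topspace_klein_hole)
  obtain V W where VW: "octagon_map \<theta> (x\<^sub>1, x\<^sub>2) = (V, W)"
    by fastforce
  have m: "(V, W) \<in> model"
    using octagon_map_in_model[OF x'(1), of \<theta>] by (simp only: VW)
  have "klassen_proj (V, W) = klassen_proj (v, w)"
    using G_proj[OF x(1)] vw(2) VW by (simp add: x(2) xx page_map_def)
  then have "W = w" "V = v \<or> v = - V \<and> cmod V = 1"
    using klassen_proj_eq_iff[OF m vw(1)] by auto
  moreover have m': "(- V, W) \<in> model" "(- v, w) \<in> model"
    using m vw(1) by auto
  ultimately have "klassen_proj (- V, W) = klassen_proj (- v, w)"
    by (subst klassen_proj_eq_iff[OF m']) auto
  then show "G (klein_reflection k) = klassen_proj (- v, w)"
    using page_map_reflect[OF x'(1) VW] G_proj[OF x'(2)] by (simp add: r)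
qed

text \<open>The annulus in which the page meets the tube: \<open>u = 0\<close> is the binding and
  \<open>u = 1\<close> lies on the boundary of the tube.\<close>

definition page_tube :: "complex \<times> real \<Rightarrow> (complex \<times> real) set" where
  "page_tube = (\<lambda>(w, u). klassen_tube (w, cis \<theta> * of_real (3 / 16 * u)))"

definition page_collar :: "complex \<times> real \<Rightarrow> (real \<times> real) set" where
  "page_collar = g \<circ> page_tube"

abbreviation collar_domain :: "(complex \<times> real) set" where
  "collar_domain \<equiv> sphere 0 1 \<times> {0..1}"

lemma norm_page_coord: "0 \<le> u \<Longrightarrow> cmod (cis \<theta> * of_real (3 / 16 * u)) = 3 / 16 * u"
  by (simp add: norm_mult)

lemma page_tube_facts:
  assumes "cmod w = 1" "0 \<le> u" "u \<le> 1"
  shows "page_tube (w, u) \<in> klassen_page_set \<theta>"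
    and "binding_fun (page_tube (w, u)) = cis \<theta> * of_real (3 / 16 * u)"
proof -
  have c: "cmod (cis \<theta> * of_real (3 / 16 * u)) \<le> 3 / 16"
    using norm_page_coord[OF assms(2)] assms(3) by simp
  show b: "binding_fun (page_tube (w, u)) = cis \<theta> * of_real (3 / 16 * u)"
    unfolding page_tube_def case_prod_conv by (rule binding_fun_klassen_tube[OF assms(1) c])
  have "page_tube (w, u) \<in> topspace klassen_space"
    unfolding page_tube_def case_prod_conv by (rule klassen_tube_in_topspace[OF assms(1) c])
  moreover have "0 \<le> 3 / 16 * u" using assms by simp
  ultimately show "page_tube (w, u) \<in> klassen_page_set \<theta>"
    unfolding klassen_page_iff using b by blast
qed

lemma page_tube_surj:
  assumes "c \<in> klassen_page_set \<theta>" "cmod (binding_fun c) \<le> 3 / 16"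
  obtains w u where "cmod w = 1" "0 \<le> u" "u \<le> 1" "c = page_tube (w, u)" "cmod (binding_fun c) = 3 / 16 * u"
proof -
  obtain R where R: "c \<in> topspace klassen_space" "0 \<le> R" "binding_fun c = cis \<theta> * of_real R"
    using assms(1) unfolding klassen_page_iff by blast
  have R': "cmod (binding_fun c) = R" using R by (simp add: norm_mult)
  obtain w where w: "cmod w = 1" "c = klassen_tube (w, binding_fun c)"
    using klassen_tube_surj[OF R(1) assms(2)] by blast
  show ?thesis
  proof (rule that[of w "16 / 3 * R"])
    show "16 / 3 * R \<le> 1" using assms(2) R' by simp
    show "c = page_tube (w, 16 / 3 * R)"
      using w(2) R(3) by (simp add: page_tube_def)
  qed (use w R R' in simp_all)
qed

lemma inj_on_page_tube: "inj_on page_tube collar_domain"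
proof (rule inj_onI)
  fix a b assume ab: "a \<in> collar_domain" "b \<in> collar_domain" and eq: "page_tube a = page_tube b"
  obtain w u w' u' where wu: "a = (w, u)" "b = (w', u')" by (cases a, cases b)
  have *: "cmod w = 1" "0 \<le> u" "u \<le> 1" "cmod w' = 1" "0 \<le> u'" "u' \<le> 1" using ab wu by auto
  have "(w, cis \<theta> * of_real (3 / 16 * u)) = (w', cis \<theta> * of_real (3 / 16 * u'))"
  proof (rule inj_onD[OF inj_on_klassen_tube])
    show "klassen_tube (w, cis \<theta> * of_real (3 / 16 * u)) = klassen_tube (w', cis \<theta> * of_real (3 / 16 * u'))"
      using eq by (simp only: wu page_tube_def case_prod_conv)
  qed (use * norm_page_coord in \<open>simp_all only: mem_Times_iff fst_conv snd_conv mem_sphere_0 mem_cball_0, simp_all\<close>)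
  then show "a = b" by (simp add: wu)
qed

lemma inj_on_page_collar: "inj_on page_collar collar_domain"
  unfolding page_collar_def
proof (rule comp_inj_on[OF inj_on_page_tube])
  have "inj_on g (klassen_page_set \<theta>)"
    using g_eq_iff by (auto intro!: inj_onI)
  then show "inj_on g (page_tube ` collar_domain)"
    by (rule inj_on_subset) (auto intro!: page_tube_facts)
qed

lemma embedding_page_collar: "embedding_map (top_of_set collar_domain) klein_hole page_collar"
proof (rule continuous_imp_embedding_map[OF _ _ Hausdorff_klein_hole])
  have "continuous_map (top_of_set collar_domain) (top_of_set tube_domain)
      (\<lambda>(w, u). (w, cis \<theta> * of_real (3 / 16 * u)))"
    using norm_page_coord by (auto simp: case_prod_unfold intro!: continuous_intros simp del: of_real_mult of_real_divide)
  from continuous_map_compose[OF this continuous_map_klassen_tube]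
  have "continuous_map (top_of_set collar_domain) klassen_space page_tube"
    by (simp add: page_tube_def o_def case_prod_unfold)
  then have "continuous_map (top_of_set collar_domain) page_top page_tube"
    using page_tube_facts(1) by (auto simp: continuous_map_in_subtopology)
  then show "continuous_map (top_of_set collar_domain) klein_hole page_collar"
    unfolding page_collar_def using continuous_g by (rule continuous_map_compose)
  show "compact_space (top_of_set collar_domain)"
    by (simp add: compact_space_subtopology compact_Times)
  show "inj_on page_collar (topspace (top_of_set collar_domain))"
    using inj_on_page_collar by simp
qed

text \<open>The radius vanishes exactly on the cut corners.\<close>

lemma binding_eq_boundary: "g ` klassen_binding = klein_hole_boundary"
proof -
  have "G (klein_proj x) \<in> klassen_binding \<longleftrightarrow> \<bar>fst x\<bar> + \<bar>snd x\<bar> = 3/2" if x: "x \<in> octagon" for x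
  proof -
    obtain x\<^sub>1 x\<^sub>2 where xx: "x = (x\<^sub>1, x\<^sub>2)" by (cases x)
    note x' = x[unfolded xx]
    show ?thesis
      using page_map_in_topspace[OF x, of \<theta>] binding_fun_page_map[OF x', of \<theta>]
        quarter_radius_eq_iff(2)[OF octagon_quarter[OF x']]
      by (simp add: G_proj[OF x, unfolded xx] klassen_binding_eq xx)
  qed
  then have *: "klein_hole_boundary = {k \<in> topspace klein_hole. G k \<in> klassen_binding}"
    unfolding klein_hole_boundary_def topspace_klein_hole by (auto simp: case_prod_unfold)
  have sub: "klassen_binding \<subseteq> klassen_page_set \<theta>"
    by (auto simp: page_def)
  show ?thesis
    unfolding *
  proof (intro equalityI subsetI)
    fix k assume "k \<in> g ` klassen_binding"
    then show "k \<in> {k \<in> topspace klein_hole. G k \<in> klassen_binding}"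
      using sub G_g g_in_klein_hole by auto
  next
    fix k assume "k \<in> {k \<in> topspace klein_hole. G k \<in> klassen_binding}"
    then show "k \<in> g ` klassen_binding"
      using g_G by (intro image_eqI[of _ _ "G k"]) auto
  qed
qed

text \<open>This turns the boundary circle, the open collar and the complement of the collar into
  conditions on \<open>cmod (binding_fun (G k))\<close>.\<close>

lemma page_collar_image:
  assumes "A \<subseteq> {0..1}"
  shows "page_collar ` (sphere 0 1 \<times> A) =
    {k \<in> topspace klein_hole. \<exists>u\<in>A. cmod (binding_fun (G k)) = 3 / 16 * u}"
proof (intro equalityI subsetI)
  fix k assume "k \<in> page_collar ` (sphere 0 1 \<times> A)"
  then obtain w u where wu: "cmod w = 1" "u \<in> A" "k = g (page_tube (w, u))"
    by (auto simp: page_collar_def)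
  then have u: "0 \<le> u" "u \<le> 1" using assms by auto
  note t = page_tube_facts[OF wu(1) u]
  have "cmod (binding_fun (G k)) = 3 / 16 * u"
    unfolding wu(3) G_g[OF t(1)] t(2) by (rule norm_page_coord[OF u(1)])
  then show "k \<in> {k \<in> topspace klein_hole. \<exists>u\<in>A. cmod (binding_fun (G k)) = 3 / 16 * u}"
    using wu g_in_klein_hole[OF t(1)] by blast
next
  fix k assume "k \<in> {k \<in> topspace klein_hole. \<exists>u\<in>A. cmod (binding_fun (G k)) = 3 / 16 * u}"
  then obtain u where k: "k \<in> topspace klein_hole" and u: "u \<in> A" "cmod (binding_fun (G k)) = 3 / 16 * u"
    by blast
  then have "cmod (binding_fun (G k)) \<le> 3 / 16" using assms by auto
  then obtain w u' where wu: "cmod w = 1" "G k = page_tube (w, u')" "cmod (binding_fun (G k)) = 3 / 16 * u'"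
    using page_tube_surj[OF G_in_page[OF k]] by metis
  with u have "u' = u" by simp
  then have "k = page_collar (w, u)"
    using g_G[OF k] wu by (simp add: page_collar_def)
  then show "k \<in> page_collar ` (sphere 0 1 \<times> A)"
    using wu(1) u(1) by auto
qed

lemma collar_page_collar: "collar klein_hole klein_hole_boundary page_collar"
  unfolding collar_def
proof (intro conjI embedding_page_collar)
  show "page_collar ` (sphere 0 1 \<times> {0}) = klein_hole_boundary"
  proof -
    have "page_collar ` (sphere 0 1 \<times> {0}) = {k \<in> topspace klein_hole. binding_fun (G k) = 0}"
      by (subst page_collar_image) auto
    also have "\<dots> = g ` klassen_binding"
    proof (intro equalityI subsetI)
      fix k assume k: "k \<in> {k \<in> topspace klein_hole. binding_fun (G k) = 0}"
      then have "G k \<in> topspace klassen_space"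
        using G_in_page[of k] unfolding klassen_page_iff by blast
      with k have "G k \<in> klassen_binding"
        by (simp add: klassen_binding_eq)
      then show "k \<in> g ` klassen_binding"
        using k g_G[of k] by force
    next
      fix k assume "k \<in> g ` klassen_binding"
      then obtain c where c: "c \<in> klassen_binding" "k = g c" by blast
      then have "c \<in> klassen_page_set \<theta>" by (simp add: page_def)
      with c show "k \<in> {k \<in> topspace klein_hole. binding_fun (G k) = 0}"
        using G_g g_in_klein_hole by (simp add: klassen_binding_eq)
    qed
    finally show ?thesis by (simp only: binding_eq_boundary)
  qed
  have "continuous_map klein_hole euclidean (binding_fun \<circ> G)"
    using continuous_G by (intro continuous_map_compose[OF _ continuous_map_binding_fun])
      (simp add: continuous_map_in_subtopology)
  from openin_continuous_map_preimage[OF this, of "ball 0 (3/16)"]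
  have "openin klein_hole {k \<in> topspace klein_hole. cmod (binding_fun (G k)) < 3/16}"
    by simp
  moreover have "page_collar ` (sphere 0 1 \<times> {0..<1}) = {k \<in> topspace klein_hole. cmod (binding_fun (G k)) < 3/16}"
  proof -
    have "(\<exists>u\<in>{0..<1}. r = 3 / 16 * u) \<longleftrightarrow> r < 3/16" if "0 \<le> r" for r :: real
      using that by (auto intro!: bexI[of _ "16 / 3 * r"])
    then show ?thesis
      by (subst page_collar_image) auto
  qed
  ultimately show "openin klein_hole (page_collar ` (sphere 0 1 \<times> {0..<1}))"
    by simp
qed

text \<open>The tube takes \<open>- u\<close> to the point with \<open>v\<close> negated and
  \<open>w\<close> unchanged, so on the collar the involution is the antipodal map of the circle
  factor.\<close>

lemma klein_reflection_collar:
  assumes "cmod w = 1" "0 \<le> u" "u \<le> 1"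
  shows "klein_reflection (page_collar (w, u)) = page_collar (- w, u)"
proof -
  let ?c = "cis \<theta> * of_real (3 / 16 * u)"
  have c: "cmod ?c \<le> 3 / 16"
    using norm_page_coord[OF assms(2)] assms(3) by simp
  note t = page_tube_facts[OF assms]
  obtain v z where vz: "tube_model (w, ?c) = (v, z)" by fastforce
  have m: "(v, z) \<in> model"
    using tube_model_in_model[OF assms(1) c] by (simp only: vz)
  have k: "page_collar (w, u) \<in> topspace klein_hole"
    using g_in_klein_hole[OF t(1)] by (simp add: page_collar_def)
  have "G (page_collar (w, u)) = klassen_proj (v, z)"
    unfolding page_collar_def o_def G_g[OF t(1)]
    by (simp only: page_tube_def case_prod_conv klassen_tube_def vz)
  note r = klein_reflection_identification[OF k m this]
  have "klassen_proj (- v, z) = page_tube (- w, u)"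
    by (simp only: page_tube_def case_prod_conv klassen_tube_def tube_model_uminus[OF assms(1) c] vz fst_conv snd_conv)
  then show ?thesis
    using g_G[OF r(1)] r(2) by (simp add: page_collar_def)
qed

text \<open>The direction \<open>-1\<close> is the one realised by the flow: it sends
  \<open>- w\<close> to \<open>- w * cis (- pi * (1 - u)) = w * cis (pi * u)\<close>, while the
  opposite direction would give \<open>w * cis (- pi * u)\<close>.\<close>

definition crosscap_slide :: "(real \<times> real) set \<Rightarrow> (real \<times> real) set" where
  "crosscap_slide = restrict (half_twist page_collar (-1) \<circ> klein_reflection) (topspace klein_hole)"

lemma Y_homeomorphism_crosscap_slide: "Y_homeomorphism crosscap_slide"
  unfolding Y_homeomorphism_def
  by (intro exI[of _ page_collar] exI[of _ "-1 :: real"])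
    (auto simp: collar_page_collar klein_reflection_collar crosscap_slide_def)

text \<open>After one turn the flow of \<open>linear_profile\<close> moves \<open>page_tube (w, u)\<close> to
  \<open>page_tube (w * cis (pi * u), u)\<close>, which is the half twist of \<open>page_tube (- w, u)\<close>.\<close>

lemma return_map_eq_crosscap_slide:
  assumes k: "k \<in> topspace klein_hole"
  shows "g (klassen_flow linear_profile (2 * pi) (G k)) = crosscap_slide k"
proof (cases "cmod (binding_fun (G k)) \<le> 3/16")
  case True
  obtain w u where wu: "cmod w = 1" "0 \<le> u" "u \<le> 1" "G k = page_tube (w, u)"
    using page_tube_surj[OF G_in_page[OF k] True] by metis
  let ?c = "cis \<theta> * of_real (3 / 16 * u)"
  have c: "cmod ?c \<le> 3 / 16" "cmod ?c = 3 / 16 * u"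
    using norm_page_coord[OF wu(2)] wu(3) by simp_all
  have "klassen_flow linear_profile (2 * pi) (G k) =
      klassen_tube (w * cis ((1 - linear_profile (cmod ?c)) * (2 * pi) / 2), cis (2 * pi) * ?c)"
    unfolding wu(4) page_tube_def case_prod_conv by (rule klassen_flow_tube[OF wu(1) c(1)])
  also have "\<dots> = page_tube (w * cis (pi * u), u)"
  proof -
    have "cis (2 * pi) = 1" by simp
    then show ?thesis
      unfolding c(2) by (simp add: linear_profile_def page_tube_def mult.commute[of u])
  qed
  finally have L: "g (klassen_flow linear_profile (2 * pi) (G k)) = page_collar (w * cis (pi * u), u)"
    by (simp add: page_collar_def)
  have kc: "k = page_collar (w, u)"
    using g_G[OF k] wu(4) by (simp add: page_collar_def)
  have r: "klein_reflection k = page_collar (- w, u)"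
    unfolding kc by (rule klein_reflection_collar[OF wu(1-3)])
  have dom: "(- w, u) \<in> collar_domain" using wu by simp
  then have "half_twist page_collar (-1) (page_collar (- w, u)) = page_collar (- w * cis (- 1 * pi * (1 - u)), u)"
    unfolding half_twist_def using inv_into_f_f[OF inj_on_page_collar dom] by simp
  also have "- w * cis (- 1 * pi * (1 - u)) = w * cis (pi * u)"
  proof -
    have "cis (- 1 * pi * (1 - u)) = cis (pi * u - pi)"
      by (simp add: algebra_simps)
    also have "\<dots> = - cis (pi * u)"
      by (simp flip: cis_divide)
    finally show ?thesis by simp
  qed
  finally show ?thesis
    using k r L by (simp add: crosscap_slide_def)
next
  case False
  have Gk: "G k \<in> topspace klassen_space"
    using G_in_page[OF k] by (simp add: klassen_page_iff)
  then obtain v w where vw: "(v, w) \<in> model" "G k = klassen_proj (v, w)"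
    unfolding topspace_klassen_space by auto
  note r = klein_reflection_identification[OF k vw]
  have b: "cmod (binding_coord (v, w)) > 3/16"
    using False vw by (simp add: binding_fun_proj)
  have "klassen_flow linear_profile (2 * pi) (G k) = klassen_proj (- v, w)"
    using vw(1) by (simp add: vw(2) klassen_flow_proj flow_model_outside[OF b])
  then have L: "g (klassen_flow linear_profile (2 * pi) (G k)) = klein_reflection k"
    using g_G[OF r(1)] r(2) by simp
  have "(- v, w) \<in> model" using vw(1) by auto
  then have "binding_fun (G (klein_reflection k)) = binding_coord (- v, w)"
    unfolding r(2) by (rule binding_fun_proj)
  then have "cmod (binding_fun (G (klein_reflection k))) > 3/16"
    using b by (simp add: binding_coord_def)
  then have "klein_reflection k \<notin> page_collar ` collar_domain"
    by (subst page_collar_image) auto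
  then show ?thesis
    using k L by (simp add: crosscap_slide_def half_twist_def)
qed

lemma transport_monodromy:
  "transport_class klein_hole g G (mapping_class page_top klassen_binding (klassen_flow linear_profile (2 * pi))) =
   mapping_class klein_hole klein_hole_boundary crosscap_slide"
proof -
  let ?f = "klassen_flow linear_profile (2 * pi)"
  note nf = normalized_klassen_flow[OF flow_profile_linear]
  have "restrict ?f (topspace page_top) \<in> homeos_fixing page_top klassen_binding"
    using nf by (intro restrict_in_homeos_fixing klassen.binding_subset_page klassen.homeomorphic_map_normalized_flow)
      (auto simp: normalized_flow_def)
  then have "transport_class klein_hole g G (mapping_class page_top klassen_binding ?f) =
      mapping_class klein_hole (g ` klassen_binding) (g \<circ> ?f \<circ> G)"
    by (rule transport_mapping_class[OF hom klassen.binding_subset_page])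
  also have "\<dots> = mapping_class klein_hole klein_hole_boundary crosscap_slide"
    unfolding binding_eq_boundary
    by (rule mapping_class_cong) (simp add: return_map_eq_crosscap_slide)
  finally show ?thesis .
qed

end

theorem theorem3p1:
  fixes s :: real
  shows "\<exists>\<mu> g g' y.
    is_monodromy klassen_space klassen_binding klassen_fibration (exp (2 * pi * \<i> * s)) \<mu> \<and>
    homeomorphic_maps (klassen_page s) klein_hole g g' \<and>
    g ` klassen_binding = klein_hole_boundary \<and>
    Y_homeomorphism y \<and>
    transport_class klein_hole g g' \<mu> = mapping_class klein_hole klein_hole_boundary y"
proof -
  have cis: "exp (2 * pi * \<i> * s) = cis (2 * pi * s)"
    by (simp add: cis_conv_exp mult_ac)
  obtain G where G: "homeomorphic_map klein_hole (subtopology klassen_space (klassen_page_set (2 * pi * s))) G"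
      "\<And>x. x \<in> octagon \<Longrightarrow> G (klein_proj x) = page_map (2 * pi * s) x"
    using page_identification_ex[of "2 * pi * s"] by blast
  then obtain g where "homeomorphic_maps (subtopology klassen_space (klassen_page_set (2 * pi * s))) klein_hole g G"
    using homeomorphic_map_maps homeomorphic_maps_sym by metis
  with G(2) interpret klassen_identification "2 * pi * s" G g
    by unfold_locales
  have "is_monodromy klassen_space klassen_binding klassen_fibration (exp (2 * pi * \<i> * s))
      (mapping_class page_top klassen_binding (klassen_flow linear_profile (2 * pi)))"
    unfolding cis
    by (rule klassen.is_monodromy_normalized_flow[OF open_book_flow_klassen_flow normalized_klassen_flow[OF flow_profile_linear]])
  moreover have "homeomorphic_maps (klassen_page s) klein_hole g G"
    using hom unfolding klassen_page_def cis .
  ultimately show ?thesis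
    using binding_eq_boundary Y_homeomorphism_crosscap_slide transport_monodromy by blast
qed

end
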